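(* Let $a,b$ be integers such that $f(x)=x^7+ax+b$ is irreducible over $\mathbb{Q}$, let $\theta$ be a root of $f(x)$ and $K=\mathbb{Q}(\theta)$. If $p\ge 5$ is a rational prime, then $p\nmid i(K)$.
   Context: For a number field $K$ with ring of integers $\mathbb{O}_K$ and $\alpha\in\mathbb{O}_K$ with $K=\mathbb{Q}(\alpha)$, $\operatorname{ind}\alpha=[\mathbb{O}_K:\mathbb{Z}[\alpha]]$. The index of the field $K$ is $i(K)=\gcd\{\operatorname{ind}\alpha \mid \alpha\in\mathbb{O}_K,\ K=\mathbb{Q}(\alpha)\}$. *)

theory Defs
  imports "HOL-Computational_Algebra.Computational_Algebra"
begin

text \<open>
  Number fields are represented as subsets of an arbitrary field of characteristic zero
  (for instance the complex numbers), given as a type.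
\<close>

definition subfield :: "'a::field_char_0 set \<Rightarrow> bool" where
  "subfield K \<longleftrightarrow>
     0 \<in> K \<and> 1 \<in> K \<and>
     (\<forall>x\<in>K. \<forall>y\<in>K. x + y \<in> K \<and> x * y \<in> K) \<and>
     (\<forall>x\<in>K. - x \<in> K \<and> inverse x \<in> K)"

text \<open>\<open>\<rat>(\<alpha>)\<close>; the rationals need not be mentioned because every subfield contains them.\<close>

definition rat_adjoin :: "'a::field_char_0 \<Rightarrow> 'a set" where
  "rat_adjoin \<alpha> = subfield hull {\<alpha>}"

definition int_adjoin :: "'a::field_char_0 \<Rightarrow> 'a set" where
  "int_adjoin \<alpha> = range (\<lambda>g :: int poly. poly (map_poly of_int g) \<alpha>)"

definition ring_of_integers :: "'a::field_char_0 set \<Rightarrow> 'a set" where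
  "ring_of_integers K = {x \<in> K. algebraic_int x}"

text \<open>
  The index \<open>[\<O>\<^sub>K : \<int>[\<alpha>]]\<close> of additive groups, as the number of cosets \<open>x + \<int>[\<alpha>]\<close>
  with \<open>x \<in> \<O>\<^sub>K\<close>. It is intended for an algebraic integer \<open>\<alpha>\<close> of a number field
  \<open>K = \<rat>(\<alpha>)\<close>; the index is then finite, so that \<open>card\<close> is the true cardinality.
\<close>

definition index_of_element :: "'a::field_char_0 set \<Rightarrow> 'a \<Rightarrow> nat" where
  "index_of_element K \<alpha> =
     card ((\<lambda>x. {x + z | z. z \<in> int_adjoin \<alpha>}) ` ring_of_integers K)"

definition field_index :: "'a::field_char_0 set \<Rightarrow> nat" where
  "field_index K =
     Gcd {index_of_element K \<alpha> | \<alpha>. \<alpha> \<in> ring_of_integers K \<and> K = rat_adjoin \<alpha>}"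

end

(*
  Localize at p: let R be the ring of integers of K and J the intersection of its maximal ideals
  containing p. If there is x with R = Z[x] + pR, then R/Z[x] is a finite group on which p acts
  surjectively, so p does not divide the index of x; and K = Q(x).

  To find x, choose generators of the residue fields that have distinct minimal polynomials; by the
  Chinese remainder theorem this gives R = Z[x] + J. Moving x inside its class modulo J, one reaches
  J = (x^q - x)R + pR for a power q of p, because J is principal modulo p. Then R = Z[x] + pR follows
  since J is nilpotent modulo p.

  The residue fields other than Z/p cause no trouble for p >= 5 in degree 7, so the only obstruction
  would be more than p primes of residue degree one. For p >= 7 there are at most 7. For p = 5, six
  such primes would include five unramified ones (otherwise sum e f > 7), hence five distinct roots
  of x^7 + ax + b in Z_5; but then some complete homogeneous symmetric polynomials vanish at them,
  and modulo 5 these have no common zero except the origin.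
*)
theory Submission
  imports
    Defs
    "HOL-Computational_Algebra.Field_as_Ring"
    "HOL-Algebra.Multiplicative_Group"
    "HOL-Algebra.QuotRing"
    "HOL-Algebra.Sylow"
    "Jordan_Normal_Form.Char_Poly"
begin

hide_const (open) up_ring.monom up_ring.coeff

section \<open>Five approximate roots of a septic trinomial\<close>

text \<open>A prime of residue degree one sees a generator only through a residue in Z/p, and these
  residues must differ from prime to prime: hence the bound p on the number of such primes. That
  \<open>J\<close> is principal modulo p is where integral closedness enters; it makes every prime
  over p locally principal. The k-th divided difference of x^7 at k + 1 points is h_(7-k), and from
  the second one on the part a x + b has disappeared. So a and b leave no trace, and three, four and
  five roots make h_5, h_4 and h_3 vanish. No completion is built. Roots in Z_5 become integers that
  are roots modulo a power of 5; each division by a difference of roots costs precision, which has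
  to be budgeted in advance. The formula for sum e f is not proved either: two weaker counts
  suffice, one giving an extra unit to each prime with f > 1, the other to each prime with e >
  1.\<close>

fun complete_hom :: "nat \<Rightarrow> int list \<Rightarrow> int" where
  "complete_hom 0 xs = 1"
| "complete_hom (Suc k) [] = 0"
| "complete_hom (Suc k) (x # xs) = x * complete_hom k (x # xs) + complete_hom (Suc k) xs"

text \<open>Expanding twice gives \<open>(x + y) * H - x * y * A\<close> plus a part free of x and
  y, where \<open>H\<close> and \<open>A\<close> are the values at k - 1 and k - 2; strong induction
  makes these two symmetric. Exchanging the first two entries is all the symmetry that divided
  differences need.\<close>

lemma complete_hom_swap: "complete_hom k (x # y # xs) = complete_hom k (y # x # xs)"
proof (induction k rule: less_induct)
  case (less k)
  show ?case
  proof (cases k)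
    case (Suc m)
    show ?thesis
    proof (cases m)
      case 0
      then show ?thesis using Suc by simp
    next
      case (Suc j)
      define A H where "A = complete_hom j (x # y # xs)" and "H = complete_hom m (x # y # xs)"
      have A': "complete_hom j (y # x # xs) = A" and H': "complete_hom m (y # x # xs) = H"
        using less \<open>k = Suc m\<close> Suc by (simp_all add: A_def H_def del: complete_hom.simps)
      have "H = x * A + complete_hom m (y # xs)" unfolding H_def A_def Suc by simp
      then have 1: "complete_hom m (y # xs) = H - x * A" by simp
      have "H = y * A + complete_hom m (x # xs)" unfolding H'[symmetric] A'[symmetric] Suc by simp
      then have 2: "complete_hom m (x # xs) = H - y * A" by simp
      have "x * H + y * complete_hom m (y # xs) = y * H + x * complete_hom m (x # xs)"
        unfolding 1 2 by (simp add: algebra_simps)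
      moreover have "complete_hom k (x # y # xs) = x * H + (y * complete_hom m (y # xs) + complete_hom k xs)"
        unfolding H_def \<open>k = Suc m\<close> by simp
      moreover have "complete_hom k (y # x # xs) = y * H + (x * complete_hom m (x # xs) + complete_hom k xs)"
        unfolding H'[symmetric] \<open>k = Suc m\<close> by simp
      ultimately show ?thesis by simp
    qed
  qed simp
qed

text \<open>Divided difference formula: expand the value at \<open>x # y # xs\<close> once along x
  and once along y, and compare.\<close>

lemma complete_hom_diff:
  "complete_hom (Suc k) (x # xs) - complete_hom (Suc k) (y # xs) = (x - y) * complete_hom k (x # y # xs)"
proof -
  have "x * complete_hom k (x # y # xs) + complete_hom (Suc k) (y # xs) =
      y * complete_hom k (y # x # xs) + complete_hom (Suc k) (x # xs)"
    using complete_hom_swap[of "Suc k" x y xs] by (simp only: complete_hom.simps(3)[of k x "y # xs"] complete_hom.simps(3)[of k y "x # xs"])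
  then show ?thesis unfolding complete_hom_swap[of k y x] by (simp add: algebra_simps del: complete_hom.simps)
qed

lemma complete_hom_scale: "complete_hom k (map ((*) c) xs) = c ^ k * complete_hom k xs"
  by (induction k xs rule: complete_hom.induct) (simp_all add: algebra_simps)

lemma complete_hom_mod: "complete_hom k (map (\<lambda>x. x mod m) xs) mod m = complete_hom k xs mod m"
proof (induction k xs rule: complete_hom.induct)
  case (3 k x xs)
  then show ?case
    unfolding list.map complete_hom.simps by (intro mod_add_cong mod_mult_cong) simp_all
qed simp_all

text \<open>Exhaustive check over the field with five elements. Each condition stands before the
  next quantifier, so a tuple that fails need not be extended.\<close>

lemma vanishing_mod_5_residues:
  "\<forall>x\<in>{0,1,2,3,4}. \<forall>y\<in>{0,1,2,3,4}. \<forall>z\<in>{0,1,2,3,4}. complete_hom 5 [x, y, z] mod 5 = 0 \<longrightarrow>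
    (\<forall>u\<in>{0,1,2,3,4}. complete_hom 4 [x, y, z, u] mod 5 = 0 \<longrightarrow>
      (\<forall>v\<in>{0,1,2,3,4}. complete_hom 3 [x, y, z, u, v] mod 5 = 0 \<longrightarrow>
        x = 0 \<and> y = 0 \<and> z = 0 \<and> u = 0 \<and> v = 0))"
  by code_simp

lemma vanishing_mod_5:
  assumes "5 dvd complete_hom 5 [x, y, z]" "5 dvd complete_hom 4 [x, y, z, u]"
    "5 dvd complete_hom 3 [x, y, z, u, v]"
  shows "\<forall>t\<in>set [x, y, z, u, v]. 5 dvd t"
proof -
  have r: "t mod 5 \<in> {0,1,2,3,4}" for t :: int
    using pos_mod_bound[of 5 t] pos_mod_sign[of 5 t] by auto
  have h: "complete_hom 5 [x mod 5, y mod 5, z mod 5] mod 5 = 0"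
    "complete_hom 4 [x mod 5, y mod 5, z mod 5, u mod 5] mod 5 = 0"
    "complete_hom 3 [x mod 5, y mod 5, z mod 5, u mod 5, v mod 5] mod 5 = 0"
    using assms complete_hom_mod[of 5 5 "[x, y, z]"] complete_hom_mod[of 4 5 "[x, y, z, u]"]
      complete_hom_mod[of 3 5 "[x, y, z, u, v]"] by (simp_all only: list.map dvd_eq_mod_eq_0)
  have "x mod 5 = 0 \<and> y mod 5 = 0 \<and> z mod 5 = 0 \<and> u mod 5 = 0 \<and> v mod 5 = 0"
    using vanishing_mod_5_residues[rule_format, OF r r r h(1) r h(2) r h(3)] by simp
  then show ?thesis by (simp add: dvd_eq_mod_eq_0)
qed

text \<open>Descent of depth m: all five entries are divisible by 5, and by homogeneity dividing
  them by 5 divides h_k by 5^k. As k is at most 5, one round uses up at most 5^5, whence the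
  exponent \<open>5 * m\<close>.\<close>

lemma vanishing_mod_5_power:
  assumes "5 ^ (5 * m) dvd complete_hom 5 [x, y, z]" "5 ^ (5 * m) dvd complete_hom 4 [x, y, z, u]"
    "5 ^ (5 * m) dvd complete_hom 3 [x, y, z, u, v]"
  shows "\<forall>t\<in>set [x, y, z, u, v]. 5 ^ m dvd t"
  using assms
proof (induction m arbitrary: x y z u v)
  case (Suc m)
  have "(5::int) dvd 5 ^ (5 * Suc m)" by simp
  note 5 = dvd_trans[OF this]
  have dvd: "\<forall>t\<in>set [x, y, z, u, v]. 5 dvd t"
    by (rule vanishing_mod_5) (rule 5, rule Suc.prems)+
  define x' y' z' u' v' where "x' = x div 5" "y' = y div 5" "z' = z div 5" "u' = u div 5" "v' = v div 5"
  then have e: "x = 5 * x'" "y = 5 * y'" "z = 5 * z'" "u = 5 * u'" "v = 5 * v'"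
    using dvd by simp_all
  have scale: "5 ^ (5 * m) dvd complete_hom k ts" if "5 ^ (5 * Suc m) dvd complete_hom k (map ((*) 5) ts)" "k \<le> 5" for k ts
  proof -
    have "(5::int) ^ k dvd 5 ^ 5" using that(2) by (rule le_imp_power_dvd)
    then have "5 ^ k * complete_hom k ts dvd 5 ^ 5 * complete_hom k ts" by (rule mult_dvd_mono) simp
    then have "5 ^ 5 * 5 ^ (5 * m) dvd 5 ^ 5 * complete_hom k ts"
      using that(1) dvd_trans unfolding complete_hom_scale by (simp only: mult_Suc_right power_add) blast
    then show ?thesis by simp
  qed
  have "\<forall>t\<in>set [x', y', z', u', v']. 5 ^ m dvd t"
    using Suc.prems unfolding e by (intro Suc.IH scale) (simp_all only: list.map)
  then show ?case unfolding e by simp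
qed simp

lemma prime_power_dvd_mult_cancel:
  fixes d e :: int
  assumes "prime q" "q ^ k dvd d * e" "\<not> q ^ m dvd d"
  shows "q ^ (k - m) dvd e"
proof (cases "e = 0")
  case False
  have d: "d \<noteq> 0" using assms(3) by auto
  have "k \<le> multiplicity q (d * e)"
    using assms(1,2) d False by (intro multiplicity_geI) auto
  also have "\<dots> = multiplicity q d + multiplicity q e"
    using assms(1) d False by (intro prime_elem_multiplicity_mult_distrib) auto
  finally have "k \<le> multiplicity q d + multiplicity q e" .
  moreover have "multiplicity q d < m"
    using assms(3) by (meson not_le_imp_less multiplicity_dvd')
  ultimately show ?thesis by (intro multiplicity_dvd') auto
qed simp

text \<open>By divided differences, five roots force \<open>h\<^sub>5\<close>, \<open>h\<^sub>4\<close> and \<open>h\<^sub>3\<close> of three, four and five of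
  them to vanish \<open>5\<close>-adically.\<close>

lemma no_five_distinct_approximate_roots:
  fixes t :: "nat \<Rightarrow> int" and a b :: int
  assumes roots: "\<And>i. i < 5 \<Longrightarrow> 5 ^ (9 * m) dvd t i ^ 7 + a * t i + b"
    and dist: "\<And>i j. i < 5 \<Longrightarrow> j < 5 \<Longrightarrow> i \<noteq> j \<Longrightarrow> \<not> 5 ^ m dvd t i - t j"
  shows False
proof -
  have p5: "prime (5::int)" by simp
  have cancel: "5 ^ (k - m) dvd e" if "5 ^ k dvd (t i - t j) * e" "i < 5" "j < 5" "i \<noteq> j" for k e i j
    using prime_power_dvd_mult_cancel[OF p5 that(1) dist[OF that(2-4)]] .
  \<comment> \<open>The linear term of the trinomial contributes the constant a to the first
    difference; it cancels in \<open>d2\<close>.\<close>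
  have d1: "5 ^ (9 * m - m) dvd complete_hom 6 [t i, t j] + a" if ij: "i < 5" "j < 5" "i \<noteq> j" for i j
  proof (rule cancel[OF _ ij])
    have "5 ^ (9 * m) dvd (t i ^ 7 + a * t i + b) - (t j ^ 7 + a * t j + b)"
      using roots ij by (intro dvd_diff)
    moreover have "complete_hom 7 [x] = x ^ 7" for x by (simp add: numeral_eq_Suc)
    then have "t i ^ 7 - t j ^ 7 = (t i - t j) * complete_hom 6 [t i, t j]"
      using complete_hom_diff[of 6 "t i" "[]" "t j"] by simp
    then have "(t i ^ 7 + a * t i + b) - (t j ^ 7 + a * t j + b) = (t i - t j) * (complete_hom 6 [t i, t j] + a)"
      by (simp only: distrib_left) (simp add: algebra_simps)
    ultimately show "5 ^ (9 * m) dvd (t i - t j) * (complete_hom 6 [t i, t j] + a)"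
      by simp
  qed
  have d2: "5 ^ (9 * m - m - m) dvd complete_hom 5 [t i, t j, t k]"
    if ij: "i < 5" "j < 5" "k < 5" "i \<noteq> j" "i \<noteq> k" "j \<noteq> k" for i j k
  proof (rule cancel[OF _ ij(1,2,4)])
    have "5 ^ (9 * m - m) dvd (complete_hom 6 [t i, t k] + a) - (complete_hom 6 [t j, t k] + a)"
      using d1 ij by (intro dvd_diff) auto
    then show "5 ^ (9 * m - m) dvd (t i - t j) * complete_hom 5 [t i, t j, t k]"
      using complete_hom_diff[of 5 "t i" "[t k]" "t j"] by simp
  qed
  have d3: "5 ^ (9 * m - m - m - m) dvd complete_hom 4 [t i, t j, t k, t l]"
    if ij: "i < 5" "j < 5" "k < 5" "l < 5" "i \<noteq> j" "i \<noteq> k" "j \<noteq> k" "i \<noteq> l" "j \<noteq> l" "k \<noteq> l" for i j k l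
  proof (rule cancel[OF _ ij(1,2,5)])
    have "5 ^ (9 * m - m - m) dvd complete_hom 5 [t i, t k, t l] - complete_hom 5 [t j, t k, t l]"
      using d2 ij by (intro dvd_diff) auto
    then show "5 ^ (9 * m - m - m) dvd (t i - t j) * complete_hom 4 [t i, t j, t k, t l]"
      using complete_hom_diff[of 4 "t i" "[t k, t l]" "t j"] by simp
  qed
  have d4: "5 ^ (9 * m - m - m - m - m) dvd complete_hom 3 [t 0, t 1, t 2, t 3, t 4]"
  proof (rule cancel)
    have "5 ^ (9 * m - m - m - m) dvd complete_hom 4 [t 0, t 2, t 3, t 4] - complete_hom 4 [t 1, t 2, t 3, t 4]"
      using d3 by (intro dvd_diff) auto
    then show "5 ^ (9 * m - m - m - m) dvd (t 0 - t 1) * complete_hom 3 [t 0, t 1, t 2, t 3, t 4]"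
      using complete_hom_diff[of 3 "t 0" "[t 2, t 3, t 4]" "t 1"] by simp
  qed auto
  \<comment> \<open>At most four cancellations, each costing m, leave at least \<open>5 * m\<close>
    out of \<open>9 * m\<close>: the precision that the descent needs.\<close>
  have le: "(5::int) ^ (5 * m) dvd 5 ^ (9 * m - m - m)" "(5::int) ^ (5 * m) dvd 5 ^ (9 * m - m - m - m)"
    "(5::int) ^ (5 * m) dvd 5 ^ (9 * m - m - m - m - m)"
    by (auto intro!: le_imp_power_dvd)
  have "\<forall>s\<in>set [t 0, t 1, t 2, t 3, t 4]. 5 ^ m dvd s"
  proof (rule vanishing_mod_5_power)
    show "5 ^ (5 * m) dvd complete_hom 5 [t 0, t 1, t 2]" using d2[of 0 1 2] le(1) by (auto intro: dvd_trans)
    show "5 ^ (5 * m) dvd complete_hom 4 [t 0, t 1, t 2, t 3]" using d3[of 0 1 2 3] le(2) by (auto intro: dvd_trans)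
    show "5 ^ (5 * m) dvd complete_hom 3 [t 0, t 1, t 2, t 3, t 4]" using d4 le(3) by (auto intro: dvd_trans)
  qed
  then have "5 ^ m dvd t 0 - t 1" by (intro dvd_diff) auto
  then show False using dist[of 0 1] by simp
qed

section \<open>Primes over \<open>p\<close> in an order that is maximal at \<open>p\<close>\<close>

definition ev :: "int poly \<Rightarrow> 'a::field_char_0 \<Rightarrow> 'a" where
  "ev h x = poly (map_poly of_int h) x"

lemma ev_0 [simp]: "ev 0 x = 0"
  and ev_1 [simp]: "ev 1 x = 1"
  and ev_pCons [simp]: "ev (pCons c h) x = of_int c + x * ev h x"
  and ev_add [simp]: "ev (g + h) x = ev g x + ev h x"
  and ev_diff [simp]: "ev (g - h) x = ev g x - ev h x"
  and ev_mult [simp]: "ev (g * h) x = ev g x * ev h x"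
  by (simp_all add: ev_def map_poly_pCons hom_distribs)

lemma ev_smult [simp]: "ev (Polynomial.smult c h) x = of_int c * ev h x"
  by (induction h) (simp_all add: algebra_simps)

lemma ev_power [simp]: "ev (g ^ k) x = ev g x ^ k"
  by (induction k) auto

lemma ev_sum [simp]: "ev (sum g A) x = (\<Sum>i\<in>A. ev (g i) x)"
  by (induction A rule: infinite_finite_induct) auto

lemma ev_prod [simp]: "ev (prod g A) x = (\<Prod>i\<in>A. ev (g i) x)"
  by (induction A rule: infinite_finite_induct) auto

lemma ev_monom [simp]: "ev (monom c k) x = of_int c * x ^ k"
  by (simp add: ev_def map_poly_monom poly_monom)

lemma eq_if_dvd_diff: "int p dvd a - b \<Longrightarrow> 0 \<le> a \<Longrightarrow> a < int p \<Longrightarrow> 0 \<le> b \<Longrightarrow> b < int p \<Longrightarrow> a = b"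
  by (metis mod_eq_dvd_iff mod_pos_pos_trivial)

lemma diff_dvd_poly_diff: "(x - y :: int) dvd poly h x - poly h y"
proof (induction h)
  case (pCons c h)
  have "poly (pCons c h) x - poly (pCons c h) y = (x - y) * poly h x + y * (poly h x - poly h y)"
    by (simp add: algebra_simps)
  then show ?case using pCons.IH by (metis dvd_add dvd_mult dvd_triv_left)
qed simp

lemma ev_of_int: "ev h (of_int m) = of_int (poly h m)"
  by (induction h) simp_all

text \<open>Collects what is needed of a ring of integers near p. Maximality at p is expressed by
  \<open>bounded_powers\<close>, a form of complete integral closedness. The assumption
  \<open>rank\<close> says that R/pR has dimension at most n over Z/p: n + 1 elements satisfy a
  relation that stays nontrivial modulo p.\<close>

locale p_maximal_order =
  fixes R :: "'a::field_char_0 set" and p n :: nat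
  assumes zero_mem [simp, intro]: "0 \<in> R" and one_mem [simp, intro]: "1 \<in> R"
    and add_mem [intro]: "x \<in> R \<Longrightarrow> y \<in> R \<Longrightarrow> x + y \<in> R"
    and uminus_mem [intro]: "x \<in> R \<Longrightarrow> - x \<in> R"
    and mult_mem [intro]: "x \<in> R \<Longrightarrow> y \<in> R \<Longrightarrow> x * y \<in> R"
    and prime_p: "prime p"
    and finite_mod_p: "\<exists>T. finite T \<and> T \<subseteq> R \<and> (\<forall>x\<in>R. \<exists>t\<in>T. \<exists>y\<in>R. x = t + of_nat p * y)"
    and bounded_powers: "(\<And>k. of_nat p * x ^ k \<in> R) \<Longrightarrow> x \<in> R"
    and rank: "(\<And>i. i \<le> n \<Longrightarrow> z i \<in> R) \<Longrightarrow>
      \<exists>c :: nat \<Rightarrow> int. (\<Sum>i\<le>n. of_int (c i) * z i) = 0 \<and> (\<exists>i\<le>n. \<not> int p dvd c i)"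
begin

lemma diff_mem [intro]: "x \<in> R \<Longrightarrow> y \<in> R \<Longrightarrow> x - y \<in> R"
  using add_mem[OF _ uminus_mem, of x y] by simp

lemma of_nat_mem [simp, intro]: "of_nat k \<in> R"
  by (induction k) auto

lemma of_int_mem [simp, intro]: "of_int k \<in> R"
  by (cases k) (auto simp del: of_nat_Suc)

lemma power_mem [intro]: "x \<in> R \<Longrightarrow> x ^ k \<in> R"
  by (induction k) auto

lemma sum_mem: "(\<And>i. i \<in> A \<Longrightarrow> g i \<in> R) \<Longrightarrow> sum g A \<in> R"
  by (induction A rule: infinite_finite_induct) auto

lemma prod_mem: "(\<And>i. i \<in> A \<Longrightarrow> g i \<in> R) \<Longrightarrow> prod g A \<in> R"
  by (induction A rule: infinite_finite_induct) auto

lemma p_gt_1: "p > 1"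
  using prime_p prime_gt_1_nat by blast

lemma p_nonzero [simp]: "p \<noteq> 0"
  using p_gt_1 by simp

section \<open>Ideals of R that contain p\<close>

definition is_ideal :: "'a set \<Rightarrow> bool" where
  "is_ideal I \<longleftrightarrow> I \<subseteq> R \<and> 0 \<in> I \<and> (\<forall>x\<in>I. \<forall>y\<in>I. x + y \<in> I) \<and> (\<forall>r\<in>R. \<forall>x\<in>I. r * x \<in> I)"

definition pR :: "'a set" where
  "pR = (\<lambda>y. of_nat p * y) ` R"

definition primes :: "'a set set" where
  "primes = {P. is_ideal P \<and> of_nat p \<in> P \<and> 1 \<notin> P \<and> (\<forall>I. is_ideal I \<and> P \<subseteq> I \<and> 1 \<notin> I \<longrightarrow> I = P)}"

lemma ideal_subset: "is_ideal I \<Longrightarrow> x \<in> I \<Longrightarrow> x \<in> R"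
  by (auto simp: is_ideal_def)

lemma ideal_zero: "is_ideal I \<Longrightarrow> 0 \<in> I"
  by (auto simp: is_ideal_def)

lemma ideal_add: "is_ideal I \<Longrightarrow> x \<in> I \<Longrightarrow> y \<in> I \<Longrightarrow> x + y \<in> I"
  by (auto simp: is_ideal_def)

lemma ideal_mult: "is_ideal I \<Longrightarrow> r \<in> R \<Longrightarrow> x \<in> I \<Longrightarrow> r * x \<in> I"
  by (auto simp: is_ideal_def)

lemma ideal_mult': "is_ideal I \<Longrightarrow> r \<in> R \<Longrightarrow> x \<in> I \<Longrightarrow> x * r \<in> I"
  by (metis ideal_mult mult.commute)

lemma ideal_uminus: "is_ideal I \<Longrightarrow> x \<in> I \<Longrightarrow> - x \<in> I"
  using ideal_mult[of I "- 1" x] by auto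

lemma ideal_diff: "is_ideal I \<Longrightarrow> x \<in> I \<Longrightarrow> y \<in> I \<Longrightarrow> x - y \<in> I"
  using ideal_add[of I x "- y"] ideal_uminus[of I y] by simp

lemma ideal_sum: "is_ideal I \<Longrightarrow> (\<And>i. i \<in> A \<Longrightarrow> g i \<in> I) \<Longrightarrow> sum g A \<in> I"
  by (induction A rule: infinite_finite_induct) (auto simp: ideal_zero ideal_add)

lemma ideal_prod:
  assumes "is_ideal I" "finite A" "j \<in> A" "g j \<in> I" "\<And>i. i \<in> A \<Longrightarrow> g i \<in> R"
  shows "prod g A \<in> I"
proof -
  have "prod g A = prod g (A - {j}) * g j"
    using assms(2,3) by (simp add: prod.remove mult.commute)
  moreover have "prod g (A - {j}) \<in> R" using assms(5) by (intro prod_mem) auto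
  ultimately show ?thesis using assms(1,4) ideal_mult by simp
qed

lemma ideal_add_iff: "is_ideal I \<Longrightarrow> y \<in> I \<Longrightarrow> x + y \<in> I \<longleftrightarrow> x \<in> I"
  using ideal_diff[of I "x + y" y] ideal_add by auto

lemma is_ideal_pR: "is_ideal pR"
proof -
  have "\<exists>z\<in>R. of_nat p * x + of_nat p * y = of_nat p * z" if "x \<in> R" "y \<in> R" for x y
    using that by (intro bexI[of _ "x + y"]) (auto simp: algebra_simps)
  moreover have "\<exists>z\<in>R. r * (of_nat p * x) = of_nat p * z" if "x \<in> R" "r \<in> R" for x r
    using that by (intro bexI[of _ "r * x"]) (auto simp: algebra_simps)
  ultimately show ?thesis
    by (auto simp: is_ideal_def pR_def image_iff)
qed

lemma pR_I [intro]: "y \<in> R \<Longrightarrow> of_nat p * y \<in> pR"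
  by (auto simp: pR_def)

lemma p_in_pR: "of_nat p \<in> pR"
  using pR_I[of 1] by simp

lemma pR_subset: "is_ideal I \<Longrightarrow> of_nat p \<in> I \<Longrightarrow> pR \<subseteq> I"
  using ideal_mult' by (auto simp: pR_def)

text \<open>An ideal containing p is a union of classes modulo p, hence determined by its trace on a
  finite set of representatives.\<close>

lemma finite_ideals: "finite {I. is_ideal I \<and> of_nat p \<in> I}"
proof -
  obtain T where T: "finite T" "T \<subseteq> R" "\<And>x. x \<in> R \<Longrightarrow> \<exists>t\<in>T. \<exists>y\<in>R. x = t + of_nat p * y"
    using finite_mod_p by blast
  have "inj_on (\<lambda>I. I \<inter> T) {I. is_ideal I \<and> of_nat p \<in> I}"
  proof (rule inj_onI)
    have *: "I \<subseteq> I'" if I: "is_ideal I" "of_nat p \<in> I" "is_ideal I'" "of_nat p \<in> I'" "I \<inter> T = I' \<inter> T" for I I'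
    proof
      fix x assume x: "x \<in> I"
      then obtain t y where t: "t \<in> T" "y \<in> R" "x = t + of_nat p * y"
        using T(3) ideal_subset I(1) by blast
      have py: "of_nat p * y \<in> I" "of_nat p * y \<in> I'" using t I ideal_mult' by auto
      have "t \<in> I" using py x t I(1) ideal_add_iff by auto
      then have "t \<in> I'" using I t by auto
      then show "x \<in> I'" using t py I ideal_add by auto
    qed
    show "I = I'" if "I \<in> {I. is_ideal I \<and> of_nat p \<in> I}" "I' \<in> {I. is_ideal I \<and> of_nat p \<in> I}"
      "I \<inter> T = I' \<inter> T" for I I'
      using *[of I I'] *[of I' I] that by auto
  qed
  moreover have "finite ((\<lambda>I. I \<inter> T) ` {I. is_ideal I \<and> of_nat p \<in> I})"
    using T(1) by (auto intro: finite_subset[of _ "Pow T"])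
  ultimately show ?thesis using finite_imageD by blast
qed

lemma finite_primes: "finite primes"
  by (rule finite_subset[OF _ finite_ideals]) (auto simp: primes_def)

lemma prime_ideal: "P \<in> primes \<Longrightarrow> is_ideal P"
  and p_in_prime: "P \<in> primes \<Longrightarrow> of_nat p \<in> P"
  and one_notin_prime: "P \<in> primes \<Longrightarrow> 1 \<notin> P"
  by (auto simp: primes_def)

text \<open>Finiteness of the ideals over p supplies the maximal element, so no choice principle is
  needed.\<close>

lemma exists_prime:
  assumes "is_ideal I" "of_nat p \<in> I" "1 \<notin> I"
  shows "\<exists>P\<in>primes. I \<subseteq> P"
proof -
  let ?F = "{I. is_ideal I \<and> of_nat p \<in> I \<and> 1 \<notin> I}"
  have "finite ?F" by (rule finite_subset[OF _ finite_ideals]) auto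
  then obtain P where P: "P \<in> ?F" "I \<subseteq> P" "\<And>Q. Q \<in> ?F \<Longrightarrow> P \<subseteq> Q \<Longrightarrow> P = Q"
    using finite_has_maximal2[of ?F I] assms by auto
  have "P \<in> primes" using P by (auto simp: primes_def)
  then show ?thesis using P(2) by blast
qed

lemma is_ideal_sum:
  assumes "is_ideal I" "x \<in> R"
  shows "is_ideal {x * y + z | y z. y \<in> R \<and> z \<in> I}"
proof -
  have "\<exists>y' z'. x * y1 + z1 + (x * y2 + z2) = x * y' + z' \<and> y' \<in> R \<and> z' \<in> I"
    if "y1 \<in> R" "y2 \<in> R" "z1 \<in> I" "z2 \<in> I" for y1 y2 z1 z2
    using that assms by (intro exI[of _ "y1 + y2"] exI[of _ "z1 + z2"]) (auto simp: algebra_simps ideal_add)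
  moreover have "\<exists>y' z'. r * (x * y1 + z1) = x * y' + z' \<and> y' \<in> R \<and> z' \<in> I"
    if "y1 \<in> R" "z1 \<in> I" "r \<in> R" for y1 z1 r
    using that assms by (intro exI[of _ "r * y1"] exI[of _ "r * z1"]) (auto simp: algebra_simps ideal_mult)
  moreover have "\<exists>y' z'. 0 = x * y' + z' \<and> y' \<in> R \<and> z' \<in> I"
    using assms ideal_zero by (intro exI[of _ 0]) auto
  ultimately show ?thesis
    using assms by (auto simp: is_ideal_def[of "{x * y + z | y z. y \<in> R \<and> z \<in> I}"] dest: ideal_subset)
qed

lemma prime_inverse:
  assumes P: "P \<in> primes" and x: "x \<in> R" "x \<notin> P"
  shows "\<exists>y\<in>R. x * y - 1 \<in> P"
proof (rule ccontr)
  assume no: "\<not> ?thesis"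
  note iP = prime_ideal[OF P]
  let ?I = "{x * y + z | y z. y \<in> R \<and> z \<in> P}"
  have I: "is_ideal ?I" using is_ideal_sum iP x by blast
  have one: "1 \<notin> ?I"
  proof
    assume "1 \<in> ?I"
    then obtain y z where "y \<in> R" "z \<in> P" "1 = x * y + z" by auto
    then have "x * y - 1 = - z" by (simp add: algebra_simps)
    then show False using no \<open>y \<in> R\<close> \<open>z \<in> P\<close> ideal_uminus[OF iP] by metis
  qed
  have PI: "P \<subseteq> ?I"
  proof
    fix z assume "z \<in> P"
    then have "z = x * 0 + z \<and> 0 \<in> R \<and> z \<in> P" by simp
    then show "z \<in> ?I" by blast
  qed
  have "x \<in> ?I"
  proof -
    have "x = x * 1 + 0 \<and> 1 \<in> R \<and> 0 \<in> P" using ideal_zero[OF iP] by simp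
    then show ?thesis by blast
  qed
  moreover have "?I = P"
    using P I PI one unfolding primes_def by blast
  ultimately show False using x by blast
qed

lemma prime_mult:
  assumes P: "P \<in> primes" and x: "x \<in> R" "y \<in> R" "x * y \<in> P"
  shows "x \<in> P \<or> y \<in> P"
proof (rule disjCI)
  assume "y \<notin> P"
  then obtain z where z: "z \<in> R" "y * z - 1 \<in> P" using prime_inverse P x by blast
  note iP = prime_ideal[OF P]
  have "x * y * z - x * (y * z - 1) \<in> P"
    using ideal_diff[OF iP ideal_mult'[OF iP z(1) x(3)] ideal_mult[OF iP x(1) z(2)]] .
  then show "x \<in> P" by (simp add: algebra_simps)
qed

lemma prime_power: "P \<in> primes \<Longrightarrow> x \<in> R \<Longrightarrow> x ^ k \<in> P \<Longrightarrow> x \<in> P"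
  by (induction k) (auto dest: prime_mult one_notin_prime)

lemma prime_prod:
  assumes "P \<in> primes" "\<And>i. i \<in> A \<Longrightarrow> g i \<in> R" "\<And>i. i \<in> A \<Longrightarrow> g i \<notin> P"
  shows "prod g A \<notin> P"
  using assms(2,3)
proof (induction A rule: infinite_finite_induct)
  case (insert x F)
  have "g x \<in> R" "prod g F \<in> R" "g x \<notin> P" "prod g F \<notin> P" using insert by (auto intro: prod_mem)
  then show ?case using insert prime_mult[OF assms(1)] by auto
qed (use one_notin_prime[OF assms(1)] in auto)

lemma of_int_in_prime:
  assumes P: "P \<in> primes"
  shows "of_int m \<in> P \<longleftrightarrow> int p dvd m"
proof
  assume m: "of_int m \<in> P"
  show "int p dvd m"
  proof (rule ccontr)
    assume "\<not> int p dvd m"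
    then have "coprime (int p) m" using prime_p by (intro prime_imp_coprime) auto
    then obtain u v where "u * int p + v * m = 1" by (metis coprime_iff_gcd_eq_1 bezout_int)
    then have "of_int u * of_nat p + of_int v * of_int m = (1::'a)"
      by (metis of_int_add of_int_mult of_int_1 of_int_of_nat_eq)
    moreover have "of_int u * of_nat p + of_int v * of_int m \<in> P"
      using m P by (intro ideal_add[OF prime_ideal[OF P]] ideal_mult[OF prime_ideal[OF P]]) (auto intro: p_in_prime)
    ultimately show False using one_notin_prime P by simp
  qed
next
  assume "int p dvd m"
  then obtain k where "m = int p * k" by auto
  then show "of_int m \<in> P" using P ideal_mult'[OF prime_ideal[OF P], of "of_int k" "of_nat p"] p_in_prime by simp
qed

text \<open>The ideal xR + pR lies in no prime over p, so it contains 1.\<close>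

lemma unit_mod_p:
  assumes x: "x \<in> R" "\<And>P. P \<in> primes \<Longrightarrow> x \<notin> P"
  shows "\<exists>y\<in>R. x * y - 1 \<in> pR"
proof (rule ccontr)
  assume no: "\<not> ?thesis"
  let ?I = "{x * y + z | y z. y \<in> R \<and> z \<in> pR}"
  have I: "is_ideal ?I" using is_ideal_sum is_ideal_pR x by blast
  have "1 \<notin> ?I"
  proof
    assume "1 \<in> ?I"
    then obtain y z where "y \<in> R" "z \<in> pR" "1 = x * y + z" by auto
    then have "x * y - 1 = - z" by (simp add: algebra_simps)
    then show False using no \<open>y \<in> R\<close> \<open>z \<in> pR\<close> ideal_uminus[OF is_ideal_pR] by metis
  qed
  moreover have "of_nat p = x * 0 + of_nat p \<and> 0 \<in> R \<and> of_nat p \<in> pR" using p_in_pR by simp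
  then have "of_nat p \<in> ?I" by blast
  ultimately obtain P where P: "P \<in> primes" "?I \<subseteq> P" using exists_prime I by blast
  have "x = x * 1 + 0 \<and> 1 \<in> R \<and> 0 \<in> pR" using ideal_zero[OF is_ideal_pR] by simp
  then have "x \<in> ?I" by blast
  then show False using P x by blast
qed

section \<open>Nilpotency modulo p and local invertibility of the primes\<close>

lemma pigeonhole_mod_p:
  assumes "\<And>i :: nat. x i \<in> R"
  shows "\<exists>i j. i < j \<and> x i - x j \<in> pR"
proof -
  obtain T where T: "finite T" "T \<subseteq> R" "\<And>x. x \<in> R \<Longrightarrow> \<exists>t\<in>T. \<exists>y\<in>R. x = t + of_nat p * y"
    using finite_mod_p by blast
  have "\<exists>t. t \<in> T \<and> x i - t \<in> pR" for i
    using T(3)[OF assms[of i]] by (force simp: pR_def)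
  then obtain t where t: "\<And>i. t i \<in> T" "\<And>i. x i - t i \<in> pR" by metis
  have "\<not> inj t" using T(1) t(1) by (metis finite_subset image_subsetI infinite_UNIV_nat finite_imageD)
  then obtain i j where "i < j" "t i = t j" by (metis injI linorder_neqE_nat)
  then have "x i - x j \<in> pR" using ideal_diff[OF is_ideal_pR t(2)[of i] t(2)[of j]] by simp
  with \<open>i < j\<close> show ?thesis by blast
qed

lemma power_eventually_periodic:
  assumes "x \<in> R"
  shows "\<exists>N k. k > 0 \<and> x ^ N * (1 - x ^ k) \<in> pR"
proof -
  obtain i j where ij: "i < j" "x ^ i - x ^ j \<in> pR" using pigeonhole_mod_p[of "\<lambda>i. x ^ i"] assms by auto
  then have "x ^ i * (1 - x ^ (j - i)) \<in> pR"
    by (simp add: algebra_simps flip: power_add)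
  then show ?thesis using ij by (intro exI[of _ i] exI[of _ "j - i"]) auto
qed

lemma one_minus_power_notin:
  assumes "P \<in> primes" "x \<in> P" "k > 0"
  shows "1 - x ^ k \<notin> P"
proof
  assume "1 - x ^ k \<in> P"
  moreover have "x ^ k \<in> P"
    using assms by (cases k) (auto intro!: ideal_mult' prime_ideal intro: ideal_subset prime_ideal)
  ultimately show False using assms ideal_add[OF prime_ideal] one_notin_prime by fastforce
qed

text \<open>The powers of x repeat modulo p, so x^N times 1 - x^k is in pR; the second factor is a
  unit at P because x is in P. Thus P becomes nilpotent in the localization of R/pR at P, as far as
  single elements are concerned.\<close>

lemma locally_nilpotent:
  assumes "P \<in> primes" "x \<in> P"
  shows "\<exists>N. \<exists>s\<in>R. s \<notin> P \<and> s * x ^ N \<in> pR"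
proof -
  have x: "x \<in> R" using assms ideal_subset prime_ideal by blast
  obtain N k where k: "k > 0" "x ^ N * (1 - x ^ k) \<in> pR" using power_eventually_periodic[OF x] by blast
  have "1 - x ^ k \<in> R" using x by auto
  then show ?thesis using k one_minus_power_notin[OF assms k(1)] by (metis mult.commute)
qed

definition J :: "'a set" where
  "J = {x \<in> R. \<forall>P\<in>primes. x \<in> P}"

lemma is_ideal_J: "is_ideal J"
  using prime_ideal by (auto simp: is_ideal_def J_def)

lemma p_in_J: "of_nat p \<in> J"
  using p_in_prime by (auto simp: J_def)

lemma pR_subset_J: "pR \<subseteq> J"
  using pR_subset[OF is_ideal_J p_in_J] .

text \<open>Here 1 - x^k avoids all primes over p at once, so it can be cancelled modulo p.\<close>

lemma J_nilpotent:
  assumes "x \<in> J"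
  shows "\<exists>N. x ^ N \<in> pR"
proof -
  have x: "x \<in> R" using assms by (auto simp: J_def)
  obtain N k where k: "k > 0" "x ^ N * (1 - x ^ k) \<in> pR" using power_eventually_periodic[OF x] by blast
  have "1 - x ^ k \<notin> P" if "P \<in> primes" for P
    using that assms k one_minus_power_notin by (auto simp: J_def)
  then obtain y where y: "y \<in> R" "(1 - x ^ k) * y - 1 \<in> pR" using unit_mod_p[of "1 - x ^ k"] x by auto
  have "x ^ N * (1 - x ^ k) * y - x ^ N * ((1 - x ^ k) * y - 1) \<in> pR"
    using k y x ideal_diff[OF is_ideal_pR ideal_mult'[OF is_ideal_pR y(1) k(2)]
      ideal_mult[OF is_ideal_pR power_mem[OF x] y(2)]] by blast
  then have "x ^ N \<in> pR" by (simp add: algebra_simps)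
  then show ?thesis by blast
qed

text \<open>Choose \<open>x\<close> with annihilator modulo \<open>p\<close> maximal among those contained in \<open>P\<close>.\<close>

lemma socle:
  assumes P: "P \<in> primes"
  shows "\<exists>x\<in>R. x \<notin> pR \<and> (\<forall>y\<in>P. x * y \<in> pR)"
proof -
  define ann where "ann x = {y \<in> R. x * y \<in> pR}" for x
  have ann: "is_ideal (ann x) \<and> of_nat p \<in> ann x" if "x \<in> R" for x
  proof -
    have "x * (r * y) \<in> pR" if "r \<in> R" "x * y \<in> pR" for r y
      using ideal_mult[OF is_ideal_pR that] by (simp add: algebra_simps)
    then show ?thesis using that is_ideal_pR p_in_pR ideal_mult[OF is_ideal_pR, of x "of_nat p"]
      unfolding ann_def is_ideal_def by (auto simp: distrib_left)
  qed
  let ?F = "ann ` R \<inter> {I. I \<subseteq> P}"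
  have fin: "finite ?F" by (rule finite_subset[OF _ finite_ideals]) (use ann in auto)
  have "ann 1 \<subseteq> P" using pR_subset[OF prime_ideal[OF P] p_in_prime[OF P]] by (auto simp: ann_def)
  then have "ann 1 \<in> ?F" by blast
  then obtain I where I: "I \<in> ?F" "\<And>K. K \<in> ?F \<Longrightarrow> I \<subseteq> K \<Longrightarrow> I = K"
    using finite_has_maximal2[OF fin] by metis
  then obtain x where x: "x \<in> R" "I = ann x" "ann x \<subseteq> P" by blast
  have eq: "ann (r * x) = ann x" if r: "r \<in> R" "ann (r * x) \<subseteq> P" for r
  proof -
    have "ann x \<subseteq> ann (r * x)" using ideal_mult[OF is_ideal_pR r(1)]
      by (auto simp: ann_def mult.assoc)
    then show ?thesis using I(2)[of "ann (r * x)"] x r by auto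
  qed
  have "y \<in> ann x" if y: "y \<in> P" for y
  proof (rule ccontr)
    assume "y \<notin> ann x"
    have yR: "y \<in> R" using y ideal_subset prime_ideal[OF P] by blast
    \<comment> \<open>If y did not annihilate x, maximality would keep the annihilator of every
      \<open>y ^ k * x\<close> equal to \<open>ann x\<close>, inside P. Local nilpotency of y
      contradicts this, since some s outside P kills \<open>y ^ N * x\<close> modulo p.\<close>
    have "ann (y ^ k * x) \<subseteq> P" for k
    proof (induction k)
      case (Suc k)
      have e: "ann (y ^ k * x) = ann x" using eq Suc yR by auto
      show ?case
      proof
        fix t assume t: "t \<in> ann (y ^ Suc k * x)"
        then have tR: "t \<in> R" by (auto simp: ann_def)
        show "t \<in> P"
        proof (rule ccontr)
          assume tP: "t \<notin> P"
          have "t * y \<in> ann (y ^ k * x)" using t yR by (auto simp: ann_def algebra_simps)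
          then have "x * (t * y) \<in> pR" using e by (auto simp: ann_def)
          then have "y \<in> ann (t * x)" using yR by (auto simp: ann_def algebra_simps)
          moreover have "ann (t * x) \<subseteq> P"
          proof
            fix s assume s: "s \<in> ann (t * x)"
            then have "t * s \<in> ann x" using tR by (auto simp: ann_def algebra_simps)
            then have "t * s \<in> P" using x by auto
            then show "s \<in> P" using prime_mult[OF P tR] tP s by (auto simp: ann_def)
          qed
          then have "ann (t * x) = ann x" using eq tR by auto
          ultimately show False using \<open>y \<notin> ann x\<close> by simp
        qed
      qed
    qed (use x in auto)
    moreover obtain N s where s: "s \<in> R" "s \<notin> P" "s * y ^ N \<in> pR"
      using locally_nilpotent[OF P y] by blast
    have "x * (s * y ^ N) \<in> pR" using ideal_mult[OF is_ideal_pR x(1) s(3)] .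
    then have "s \<in> ann (y ^ N * x)" using s by (auto simp: ann_def algebra_simps)
    ultimately show False using s by blast
  qed
  moreover have "x \<notin> pR"
  proof
    assume "x \<in> pR"
    then have "1 \<in> ann x" by (simp add: ann_def)
    then show False using x one_notin_prime[OF P] by auto
  qed
  ultimately show ?thesis using x by (auto simp: ann_def)
qed

text \<open>A socle element divided by p gives \<open>\<tau>\<close> with \<open>\<tau>\<close> P
  inside R. If \<open>\<tau>\<close> mapped P into P, all \<open>p * \<tau> ^ k\<close> would stay
  in P and \<open>bounded_powers\<close> would put \<open>\<tau>\<close> into R, so the socle
  element would lie in pR. This is the classical route from integral closedness to invertible
  primes; y is then a local uniformizer.\<close>

lemma locally_invertible:
  assumes P: "P \<in> primes"
  shows "\<exists>\<tau>. (\<forall>y\<in>P. \<tau> * y \<in> R) \<and> (\<exists>y\<in>P. \<tau> * y \<notin> P)"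
proof -
  obtain x where x: "x \<in> R" "x \<notin> pR" "\<And>y. y \<in> P \<Longrightarrow> x * y \<in> pR" using socle[OF P] by blast
  define \<tau> where "\<tau> = x / of_nat p"
  have "\<tau> * y \<in> R" if y: "y \<in> P" for y
  proof -
    obtain z where "z \<in> R" "x * y = of_nat p * z" using x(3)[OF y] by (auto simp: pR_def)
    then show ?thesis by (simp add: \<tau>_def)
  qed
  moreover have "\<exists>y\<in>P. \<tau> * y \<notin> P"
  proof (rule ccontr)
    assume "\<not> ?thesis"
    then have *: "\<And>y. y \<in> P \<Longrightarrow> \<tau> * y \<in> P" by blast
    have "of_nat p * \<tau> ^ k \<in> P" for k
    proof (induction k)
      case (Suc k)
      then show ?case using *[OF Suc] by (simp add: algebra_simps)
    qed (use p_in_prime[OF P] in auto)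
    then have "\<tau> \<in> R" using bounded_powers[of \<tau>] ideal_subset[OF prime_ideal[OF P]] by blast
    then have "of_nat p * \<tau> \<in> pR" by (rule pR_I)
    moreover have "of_nat p * \<tau> = x" by (simp add: \<tau>_def)
    ultimately show False using x by simp
  qed
  ultimately show ?thesis by blast
qed

section \<open>Simultaneous approximation at the primes over p\<close>

lemma separating_element:
  assumes P: "P \<in> primes"
  shows "\<exists>e\<in>R. e \<notin> P \<and> (\<forall>Q\<in>primes - {P}. e \<in> Q)"
proof -
  have "\<exists>e. e \<in> Q \<and> e \<notin> P" if "Q \<in> primes - {P}" for Q
  proof (rule ccontr)
    assume "\<not> ?thesis"
    then have "Q \<subseteq> P" by auto
    then show False using that P by (auto simp: primes_def)
  qed
  then obtain e where e: "\<And>Q. Q \<in> primes - {P} \<Longrightarrow> e Q \<in> Q \<and> e Q \<notin> P" by metis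
  have eR: "e Q \<in> R" if "Q \<in> primes - {P}" for Q
    using e[OF that] that ideal_subset prime_ideal by blast
  show ?thesis
  proof (intro bexI[of _ "prod e (primes - {P})"] conjI ballI)
    show "prod e (primes - {P}) \<notin> P" using prime_prod[OF P] eR e by blast
    show "prod e (primes - {P}) \<in> Q" if "Q \<in> primes - {P}" for Q
      using that e eR finite_primes prime_ideal by (intro ideal_prod[of Q _ Q]) auto
  qed (use eR in \<open>auto intro: prod_mem\<close>)
qed

text \<open>These elements are orthogonal idempotents only modulo \<open>J\<close>, which is enough
  for all gluing below.\<close>

lemma idempotent_family:
  "\<exists>e. (\<forall>P\<in>primes. e P \<in> R \<and> e P - 1 \<in> P \<and> (\<forall>Q\<in>primes - {P}. e P \<in> Q))"
proof -
  have "\<exists>e\<in>R. e - 1 \<in> P \<and> (\<forall>Q\<in>primes - {P}. e \<in> Q)" if P: "P \<in> primes" for P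
  proof -
    obtain e where e: "e \<in> R" "e \<notin> P" "\<forall>Q\<in>primes - {P}. e \<in> Q" using separating_element[OF P] by blast
    obtain y where "y \<in> R" "e * y - 1 \<in> P" using prime_inverse[OF P e(1,2)] by blast
    then show ?thesis using e by (intro bexI[of _ "e * y"]) (auto intro: ideal_mult' prime_ideal)
  qed
  then show ?thesis by metis
qed

lemma crt:
  assumes "\<And>P. P \<in> primes \<Longrightarrow> g P \<in> R"
  shows "\<exists>x\<in>R. \<forall>P\<in>primes. x - g P \<in> P"
proof -
  obtain e where e: "\<And>P. P \<in> primes \<Longrightarrow> e P \<in> R" "\<And>P. P \<in> primes \<Longrightarrow> e P - 1 \<in> P"
    "\<And>P Q. P \<in> primes \<Longrightarrow> Q \<in> primes \<Longrightarrow> Q \<noteq> P \<Longrightarrow> e P \<in> Q" using idempotent_family by blast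
  let ?x = "\<Sum>Q\<in>primes. e Q * g Q"
  have "?x - g P \<in> P" if P: "P \<in> primes" for P
  proof -
    have "?x - g P = (e P - 1) * g P + (\<Sum>Q\<in>primes - {P}. e Q * g Q)"
      using P finite_primes by (simp add: sum.remove[of primes P] algebra_simps)
    moreover have "\<dots> \<in> P"
      using P e assms by (intro ideal_add ideal_sum ideal_mult' prime_ideal) auto
    ultimately show ?thesis by simp
  qed
  moreover have "?x \<in> R" by (intro sum_mem mult_mem e(1) assms)
  ultimately show ?thesis by blast
qed

text \<open>At each P there is a uniformizer \<open>y P\<close> in \<open>J\<close> and a multiplier
  \<open>\<tau> P\<close> sending it to a unit at P. Weighted with the idempotents modulo
  \<open>J\<close> they glue to w and t, where t maps \<open>J\<close> into R and t w is a unit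
  modulo p. With its inverse v, x is congruent to \<open>w * (t * x * v)\<close>.\<close>

lemma J_principal_mod_p:
  "\<exists>w\<in>J. \<forall>x\<in>J. \<exists>u\<in>R. x - w * u \<in> pR"
proof -
  obtain e where e: "\<And>P. P \<in> primes \<Longrightarrow> e P \<in> R" "\<And>P. P \<in> primes \<Longrightarrow> e P - 1 \<in> P"
    "\<And>P Q. P \<in> primes \<Longrightarrow> Q \<in> primes \<Longrightarrow> Q \<noteq> P \<Longrightarrow> e P \<in> Q" using idempotent_family by blast
  have e': "e P \<notin> P" if "P \<in> primes" for P
    using e(2)[OF that] ideal_diff[OF prime_ideal[OF that], of "e P" "e P - 1"] one_notin_prime[OF that] by auto
  have "\<exists>\<tau> y. (\<forall>z\<in>J. \<tau> * z \<in> R) \<and> y \<in> J \<and> \<tau> * y \<notin> P" if P: "P \<in> primes" for P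
  proof -
    obtain \<tau> y where t: "\<And>y. y \<in> P \<Longrightarrow> \<tau> * y \<in> R" "y \<in> P" "\<tau> * y \<notin> P" using locally_invertible[OF P] by blast
    have yR: "y \<in> R" using t(2) ideal_subset prime_ideal[OF P] by blast
    have "e P * y \<in> Q" if Q: "Q \<in> primes" for Q
      using ideal_mult[OF prime_ideal[OF P] e(1)[OF P] t(2)] e(3)[OF P Q]
        ideal_mult'[OF prime_ideal[OF Q] yR] by (cases "Q = P") auto
    then have "e P * y \<in> J" using P e yR by (auto simp: J_def)
    moreover have "\<tau> * (e P * y) \<notin> P"
    proof
      assume "\<tau> * (e P * y) \<in> P"
      then have "e P * (\<tau> * y) \<in> P" by (simp add: algebra_simps)
      then show False using prime_mult[OF P e(1)[OF P] t(1)[OF t(2)]] e'[OF P] t by auto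
    qed
    moreover have "\<forall>z\<in>J. \<tau> * z \<in> R" using t(1) P by (auto simp: J_def)
    ultimately show ?thesis by blast
  qed
  then obtain \<tau> y where ty: "\<And>P z. P \<in> primes \<Longrightarrow> z \<in> J \<Longrightarrow> \<tau> P * z \<in> R"
    "\<And>P. P \<in> primes \<Longrightarrow> y P \<in> J" "\<And>P. P \<in> primes \<Longrightarrow> \<tau> P * y P \<notin> P" by metis
  define t where "t = (\<Sum>P\<in>primes. e P * \<tau> P)"
  define w where "w = (\<Sum>P\<in>primes. e P * y P)"
  have w: "w \<in> J" unfolding w_def using e ty by (intro ideal_sum is_ideal_J ideal_mult) auto
  have tz: "t * z \<in> R" if "z \<in> J" for z
  proof -
    have "t * z = (\<Sum>P\<in>primes. e P * (\<tau> P * z))" by (simp add: t_def sum_distrib_right mult.assoc)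
    also have "\<dots> \<in> R" using that by (intro sum_mem mult_mem e(1) ty(1))
    finally show ?thesis .
  qed
  \<comment> \<open>Modulo P the weights of the other primes vanish, first in w and then in t, so t
    w becomes \<open>e P * (e P * (\<tau> P * y P))\<close>, a product of elements outside
    P.\<close>
  have "t * w \<notin> P" if P: "P \<in> primes" for P
  proof
    assume tw: "t * w \<in> P"
    note iP = prime_ideal[OF P]
    have eP: "e Q \<in> P" if "Q \<in> primes - {P}" for Q using e(3)[of Q P] that P by auto
    have "t * w = (\<Sum>Q\<in>primes. e Q * (t * y Q))" by (simp add: w_def sum_distrib_left mult.left_commute)
    also have "\<dots> = e P * (t * y P) + (\<Sum>Q\<in>primes - {P}. e Q * (t * y Q))"
      using P finite_primes by (simp add: sum.remove[of primes P])
    finally have "e P * (t * y P) + (\<Sum>Q\<in>primes - {P}. e Q * (t * y Q)) \<in> P" using tw by simp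
    moreover have "(\<Sum>Q\<in>primes - {P}. e Q * (t * y Q)) \<in> P"
      using tz ty(2) by (intro ideal_sum[OF iP] ideal_mult'[OF iP] eP) auto
    ultimately have "e P * (t * y P) \<in> P" using ideal_add_iff[OF iP] by blast
    then have "t * y P \<in> P"
      using prime_mult[OF P e(1)[OF P] tz[OF ty(2)[OF P]]] e'[OF P] by simp
    moreover have "t * y P = e P * (\<tau> P * y P) + (\<Sum>Q\<in>primes - {P}. e Q * (\<tau> Q * y P))"
      using P finite_primes by (simp add: t_def sum_distrib_right sum.remove[of primes P] mult.assoc distrib_right)
    moreover have "(\<Sum>Q\<in>primes - {P}. e Q * (\<tau> Q * y P)) \<in> P"
      using P ty by (intro ideal_sum[OF iP] ideal_mult'[OF iP] eP) auto
    ultimately have "e P * (\<tau> P * y P) \<in> P" using ideal_add_iff[OF iP] by metis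
    then show False
      using prime_mult[OF P e(1)[OF P] ty(1)[OF P ty(2)[OF P]]] e'[OF P] ty(3)[OF P] by simp
  qed
  then obtain v where v: "v \<in> R" "t * w * v - 1 \<in> pR" using unit_mod_p[OF tz[OF w]] by blast
  have "\<exists>u\<in>R. x - w * u \<in> pR" if x: "x \<in> J" for x
  proof (intro bexI[of _ "t * x * v"])
    have xR: "x \<in> R" using x by (auto simp: J_def)
    have "(- x) * (t * w * v - 1) \<in> pR" using xR v by (intro ideal_mult is_ideal_pR) auto
    then show "x - w * (t * x * v) \<in> pR" by (simp add: algebra_simps)
  qed (use v tz[OF x] in auto)
  then show ?thesis using w by blast
qed

section \<open>Generators of the residue fields and their separation\<close>

lemma ev_mem [intro]: "x \<in> R \<Longrightarrow> ev h x \<in> R"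
  by (induction h) auto

lemma ev_cong:
  assumes I: "is_ideal I" and x: "x \<in> R" "y \<in> R" "x - y \<in> I"
  shows "ev h x - ev h y \<in> I"
proof (induction h)
  case (pCons c h)
  have "ev (pCons c h) x - ev (pCons c h) y = (x - y) * ev h x + y * (ev h x - ev h y)"
    by (simp add: algebra_simps)
  also have "\<dots> \<in> I"
    by (intro ideal_add[OF I] ideal_mult'[OF I] ideal_mult[OF I] x pCons.IH ev_mem)
  finally show ?case .
qed (use I ideal_zero in auto)

text \<open>Says that the residue field R/P is Z/p, without forming the quotient.\<close>

definition degree_one :: "'a set \<Rightarrow> bool" where
  "degree_one P \<longleftrightarrow> (\<forall>y\<in>R. \<exists>m :: int. y - of_int m \<in> P)"

definition generates :: "'a set \<Rightarrow> 'a \<Rightarrow> bool" where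
  "generates P x \<longleftrightarrow> x \<in> R \<and> (\<forall>y\<in>R. \<exists>h. y - ev h x \<in> P)"

text \<open>R is made into a ring record so that R/P is a finite field in the algebraic library; its
  multiplicative group is cyclic, and a lift of a generator is the required x.\<close>

lemma primitive_element_mod_prime:
  assumes P: "P \<in> primes"
  shows "\<exists>x\<in>R. \<forall>y\<in>R. y \<notin> P \<longrightarrow> (\<exists>i. y - x ^ i \<in> P)"
proof -
  let ?R = "\<lparr>carrier = R, monoid.mult = (*), one = 1, zero = 0, add = (+)\<rparr> :: 'a ring"
  note iP = prime_ideal[OF P]
  have "cring ?R"
  proof (rule cringI)
    show "abelian_group ?R"
    proof (rule abelian_groupI)
      show "\<exists>y\<in>carrier ?R. y \<oplus>\<^bsub>?R\<^esub> x = \<zero>\<^bsub>?R\<^esub>" if "x \<in> carrier ?R" for x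
        using that by (intro bexI[of _ "- x"]) auto
    qed (auto simp: algebra_simps)
    show "Group.comm_monoid ?R"
      by (rule comm_monoidI) (auto simp: algebra_simps)
  qed (auto simp: algebra_simps)
  then interpret RR: cring ?R .
  have neg: "\<ominus>\<^bsub>?R\<^esub> x = - x" if "x \<in> R" for x
    using that by (intro RR.minus_equality) auto
  have ideal_iff: "ideal I ?R \<longleftrightarrow> is_ideal I" for I
  proof
    assume "ideal I ?R"
    then interpret I: ideal I ?R .
    show "is_ideal I"
      using I.a_subset I.zero_closed I.I_l_closed I.a_closed by (auto simp: is_ideal_def)
  next
    assume I: "is_ideal I"
    show "ideal I ?R"
    proof (rule idealI)
      show "ring ?R" by (rule RR.ring_axioms)
      show "subgroup I (add_monoid ?R)"
      proof (rule subgroup.intro)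
        show "inv\<^bsub>add_monoid ?R\<^esub> x \<in> I" if "x \<in> I" for x
          using neg[of x] that I ideal_subset[OF I that] ideal_uminus[OF I that] by (simp add: a_inv_def)
      qed (use I ideal_subset ideal_add ideal_zero in auto)
    qed (use I ideal_mult ideal_mult' in auto)
  qed
  have "maximalideal P ?R"
  proof (rule maximalidealI)
    show "ideal P ?R" using iP ideal_iff by simp
    show "carrier ?R \<noteq> P" using one_notin_prime[OF P] by auto
    show "K = P \<or> K = carrier ?R" if K: "ideal K ?R" "P \<subseteq> K" "K \<subseteq> carrier ?R" for K
    proof (cases "1 \<in> K")
      case True
      have iK: "is_ideal K" using K ideal_iff by simp
      have "x \<in> K" if "x \<in> R" for x using ideal_mult[OF iK that True] by simp
      then have "R \<subseteq> K" by blast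
      then show ?thesis using K by auto
    next
      case False
      have "is_ideal K" using K ideal_iff by simp
      then show ?thesis using P K(2) False unfolding primes_def by blast
    qed
  qed
  then interpret M: maximalideal P ?R .
  interpret F: field "?R Quot P" using M.quotient_is_field RR.is_cring by blast
  have coset: "P +>\<^bsub>?R\<^esub> x = (\<lambda>z. z + x) ` P" for x
    by (auto simp: a_r_coset_def r_coset_def)
  have coset_eq: "P +>\<^bsub>?R\<^esub> x = P +>\<^bsub>?R\<^esub> y \<longleftrightarrow> x - y \<in> P" if "x \<in> R" "y \<in> R" for x y
  proof
    assume "P +>\<^bsub>?R\<^esub> x = P +>\<^bsub>?R\<^esub> y"
    moreover have "x \<in> P +>\<^bsub>?R\<^esub> x" unfolding coset using ideal_zero[OF iP] by force
    ultimately show "x - y \<in> P" unfolding coset by auto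
  next
    assume xy: "x - y \<in> P"
    have "z + x \<in> (\<lambda>z. z + y) ` P" if "z \<in> P" for z
      using ideal_add[OF iP that xy] by (intro image_eqI[of _ _ "z + (x - y)"]) auto
    moreover have "z + y \<in> (\<lambda>z. z + x) ` P" if "z \<in> P" for z
      using ideal_diff[OF iP that xy] by (intro image_eqI[of _ _ "z - (x - y)"]) auto
    ultimately show "P +>\<^bsub>?R\<^esub> x = P +>\<^bsub>?R\<^esub> y"
      unfolding coset by (intro equalityI image_subsetI)
  qed
  have carr: "carrier (?R Quot P) = (\<lambda>x. P +>\<^bsub>?R\<^esub> x) ` R"
    by (auto simp: FactRing_def A_RCOSETS_def' )
  have "finite (carrier (?R Quot P))"
  proof -
    obtain T where T: "finite T" "T \<subseteq> R" "\<And>x. x \<in> R \<Longrightarrow> \<exists>t\<in>T. \<exists>y\<in>R. x = t + of_nat p * y"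
      using finite_mod_p by blast
    have "(\<lambda>x. P +>\<^bsub>?R\<^esub> x) ` R \<subseteq> (\<lambda>x. P +>\<^bsub>?R\<^esub> x) ` T"
    proof
      fix c assume "c \<in> (\<lambda>x. P +>\<^bsub>?R\<^esub> x) ` R"
      then obtain x where x: "x \<in> R" "c = P +>\<^bsub>?R\<^esub> x" by auto
      then obtain t y where t: "t \<in> T" "y \<in> R" "x = t + of_nat p * y" using T(3) by blast
      have tR: "t \<in> R" using t(1) T(2) by (rule subsetD[rotated])
      have "x - t \<in> P" using t ideal_mult'[OF iP t(2) p_in_prime[OF P]] by simp
      then have "c = P +>\<^bsub>?R\<^esub> t" using x(2) coset_eq[OF x(1) tR] by simp
      then show "c \<in> (\<lambda>x. P +>\<^bsub>?R\<^esub> x) ` T" using t(1) by (rule image_eqI)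
    qed
    then show ?thesis unfolding carr by (rule finite_subset) (rule finite_imageI[OF T(1)])
  qed
  then obtain c where c: "c \<in> carrier (mult_of (?R Quot P))"
    "carrier (mult_of (?R Quot P)) = {c [^]\<^bsub>?R Quot P\<^esub> i | i::nat. i \<in> UNIV}"
    using F.finite_field_mult_group_has_gen by auto
  then obtain x where x: "x \<in> R" "c = P +>\<^bsub>?R\<^esub> x" using carr by (auto simp: carrier_mult_of)
  interpret h: ring_hom_ring ?R "?R Quot P" "\<lambda>x. P +>\<^bsub>?R\<^esub> x"
    by (rule M.rcos_ring_hom_ring)
  have pw: "c [^]\<^bsub>?R Quot P\<^esub> i = P +>\<^bsub>?R\<^esub> (x ^ i)" for i :: nat
  proof (induction i)
    case 0
    then show ?case using h.hom_one by simp
  next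
    case (Suc i)
    have "P +>\<^bsub>?R\<^esub> (x ^ Suc i) = (P +>\<^bsub>?R\<^esub> (x ^ i)) \<otimes>\<^bsub>?R Quot P\<^esub> (P +>\<^bsub>?R\<^esub> x)"
      using h.hom_mult[of "x ^ i" x] x power_mem[of x i] by (simp add: mult.commute)
    then show ?case using Suc x by simp
  qed
  have "\<exists>i. y - x ^ i \<in> P" if y: "y \<in> R" "y \<notin> P" for y
  proof -
    have "P +>\<^bsub>?R\<^esub> y \<noteq> \<zero>\<^bsub>?R Quot P\<^esub>"
      using h.hom_zero coset_eq[of y 0] y by auto
    then have "P +>\<^bsub>?R\<^esub> y \<in> carrier (mult_of (?R Quot P))" using carr y by (auto simp: carrier_mult_of)
    then obtain i :: nat where "P +>\<^bsub>?R\<^esub> y = c [^]\<^bsub>?R Quot P\<^esub> i" using c(2) by blast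
    then have "y - x ^ i \<in> P" using pw[of i] coset_eq[OF y(1) power_mem[OF x(1)]] by simp
    then show ?thesis ..
  qed
  then show ?thesis using x(1) by auto
qed

lemma exists_generator:
  assumes P: "P \<in> primes"
  shows "\<exists>x. generates P x"
proof -
  obtain x where x: "x \<in> R" "\<And>y. y \<in> R \<Longrightarrow> y \<notin> P \<Longrightarrow> \<exists>i. y - x ^ i \<in> P"
    using primitive_element_mod_prime[OF P] by blast
  have "\<exists>h. y - ev h x \<in> P" if y: "y \<in> R" for y
  proof (cases "y \<in> P")
    case True
    then show ?thesis by (intro exI[of _ 0]) auto
  next
    case False
    then obtain i where "y - x ^ i \<in> P" using x y by blast
    then show ?thesis by (intro exI[of _ "monom 1 i"]) auto
  qed
  then show ?thesis using x(1) unfolding generates_def by blast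
qed

text \<open>The bound on the number of roots over the field R/P, stated for pairwise incongruent
  representatives; one root is split off at a time.\<close>

lemma root_bound:
  assumes P: "P \<in> primes"
  shows "(\<And>i. i \<le> m \<Longrightarrow> c i \<in> R) \<Longrightarrow> \<exists>i\<le>m. c i \<notin> P \<Longrightarrow> finite Y \<Longrightarrow> Y \<subseteq> R \<Longrightarrow>
    (\<And>x y. x \<in> Y \<Longrightarrow> y \<in> Y \<Longrightarrow> x - y \<in> P \<Longrightarrow> x = y) \<Longrightarrow>
    (\<And>y. y \<in> Y \<Longrightarrow> (\<Sum>i\<le>m. c i * y ^ i) \<in> P) \<Longrightarrow> card Y \<le> m"
proof (induction m arbitrary: c Y)
  case 0
  then have "Y = {}" by auto
  then show ?case by simp
next
  case (Suc m)
  note iP = prime_ideal[OF P]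
  show ?case
  proof (cases "c (Suc m) \<in> P")
    case True
    have "(\<Sum>i\<le>m. c i * y ^ i) \<in> P" if y: "y \<in> Y" for y
    proof -
      have "c (Suc m) * y ^ Suc m \<in> P" using True y Suc.prems(4) by (intro ideal_mult'[OF iP]) auto
      then show ?thesis using Suc.prems(6)[OF y] ideal_add_iff[OF iP] by simp
    qed
    moreover have "\<exists>i\<le>m. c i \<notin> P" using Suc.prems(2) True le_Suc_eq by auto
    ultimately have "card Y \<le> m" using Suc.prems by (intro Suc.IH[of c]) auto
    then show ?thesis by simp
  next
    case False
    show ?thesis
    proof (cases "Y = {}")
      case False
      then obtain y0 where y0: "y0 \<in> Y" by blast
      \<comment> \<open>Coefficients of the quotient of the polynomial, minus its value at y0, by
        \<open>y - y0\<close>. The top coefficient is unchanged, so the quotient is again nonzero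
        modulo P.\<close>
      define d where "d j = (\<Sum>i=Suc j..Suc m. c i * y0 ^ (i - j - 1))" for j
      have dR: "d j \<in> R" for j unfolding d_def using Suc.prems(1,4) y0 by (intro sum_mem mult_mem power_mem) auto
      have "card (Y - {y0}) \<le> m"
      proof (rule Suc.IH[of d])
        have "d m = c (Suc m)" by (simp add: d_def)
        then show "\<exists>i\<le>m. d i \<notin> P" using \<open>c (Suc m) \<notin> P\<close> by auto
        show "(\<Sum>i\<le>m. d i * y ^ i) \<in> P" if y: "y \<in> Y - {y0}" for y
        proof -
          have "(\<Sum>i\<le>Suc m. c i * y ^ i) - (\<Sum>i\<le>Suc m. c i * y0 ^ i) = (y - y0) * (\<Sum>j\<le>m. d j * y ^ j)"
            unfolding d_def by (subst polyfun_diff) (simp_all only: lessThan_Suc_atMost)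
          moreover have "(\<Sum>i\<le>Suc m. c i * y ^ i) - (\<Sum>i\<le>Suc m. c i * y0 ^ i) \<in> P"
            using Suc.prems(6) y y0 ideal_diff[OF iP] by blast
          ultimately have "(y - y0) * (\<Sum>j\<le>m. d j * y ^ j) \<in> P" by simp
          moreover have "y - y0 \<notin> P" using y y0 Suc.prems(5) by blast
          moreover have "(\<Sum>j\<le>m. d j * y ^ j) \<in> R" "y - y0 \<in> R"
            using dR y y0 Suc.prems(4) by (auto intro!: sum_mem mult_mem power_mem)
          ultimately show ?thesis using prime_mult[OF P] by blast
        qed
      qed (use Suc.prems dR in auto)
      then show ?thesis using y0 Suc.prems(3) by (simp add: card_Diff_singleton)
    qed simp
  qed
qed

lemma int_inverse_mod_p:
  assumes "\<not> int p dvd m"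
  shows "\<exists>u :: int. int p dvd (u * m - 1)"
proof -
  have "coprime (int p) m" using prime_p assms by (intro prime_imp_coprime) auto
  then obtain u v where "v * int p + u * m = 1" by (metis coprime_iff_gcd_eq_1 bezout_int)
  then have "u * m - 1 = int p * (- v)" by (simp add: algebra_simps)
  then show ?thesis by (intro exI[of _ u]) (metis dvd_triv_left)
qed

lemma degree_oneI:
  assumes P: "P \<in> primes" and x: "generates P x" "x - of_int m \<in> P"
  shows "degree_one P"
  unfolding degree_one_def
proof
  fix y assume y: "y \<in> R"
  note iP = prime_ideal[OF P]
  obtain h where h: "y - ev h x \<in> P" using x y by (auto simp: generates_def)
  have "ev h x - ev h (of_int m) \<in> P" using x by (intro ev_cong iP) (auto simp: generates_def)
  then have "y - ev h (of_int m) \<in> P" using ideal_add[OF iP h] by fastforce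
  moreover have "ev h (of_int m :: 'a) = of_int (poly h m)" by (simp add: ev_def)
  ultimately show "\<exists>m. y - of_int m \<in> P" by auto
qed

text \<open>A generator of a residue field larger than Z/p is linearly independent of 1 over Z/p;
  this makes its affine images distinct.\<close>

lemma not_degree_one_affine:
  assumes P: "P \<in> primes" and x: "generates P x" "\<not> degree_one P"
    and uv: "of_int u * x - of_int v \<in> P"
  shows "int p dvd u"
proof (rule ccontr)
  assume "\<not> int p dvd u"
  then obtain k where k: "int p dvd (k * u - 1)" using int_inverse_mod_p by blast
  note iP = prime_ideal[OF P]
  have xR: "x \<in> R" using x by (auto simp: generates_def)
  have "of_int (k * u - 1) \<in> P" using k of_int_in_prime[OF P] by blast
  then have "of_int k * (of_int u * x - of_int v) - of_int (k * u - 1) * x \<in> P"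
    by (intro ideal_diff[OF iP] ideal_mult[OF iP _ uv] ideal_mult'[OF iP xR] of_int_mem)
  then have "x - of_int (k * v) \<in> P" by (simp add: algebra_simps)
  then show False using degree_oneI[OF P x(1)] x(2) by blast
qed

lemma generates_affine:
  assumes P: "P \<in> primes" and x: "generates P x" and u: "\<not> int p dvd u"
  shows "generates P (of_int u * x + of_int v)"
  unfolding generates_def
proof (intro conjI ballI)
  have xR: "x \<in> R" using x by (auto simp: generates_def)
  then show yR: "of_int u * x + of_int v \<in> R" by auto
  note iP = prime_ideal[OF P]
  obtain k where k: "int p dvd (k * u - 1)" using u int_inverse_mod_p by blast
  fix y assume y: "y \<in> R"
  obtain h where h: "y - ev h x \<in> P" using x y by (auto simp: generates_def)
  let ?z = "of_int k * (of_int u * x + of_int v - of_int v)"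
  have "of_int (k * u - 1) \<in> P" using k of_int_in_prime[OF P] by blast
  then have "- of_int (k * u - 1) * x \<in> P"
    by (intro ideal_mult'[OF iP xR] ideal_uminus[OF iP])
  then have "x - ?z \<in> P" by (simp add: algebra_simps)
  moreover have "?z \<in> R" using xR by auto
  ultimately have "ev h x - ev h ?z \<in> P" using xR by (intro ev_cong iP)
  then have "y - ev h ?z \<in> P" using ideal_add[OF iP h] by fastforce
  moreover have "ev h ?z = ev (pcompose h [:- k * v, k:]) (of_int u * x + of_int v)"
  proof -
    have "ev (pcompose h [:- k * v, k:]) w = ev h (of_int k * (w - of_int v))" for w :: 'a
      by (induction h) (simp_all add: pcompose_pCons algebra_simps)
    then show ?thesis by simp
  qed
  ultimately show "\<exists>h. y - ev h (of_int u * x + of_int v) \<in> P" by metis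
qed

text \<open>A polynomial vanishing at one generator but not at the other expresses that their
  minimal polynomials over Z/p differ. To reverse the roles, invert h at y by some g, as y generates
  the field; then \<open>1 - h * g\<close> vanishes at y and equals 1 at x.\<close>

lemma separation_sym:
  assumes Q: "Q \<in> primes" and P: "P \<in> primes" and x: "x \<in> R" and y: "generates Q y"
    and h: "ev h x \<in> P" "ev h y \<notin> Q"
  shows "\<exists>g. ev g y \<in> Q \<and> ev g x \<notin> P"
proof -
  note iP = prime_ideal[OF P] and iQ = prime_ideal[OF Q]
  have yR: "y \<in> R" using y by (auto simp: generates_def)
  obtain z where z: "z \<in> R" "ev h y * z - 1 \<in> Q" using prime_inverse[OF Q ev_mem[OF yR] h(2)] by blast
  obtain g where g: "z - ev g y \<in> Q" using y z by (auto simp: generates_def)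
  have "ev h y * (z - ev g y) - (ev h y * z - 1) \<in> Q"
    by (intro ideal_diff[OF iQ] ideal_mult[OF iQ] ev_mem yR z(2) g)
  then have "ev (1 - h * g) y \<in> Q" by (simp add: algebra_simps)
  moreover have "ev (1 - h * g) x \<notin> P"
  proof
    assume "ev (1 - h * g) x \<in> P"
    moreover have "ev h x * ev g x \<in> P" by (intro ideal_mult'[OF iP] h(1) ev_mem x)
    ultimately have "ev (1 - h * g) x + ev h x * ev g x \<in> P" by (rule ideal_add[OF iP])
    then show False using one_notin_prime[OF P] by simp
  qed
  ultimately show ?thesis by blast
qed

text \<open>A generator of a residue field larger than \<open>\<int>/p\<close> has \<open>p (p - 1)\<close> distinct affine images,
  which are again generators; few of them are roots of a prescribed polynomial.\<close>

lemma separated_generators: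
  assumes "finite S" "S \<subseteq> primes" "\<And>P. P \<in> S \<Longrightarrow> \<not> degree_one P" "n * card S < p * (p - 1) + n"
  shows "\<exists>x. (\<forall>P\<in>S. generates P (x P)) \<and>
    (\<forall>P\<in>S. \<forall>Q\<in>S. P \<noteq> Q \<longrightarrow> (\<exists>h. ev h (x P) \<in> P \<and> ev h (x Q) \<notin> Q))"
  using assms
proof (induction S rule: finite_induct)
  case (insert P S)
  have "n * card S < p * (p - 1) + n" "S \<subseteq> primes" "\<And>P. P \<in> S \<Longrightarrow> \<not> degree_one P"
    using insert.prems insert.hyps by auto
  then have "\<exists>x. (\<forall>P\<in>S. generates P (x P)) \<and>
      (\<forall>P\<in>S. \<forall>Q\<in>S. P \<noteq> Q \<longrightarrow> (\<exists>h. ev h (x P) \<in> P \<and> ev h (x Q) \<notin> Q))"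
    by (intro insert.IH)
  then obtain x where x0: "\<forall>Q\<in>S. generates Q (x Q)"
    "\<forall>P\<in>S. \<forall>Q\<in>S. P \<noteq> Q \<longrightarrow> (\<exists>h. ev h (x P) \<in> P \<and> ev h (x Q) \<notin> Q)"
    by (elim exE conjE)
  have x: "generates Q (x Q)" if "Q \<in> S" for Q
    using x0(1) that by simp
  have x2: "\<exists>h. ev h (x Q) \<in> Q \<and> ev h (x Q') \<notin> Q'" if "Q \<in> S" "Q' \<in> S" "Q \<noteq> Q'" for Q Q'
    using x0(2) that by simp
  have P: "P \<in> primes" "\<not> degree_one P" using insert.prems by auto
  note iP = prime_ideal[OF P(1)]
  obtain g where g: "generates P g" using exists_generator[OF P(1)] by blast
  have gR: "g \<in> R" using g by (auto simp: generates_def)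
  define y where "y = (\<lambda>(u :: int, v :: int). of_int u * g + of_int v)"
  \<comment> \<open>The slope u must be nonzero modulo p, otherwise the image is congruent to an
    integer and generates only Z/p.\<close>
  let ?A = "{1..<int p} \<times> {0..<int p}"
  have yP: "z = z'" if z: "z \<in> ?A" "z' \<in> ?A" "y z - y z' \<in> P" for z z'
  proof -
    obtain u v u' v' where e: "z = (u, v)" "z' = (u', v')" by fastforce
    have "of_int (u - u') * g - of_int (v' - v) \<in> P" using z e by (simp add: y_def algebra_simps)
    then have "int p dvd u - u'" using not_degree_one_affine[OF P(1) g P(2)] by blast
    then have uu: "u = u'" by (rule eq_if_dvd_diff) (use z e in simp_all)
    then have "of_int (v - v') \<in> P" using z e by (simp add: y_def)
    then have "int p dvd v - v'" using of_int_in_prime[OF P(1)] by blast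
    then have "v = v'" by (rule eq_if_dvd_diff) (use z e in simp_all)
    then show ?thesis using uu e by simp
  qed
  have inj: "inj_on y ?A"
  proof (rule inj_onI)
    fix z z' assume z: "z \<in> ?A" "z' \<in> ?A" and "y z = y z'"
    then have "y z - y z' \<in> P" using ideal_zero[OF iP] by simp
    with z show "z = z'" by (rule yP)
  qed
  have "card (y ` ?A) = p * (p - 1)" using card_image[OF inj] by (simp add: mult.commute nat_diff_distrib)
  have yR: "y ` ?A \<subseteq> R" using gR by (auto simp: y_def)
  \<comment> \<open>A relation between the n + 1 powers of \<open>x Q\<close>, nontrivial modulo p,
    is a polynomial vanishing at \<open>x Q\<close> that remains nonzero over R/P.\<close>
  have "\<exists>h. ev h (x Q) = 0 \<and> card {z \<in> y ` ?A. ev h z \<in> P} \<le> n" if Q: "Q \<in> S" for Q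
  proof -
    have xR: "x Q \<in> R" using x[OF Q] by (auto simp: generates_def)
    obtain c :: "nat \<Rightarrow> int" where c: "(\<Sum>i\<le>n. of_int (c i) * x Q ^ i) = 0" "\<exists>i\<le>n. \<not> int p dvd c i"
      using rank[of "\<lambda>i. x Q ^ i", OF power_mem[OF xR]] by blast
    define h where "h = (\<Sum>i\<le>n. monom (c i) i)"
    have ev_h: "ev h z = (\<Sum>i\<le>n. of_int (c i) * z ^ i)" for z :: 'a by (simp add: h_def)
    have "card {z \<in> y ` ?A. ev h z \<in> P} \<le> n"
    proof (rule root_bound[OF P(1), of n "\<lambda>i. of_int (c i)"])
      show "\<exists>i\<le>n. of_int (c i) \<notin> P" using c(2) of_int_in_prime[OF P(1)] by simp
      show "z = z'" if zz: "z \<in> {z \<in> y ` ?A. ev h z \<in> P}" "z' \<in> {z \<in> y ` ?A. ev h z \<in> P}" "z - z' \<in> P" for z z'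
      proof -
        obtain w w' where "w \<in> ?A" "w' \<in> ?A" "z = y w" "z' = y w'" using zz(1,2) by blast
        then show ?thesis using yP[of w w'] zz(3) by simp
      qed
      show "(\<Sum>i\<le>n. of_int (c i) * z ^ i) \<in> P" if "z \<in> {z \<in> y ` ?A. ev h z \<in> P}" for z
        using that ev_h[of z] by simp
    qed (use yR in auto)
    moreover have "ev h (x Q) = 0" using c(1) ev_h by simp
    ultimately show ?thesis by blast
  qed
  then have "\<exists>h. \<forall>Q\<in>S. ev (h Q) (x Q) = 0 \<and> card {z \<in> y ` ?A. ev (h Q) z \<in> P} \<le> n"
    by (intro bchoice ballI)
  then obtain h where h: "\<forall>Q\<in>S. ev (h Q) (x Q) = 0 \<and> card {z \<in> y ` ?A. ev (h Q) z \<in> P} \<le> n"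
    by (elim exE)
  \<comment> \<open>Only the primes treated before exclude candidates, so n times one less than the
    final number of primes must be below p (p - 1); this explains the summand n in the
    hypothesis.\<close>
  have "card (\<Union>Q\<in>S. {z \<in> y ` ?A. ev (h Q) z \<in> P}) \<le> (\<Sum>Q\<in>S. card {z \<in> y ` ?A. ev (h Q) z \<in> P})"
    using insert.hyps by (intro card_UN_le)
  also have "\<dots> \<le> card S * n" using sum_bounded_above[of S "\<lambda>Q. card {z \<in> y ` ?A. ev (h Q) z \<in> P}" n] h by simp
  also have "\<dots> < card (y ` ?A)" using insert.prems insert.hyps \<open>card (y ` ?A) = _\<close> by (simp add: mult.commute)
  finally have "\<not> y ` ?A \<subseteq> (\<Union>Q\<in>S. {z \<in> y ` ?A. ev (h Q) z \<in> P})"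
    using insert.hyps card_mono[of "\<Union>Q\<in>S. {z \<in> y ` ?A. ev (h Q) z \<in> P}" "y ` ?A"] by auto
  then obtain z where z: "z \<in> y ` ?A" "\<And>Q. Q \<in> S \<Longrightarrow> ev (h Q) z \<notin> P" by blast
  have gz: "generates P z"
  proof -
    obtain u v where uv: "1 \<le> u" "u < int p" "z = of_int u * g + of_int v" using z(1) by (auto simp: y_def)
    then have "\<not> int p dvd u" by (simp add: zdvd_not_zless)
    then show ?thesis using generates_affine[OF P(1) g] uv(3) by simp
  qed
  define x' where "x' = x(P := z)"
  have x'S: "x' Q = x Q" if "Q \<in> S" for Q using that insert.hyps by (auto simp: x'_def)
  have x'P: "x' P = z" by (simp add: x'_def)
  have sepQ: "\<exists>h. ev h (x' Q) \<in> Q \<and> ev h (x' P) \<notin> P" if Q: "Q \<in> S" for Q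
    proof (intro exI conjI)
    have "Q \<in> primes" using Q insert.prems by auto
    then show "ev (h Q) (x' Q) \<in> Q" using h Q x'S[OF Q] ideal_zero[OF prime_ideal] by simp
    show "ev (h Q) (x' P) \<notin> P" using z(2)[OF Q] x'P by simp
  qed
  have sepP: "\<exists>h. ev h (x' P) \<in> P \<and> ev h (x' Q) \<notin> Q" if Q: "Q \<in> S" for Q
  proof -
    obtain h' where "ev h' (x' Q) \<in> Q" "ev h' (x' P) \<notin> P" using sepQ[OF Q] by blast
    moreover have "Q \<in> primes" "x' Q \<in> R" using Q insert.prems x[OF Q] x'S[OF Q] by (auto simp: generates_def)
    ultimately show ?thesis using separation_sym[OF P(1), of Q "x' Q" z h'] gz x'P by simp
  qed
  show ?case
  proof (intro exI[of _ x'] conjI ballI impI)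
    show "generates Q (x' Q)" if "Q \<in> insert P S" for Q
      using that gz x[of Q] x'P x'S[of Q] by (cases "Q = P") simp_all
    show "\<exists>h. ev h (x' Q) \<in> Q \<and> ev h (x' Q') \<notin> Q'"
      if "Q \<in> insert P S" "Q' \<in> insert P S" "Q \<noteq> Q'" for Q Q'
      using that sepP[of Q'] sepQ[of Q] x2[of Q Q'] x'S[of Q] x'S[of Q'] by (cases "Q = P"; cases "Q' = P") simp_all
  qed
qed simp

text \<open>Primes of degree one receive distinct residues \<open>r P\<close> below p as generators.
  Then X - r(P) separates P from every other prime: if it vanished at a generator modulo Q, then Q
  would have degree one with the same residue.\<close>

lemma all_separated_generators:
  assumes "card {P \<in> primes. degree_one P} \<le> p"
    and "n * card {P \<in> primes. \<not> degree_one P} < p * (p - 1) + n"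
  shows "\<exists>x. (\<forall>P\<in>primes. generates P (x P)) \<and>
    (\<forall>P\<in>primes. \<forall>Q\<in>primes. P \<noteq> Q \<longrightarrow> (\<exists>h. ev h (x P) \<in> P \<and> ev h (x Q) \<notin> Q))"
proof -
  let ?D = "{P \<in> primes. \<not> degree_one P}"
  have "\<exists>x. (\<forall>P\<in>?D. generates P (x P)) \<and>
      (\<forall>P\<in>?D. \<forall>Q\<in>?D. P \<noteq> Q \<longrightarrow> (\<exists>h. ev h (x P) \<in> P \<and> ev h (x Q) \<notin> Q))"
    by (rule separated_generators) (use assms(2) finite_primes in simp_all)
  then obtain x where x0: "\<forall>P\<in>?D. generates P (x P)"
    "\<forall>P\<in>?D. \<forall>Q\<in>?D. P \<noteq> Q \<longrightarrow> (\<exists>h. ev h (x P) \<in> P \<and> ev h (x Q) \<notin> Q)"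
    by (elim exE conjE)
  have x: "generates P (x P)" if "P \<in> primes" "\<not> degree_one P" for P
    using x0(1) that by simp
  have x2: "\<exists>h. ev h (x P) \<in> P \<and> ev h (x Q) \<notin> Q"
    if "P \<in> primes" "\<not> degree_one P" "Q \<in> primes" "\<not> degree_one Q" "P \<noteq> Q" for P Q
    using x0(2) that by simp
  obtain r where r: "inj_on r {P \<in> primes. degree_one P}" "r ` {P \<in> primes. degree_one P} \<subseteq> {..<p}"
    using card_le_inj[of "{P \<in> primes. degree_one P}" "{..<p}"] assms(1) finite_primes by auto
  define x' where "x' P = (if degree_one P then of_nat (r P) else x P)" for P
  have gen: "generates P (x' P)" if P: "P \<in> primes" for P
  proof (cases "degree_one P")
    case True
    have "\<exists>h. y - ev h (x' P) \<in> P" if y: "y \<in> R" for y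
    proof -
      obtain m where "y - of_int m \<in> P" using True y by (auto simp: degree_one_def)
      then show ?thesis by (intro exI[of _ "[:m:]"]) auto
    qed
    then show ?thesis using True by (auto simp: generates_def x'_def)
  qed (use x[OF P] in \<open>simp add: x'_def\<close>)
  have sep1: "\<exists>h. ev h (x' P) \<in> P \<and> ev h (x' Q) \<notin> Q"
    if PQ: "P \<in> primes" "degree_one P" "Q \<in> primes" "P \<noteq> Q" for P Q
  proof (intro exI[of _ "[:- int (r P), 1:]"] conjI)
    show "ev [:- int (r P), 1:] (x' P) \<in> P"
      using PQ ideal_zero[OF prime_ideal] by (simp add: x'_def)
    show "ev [:- int (r P), 1:] (x' Q) \<notin> Q"
    proof
      assume "ev [:- int (r P), 1:] (x' Q) \<in> Q"
      then have *: "x' Q - of_int (int (r P)) \<in> Q" by simp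
      then have Q1: "degree_one Q" using degree_oneI[OF PQ(3) gen[OF PQ(3)]] by blast
      then have "of_int (int (r Q) - int (r P)) \<in> Q" using * by (simp add: x'_def)
      then have "int p dvd int (r Q) - int (r P)" using of_int_in_prime[OF PQ(3)] by blast
      moreover have "r P < p" "r Q < p" using r(2) PQ Q1 by (simp_all add: image_subset_iff)
      ultimately have "r P = r Q" using eq_if_dvd_diff[of p "int (r Q)" "int (r P)"] by simp
      then show False using r(1) PQ Q1 by (auto dest: inj_onD)
    qed
  qed
  have "\<exists>h. ev h (x' P) \<in> P \<and> ev h (x' Q) \<notin> Q" if PQ: "P \<in> primes" "Q \<in> primes" "P \<noteq> Q" for P Q
  proof (cases "degree_one P")
    case False
    show ?thesis
    proof (cases "degree_one Q")
      case True
      then obtain h where "ev h (x' Q) \<in> Q" "ev h (x' P) \<notin> P" using sep1[OF PQ(2) True PQ(1)] PQ(3) by blast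
      then show ?thesis using separation_sym[OF PQ(1,2) _ gen[OF PQ(1)]] gen[OF PQ(2)] by (auto simp: generates_def)
    next
      case Q: False
      then show ?thesis using x2[OF PQ(1) False PQ(2) Q PQ(3)] False by (simp add: x'_def)
    qed
  qed (use sep1[OF PQ(1) _ PQ(2,3)] in simp)
  then show ?thesis using gen by (intro exI[of _ x'] conjI ballI impI)
qed

text \<open>The separating polynomials allow the Chinese remainder theorem to be carried out inside
  Z[x]. Only the class of x modulo \<open>J\<close> matters, which leaves room to adjust x
  later.\<close>

lemma surjective_mod_J:
  assumes "card {P \<in> primes. degree_one P} \<le> p"
    and "n * card {P \<in> primes. \<not> degree_one P} < p * (p - 1) + n"
  shows "\<exists>x0\<in>R. \<forall>x\<in>R. x - x0 \<in> J \<longrightarrow> (\<forall>y\<in>R. \<exists>h. y - ev h x \<in> J)"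
proof -
  obtain a where a: "\<forall>P\<in>primes. generates P (a P)"
    "\<forall>P\<in>primes. \<forall>Q\<in>primes. P \<noteq> Q \<longrightarrow> (\<exists>h. ev h (a P) \<in> P \<and> ev h (a Q) \<notin> Q)"
    using all_separated_generators[OF assms] by (elim exE conjE)
  have aR: "a P \<in> R" if "P \<in> primes" for P using a(1) that by (simp add: generates_def)
  obtain x0 where x0: "x0 \<in> R" "\<forall>P\<in>primes. x0 - a P \<in> P" using crt[of a] aR by blast
  have "\<exists>h. y - ev h x \<in> J" if x: "x \<in> R" "x - x0 \<in> J" and y: "y \<in> R" for x y
  proof -
    have xa: "ev h x - ev h (a P) \<in> P" if P: "P \<in> primes" for P h
    proof (rule ev_cong[OF prime_ideal[OF P] x(1) aR[OF P]])
      have "x - x0 \<in> P" "x0 - a P \<in> P" using x(2) x0(2) P by (simp_all add: J_def)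
      then have "(x - x0) + (x0 - a P) \<in> P" by (rule ideal_add[OF prime_ideal[OF P]])
      then show "x - a P \<in> P" by simp
    qed
    have xa_iff: "ev h x \<in> P \<longleftrightarrow> ev h (a P) \<in> P" if P: "P \<in> primes" for P h
      using ideal_add_iff[OF prime_ideal[OF P] xa[OF P], of "ev h (a P)" h]
        ideal_diff[OF prime_ideal[OF P] _ xa[OF P], of "ev h x" h] by auto
    have ex: "\<exists>g. y - ev g x \<in> P \<and> (\<forall>Q\<in>primes - {P}. ev g x \<in> Q)" if P: "P \<in> primes" for P
    proof -
      note iP = prime_ideal[OF P]
      have "\<forall>Q\<in>primes - {P}. \<exists>h. ev h x \<in> Q \<and> ev h x \<notin> P"
      proof
        fix Q assume Q: "Q \<in> primes - {P}"
        then obtain h where "ev h (a Q) \<in> Q" "ev h (a P) \<notin> P" using a(2) P by auto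
        then show "\<exists>h. ev h x \<in> Q \<and> ev h x \<notin> P" using xa_iff[of Q h] xa_iff[of P h] Q P by auto
      qed
      then obtain h where h: "\<forall>Q\<in>primes - {P}. ev (h Q) x \<in> Q \<and> ev (h Q) x \<notin> P"
        by (rule bchoice[THEN exE])
      \<comment> \<open>The value of k at x lies in every prime but P; multiplying by a polynomial
        that represents y divided by this value in R/P gives y at P and 0 elsewhere.\<close>
      define k where "k = (\<Prod>Q\<in>primes - {P}. h Q)"
      have kP: "ev k x \<notin> P" unfolding k_def ev_prod
        by (rule prime_prod[OF P]) (use h x in auto)
      have kQ: "ev k x \<in> Q" if Q: "Q \<in> primes - {P}" for Q unfolding k_def ev_prod
        by (rule ideal_prod[of Q _ Q]) (use h x Q finite_primes prime_ideal in auto)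
      obtain v where v: "v \<in> R" "ev k x * v - 1 \<in> P" using prime_inverse[OF P ev_mem[OF x(1)] kP] by (elim bexE)
      obtain g where "y * v - ev g (a P) \<in> P" using a(1) P mult_mem[OF y v(1)] unfolding generates_def by blast
      then have "(y * v - ev g (a P)) - (ev g x - ev g (a P)) \<in> P"
        by (rule ideal_diff[OF iP _ xa[OF P]])
      then have g: "y * v - ev g x \<in> P" by simp
      have "ev k x * (y * v - ev g x) - y * (ev k x * v - 1) \<in> P"
        by (intro ideal_diff[OF iP] ideal_mult[OF iP] ev_mem x(1) y v g)
      then have "y - ev (g * k) x \<in> P" by (simp add: algebra_simps)
      moreover have "ev (g * k) x \<in> Q" if Q: "Q \<in> primes - {P}" for Q
        unfolding ev_mult using Q by (intro ideal_mult prime_ideal ev_mem x(1) kQ) auto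
      ultimately show ?thesis by blast
    qed
    then obtain g where g: "\<forall>P\<in>primes. y - ev (g P) x \<in> P \<and> (\<forall>Q\<in>primes - {P}. ev (g P) x \<in> Q)"
      using bchoice[of primes "\<lambda>P g. y - ev g x \<in> P \<and> (\<forall>Q\<in>primes - {P}. ev g x \<in> Q)"] by auto
    have "y - ev (\<Sum>P\<in>primes. g P) x \<in> P" if P: "P \<in> primes" for P
    proof -
      note iP = prime_ideal[OF P]
      have "y - ev (\<Sum>P\<in>primes. g P) x = (y - ev (g P) x) - (\<Sum>Q\<in>primes - {P}. ev (g Q) x)"
        using P finite_primes by (simp add: sum.remove[of primes P])
      also have "\<dots> \<in> P" by (rule ideal_diff[OF iP], use g P in blast, rule ideal_sum[OF iP]) (use g P in blast)
      finally show ?thesis .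
    qed
    moreover have "y - ev (\<Sum>P\<in>primes. g P) x \<in> R" using x y by (intro diff_mem ev_mem)
    ultimately have "y - ev (\<Sum>P\<in>primes. g P) x \<in> J" by (simp add: J_def)
    then show ?thesis ..
  qed
  then show ?thesis by (intro bexI[OF _ x0(1)] ballI impI)
qed

section \<open>The Frobenius map modulo \<open>J\<close> and the adjustment of the generator\<close>

lemma frobenius_add:
  assumes "x \<in> R" "y \<in> R"
  shows "(x + y) ^ p - (x ^ p + y ^ p) \<in> pR"
proof -
  have p: "{..p} = insert 0 (insert p {0<..<p})" using p_gt_1 by auto
  have "(x + y) ^ p = (\<Sum>k\<le>p. of_nat (p choose k) * x ^ k * y ^ (p - k))" by (rule binomial_ring)
  also have "\<dots> = x ^ p + y ^ p + (\<Sum>k\<in>{0<..<p}. of_nat (p choose k) * x ^ k * y ^ (p - k))"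
    unfolding p using p_gt_1 by (subst sum.insert | simp)+
  finally have "(x + y) ^ p - (x ^ p + y ^ p) = (\<Sum>k\<in>{0<..<p}. of_nat (p choose k) * x ^ k * y ^ (p - k))"
    by simp
  also have "\<dots> \<in> pR"
  proof (rule ideal_sum[OF is_ideal_pR])
    fix k assume "k \<in> {0<..<p}"
    then have "p dvd p choose k" using prime_p by (intro dvd_choose_prime) auto
    then obtain c where c: "p choose k = p * c" by auto
    have "of_nat p * (of_nat c * x ^ k * y ^ (p - k)) \<in> pR" using assms by (intro pR_I mult_mem power_mem of_nat_mem)
    then show "of_nat (p choose k) * x ^ k * y ^ (p - k) \<in> pR" by (simp add: c mult.assoc)
  qed
  finally show ?thesis .
qed

lemma in_J_if_power_in_J:
  assumes "x \<in> R" "x ^ k \<in> J" shows "x \<in> J"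
proof -
  have "x \<in> P" if P: "P \<in> primes" for P
  proof (rule prime_power[OF P assms(1)])
    show "x ^ k \<in> P" using assms(2) P by (simp add: J_def)
  qed
  then show ?thesis using assms(1) by (simp add: J_def)
qed

text \<open>Frobenius is additive modulo p and R/J is reduced, so Frobenius is injective on
  R/J.\<close>

lemma in_J_if_frobenius_in_J:
  assumes "x \<in> R" "y \<in> R" "x ^ p - y ^ p \<in> J"
  shows "x - y \<in> J"
proof -
  have "((x - y) + y) ^ p - ((x - y) ^ p + y ^ p) \<in> J"
    using frobenius_add[of "x - y" y, OF diff_mem[OF assms(1,2)] assms(2)] pR_subset_J by (rule subsetD[rotated])
  then have "(x ^ p - y ^ p) - (((x - y) + y) ^ p - ((x - y) ^ p + y ^ p)) \<in> J"
    by (rule ideal_diff[OF is_ideal_J assms(3)])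
  then have "(x - y) ^ p \<in> J" by simp
  then show ?thesis by (rule in_J_if_power_in_J[OF diff_mem[OF assms(1,2)]])
qed

lemma in_J_if_iterated_frobenius_in_J:
  "x \<in> R \<Longrightarrow> y \<in> R \<Longrightarrow> x ^ (p ^ i) - y ^ (p ^ i) \<in> J \<Longrightarrow> x - y \<in> J"
proof (induction i)
  case (Suc i)
  have "(x ^ (p ^ i)) ^ p - (y ^ (p ^ i)) ^ p \<in> J"
    using Suc.prems by (simp add: power_mult[symmetric] mult.commute)
  then have "x ^ (p ^ i) - y ^ (p ^ i) \<in> J"
    using in_J_if_frobenius_in_J power_mem Suc.prems by simp
  then show ?case using Suc by simp
qed simp

lemma ideal_power_diff:
  assumes "is_ideal I" "x \<in> R" "y \<in> R" "x - y \<in> I"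
  shows "x ^ k - y ^ k \<in> I"
  using ev_cong[OF assms, of "monom 1 k"] by simp

text \<open>Pigeonhole and injectivity of Frobenius give each element a period under Frobenius
  modulo \<open>J\<close>. Finitely many representatives suffice, and the product of their periods
  serves all of R.\<close>

lemma frobenius_identity_mod_J:
  "\<exists>M>0. \<forall>x\<in>R. x ^ (p ^ M) - x \<in> J"
proof -
  have per: "\<exists>r>0. x ^ (p ^ r) - x \<in> J" if x: "x \<in> R" for x
  proof -
    obtain i j where ij: "i < j" "x ^ (p ^ i) - x ^ (p ^ j) \<in> pR"
      using pigeonhole_mod_p[of "\<lambda>i. x ^ (p ^ i)"] power_mem[OF x] by auto
    then have "x ^ (p ^ i) - (x ^ (p ^ (j - i))) ^ (p ^ i) \<in> J"
      using subsetD[OF pR_subset_J ij(2)] ij(1) by (simp flip: power_mult power_add)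
    then have "x - x ^ (p ^ (j - i)) \<in> J"
      by (rule in_J_if_iterated_frobenius_in_J[OF x power_mem[OF x]])
    then have "- (x - x ^ (p ^ (j - i))) \<in> J" by (rule ideal_uminus[OF is_ideal_J])
    then show ?thesis using ij(1) by (intro exI[of _ "j - i"]) simp
  qed
  obtain T where T: "finite T" "T \<subseteq> R" "\<And>x. x \<in> R \<Longrightarrow> \<exists>t\<in>T. \<exists>y\<in>R. x = t + of_nat p * y"
    using finite_mod_p by blast
  have "\<forall>t\<in>T. \<exists>r>0. t ^ (p ^ r) - t \<in> J" by (intro ballI per subsetD[OF T(2)])
  then obtain r where r: "\<forall>t\<in>T. r t > 0 \<and> t ^ (p ^ (r t)) - t \<in> J"
    using bchoice[of T "\<lambda>t r. r > 0 \<and> t ^ (p ^ r) - t \<in> J"] by auto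
  define M where "M = prod r T"
  have mult: "t ^ (p ^ (s * m)) - t \<in> J" if t: "t \<in> R" "t ^ (p ^ s) - t \<in> J" for t s m
  proof (induction m)
    case (Suc m)
    have "(t ^ (p ^ (s * m))) ^ (p ^ s) - t ^ (p ^ s) \<in> J"
      using ideal_power_diff[OF is_ideal_J power_mem[OF t(1)] t(1) Suc] .
    then have "((t ^ (p ^ (s * m))) ^ (p ^ s) - t ^ (p ^ s)) + (t ^ (p ^ s) - t) \<in> J"
      using t(2) by (rule ideal_add[OF is_ideal_J])
    then show ?case by (simp add: power_add mult.commute flip: power_mult)
  qed (use ideal_zero[OF is_ideal_J] in simp)
  have "x ^ (p ^ M) - x \<in> J" if x: "x \<in> R" for x
  proof -
    obtain t y where t: "t \<in> T" "y \<in> R" "x = t + of_nat p * y" using T(3)[OF x] by blast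
    have tR: "t \<in> R" using t(1) T(2) by blast
    have xt: "x - t \<in> J" using subsetD[OF pR_subset_J pR_I[OF t(2)]] t(3) by simp
    have "M = r t * prod r (T - {t})" unfolding M_def using T(1) t(1) by (rule prod.remove)
    then have "t ^ (p ^ M) - t \<in> J" using mult[OF tR] r t(1) by simp
    then have "(x ^ (p ^ M) - t ^ (p ^ M)) + (t ^ (p ^ M) - t) - (x - t) \<in> J"
      by (rule ideal_diff[OF is_ideal_J ideal_add[OF is_ideal_J ideal_power_diff[OF is_ideal_J x tR xt]] xt])
    then show ?thesis by simp
  qed
  moreover have "M > 0" unfolding M_def using r by (intro prod_pos) auto
  ultimately show ?thesis by blast
qed

text \<open>Since \<open>X\<^sup>q - X\<close> has derivative \<open>-1\<close> modulo \<open>p\<close>, moving \<open>x\<^sub>0\<close> inside its class modulo \<open>J\<close> moves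
  \<open>x\<^sup>q - x\<close> freely inside \<open>J\<close>, up to \<open>J\<^sup>2 + pR\<close>; so it can be made a generator of \<open>J\<close>.\<close>

lemma generator_of_J_in_subring:
  assumes x0: "x0 \<in> R"
  shows "\<exists>x\<in>R. \<exists>g. x - x0 \<in> J \<and> ev g x \<in> J \<and> (\<forall>z\<in>J. \<exists>u\<in>R. z - ev g x * u \<in> pR)"
proof -
  obtain w where w: "w \<in> J" "\<forall>z\<in>J. \<exists>u\<in>R. z - w * u \<in> pR" using J_principal_mod_p by blast
  obtain M where M: "M > 0" "\<forall>x\<in>R. x ^ (p ^ M) - x \<in> J" using frobenius_identity_mod_J by blast
  \<comment> \<open>One application of additivity of Frobenius already makes the difference of the
    p-th powers of x and x0 divisible by e^2 modulo p; raising to the power q preserves this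
    congruence.\<close>
  define q where "q = p ^ (M - 1)"
  have q: "p ^ M = p * q" using M(1) by (simp add: q_def flip: power_Suc)
  have JR: "z \<in> R" if "z \<in> J" for z using that by (simp add: J_def)
  \<comment> \<open>Newton step for the equation \<open>x ^ (p * q) - x = w\<close>: with x = x0 +
    e, the left side equals w plus \<open>x ^ (p * q) - x0 ^ (p * q)\<close>.\<close>
  define e where "e = x0 ^ (p * q) - x0 - w"
  have eJ: "e \<in> J"
    unfolding e_def q[symmetric] by (rule ideal_diff[OF is_ideal_J bspec[OF M(2) x0] w(1)])
  define x where "x = x0 + e"
  have xR: "x \<in> R" unfolding x_def by (rule add_mem[OF x0 JR[OF eJ]])
  let ?I = "{e\<^sup>2 * y + z | y z. y \<in> R \<and> z \<in> pR}"
  have I: "is_ideal ?I" using JR[OF eJ] by (intro is_ideal_sum is_ideal_pR power_mem)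
  have pI: "z \<in> ?I" if "z \<in> pR" for z
    using that zero_mem by (intro CollectI exI[of _ 0] exI[of _ z]) simp
  have "2 + (p - 2) = p" using p_gt_1 by simp
  then have "e ^ p = e\<^sup>2 * e ^ (p - 2) + 0" by (metis power_add add_0_right)
  moreover have "e ^ (p - 2) \<in> R" "0 \<in> pR" by (rule power_mem[OF JR[OF eJ]], rule ideal_zero[OF is_ideal_pR])
  ultimately have epI: "e ^ p \<in> ?I" by (intro CollectI exI conjI)
  have "x ^ p - (x0 ^ p + e ^ p) \<in> ?I" unfolding x_def using frobenius_add[OF x0 JR[OF eJ]] by (rule pI)
  then have "(x ^ p - (x0 ^ p + e ^ p)) + e ^ p \<in> ?I" using epI by (rule ideal_add[OF I])
  then have "x ^ p - x0 ^ p \<in> ?I" by simp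
  then have "(x ^ p) ^ q - (x0 ^ p) ^ q \<in> ?I"
    by (rule ideal_power_diff[OF I power_mem[OF xR] power_mem[OF x0]])
  then obtain y z where yz: "y \<in> R" "z \<in> pR" "x ^ (p * q) - x0 ^ (p * q) = e\<^sup>2 * y + z"
    unfolding power_mult[symmetric] by blast
  define b where "b = x ^ (p * q) - x"
  have b: "b = w + e\<^sup>2 * y + z" using yz(3) by (simp add: b_def x_def e_def)
  \<comment> \<open>As e is congruent to w u modulo p, the quadratic error is w times an element of
    \<open>J\<close>. Hence b is w times a unit modulo p and generates the same ideal.\<close>
  obtain u where u: "u \<in> R" "e - w * u \<in> pR" using bspec[OF w(2) eJ] by (elim bexE)
  have "(e - w * u) * (e + w * u) \<in> pR"
    using u JR[OF eJ] JR[OF w(1)] by (intro ideal_mult'[OF is_ideal_pR] add_mem mult_mem)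
  then have "(e - w * u) * (e + w * u) * y \<in> pR" by (rule ideal_mult'[OF is_ideal_pR yz(1)])
  then have "(e - w * u) * (e + w * u) * y + z \<in> pR" using yz(2) by (rule ideal_add[OF is_ideal_pR])
  moreover have "b - w * (1 + w * u\<^sup>2 * y) = (e - w * u) * (e + w * u) * y + z"
    by (simp add: b algebra_simps power2_eq_square)
  ultimately have bw: "b - w * (1 + w * u\<^sup>2 * y) \<in> pR" by simp
  have nP: "1 + w * u\<^sup>2 * y \<notin> P" if P: "P \<in> primes" for P
  proof
    assume *: "1 + w * u\<^sup>2 * y \<in> P"
    have "w \<in> P" using w(1) P by (simp add: J_def)
    then have "w * (u\<^sup>2 * y) \<in> P" using u yz by (intro ideal_mult'[OF prime_ideal[OF P]] mult_mem power_mem)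
    then show False using * ideal_add_iff[OF prime_ideal[OF P], of "w * (u\<^sup>2 * y)" 1] one_notin_prime[OF P]
      by (simp add: mult.assoc)
  qed
  have R1: "1 + w * u\<^sup>2 * y \<in> R" using JR[OF w(1)] u(1) yz(1) by (intro add_mem mult_mem power_mem one_mem)
  obtain v where v: "v \<in> R" "(1 + w * u\<^sup>2 * y) * v - 1 \<in> pR" using unit_mod_p[OF R1] nP by blast
  have "(b - w * (1 + w * u\<^sup>2 * y)) * v + w * ((1 + w * u\<^sup>2 * y) * v - 1) \<in> pR"
    by (intro ideal_add[OF is_ideal_pR] ideal_mult[OF is_ideal_pR] ideal_mult'[OF is_ideal_pR] bw v JR w(1))
  then have wb: "b * v - w \<in> pR" by (simp add: algebra_simps)
  have bR: "b \<in> R" unfolding b_def using xR by (intro diff_mem power_mem)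
  have gen: "\<exists>t\<in>R. z - b * t \<in> pR" if zJ: "z \<in> J" for z
  proof -
    obtain s where s: "s \<in> R" "z - w * s \<in> pR" using bspec[OF w(2) zJ] by (elim bexE)
    have "(z - w * s) - (b * v - w) * s \<in> pR"
      by (intro ideal_diff[OF is_ideal_pR] ideal_mult'[OF is_ideal_pR] s wb)
    then have "z - b * (v * s) \<in> pR" by (simp add: algebra_simps)
    then show ?thesis by (rule bexI[OF _ mult_mem[OF v(1) s(1)]])
  qed
  have "b \<in> J" unfolding b_def q[symmetric] by (rule bspec[OF M(2) xR])
  moreover have "ev (monom 1 (p * q) - monom 1 1) x = b" by (simp add: b_def)
  moreover have "x - x0 \<in> J" using eJ by (simp add: x_def)
  ultimately show ?thesis using xR gen
    by (intro bexI[of _ x] exI[of _ "monom 1 (p * q) - monom 1 1"]) simp_all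
qed

theorem monogenic_mod_p:
  assumes "card {P \<in> primes. degree_one P} \<le> p"
    and "n * card {P \<in> primes. \<not> degree_one P} < p * (p - 1) + n"
  shows "\<exists>x\<in>R. \<forall>y\<in>R. \<exists>h. y - ev h x \<in> pR"
proof -
  obtain x0 where x0: "x0 \<in> R" "\<forall>x\<in>R. x - x0 \<in> J \<longrightarrow> (\<forall>y\<in>R. \<exists>h. y - ev h x \<in> J)"
    using surjective_mod_J[OF assms] by blast
  obtain x g where x: "x \<in> R" "x - x0 \<in> J" "ev g x \<in> J" "\<forall>z\<in>J. \<exists>u\<in>R. z - ev g x * u \<in> pR"
    using generator_of_J_in_subring[OF x0(1)] by (elim bexE exE conjE)
  have surj: "\<forall>y\<in>R. \<exists>h. y - ev h x \<in> J" using bspec[OF x0(2) x(1)] x(2) by (rule mp)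
  obtain N where N: "ev g x ^ N \<in> pR" using J_nilpotent[OF x(3)] by (elim exE)
  have "\<exists>h. y - ev h x \<in> pR" if y: "y \<in> R" for y
  proof -
    \<comment> \<open>Here \<open>ev g x\<close> lies in Z[x] and generates \<open>J\<close> modulo
      p. Approximating u by Z[x] up to \<open>J\<close> turns the remainder from a multiple of its
      k-th power into a multiple of the next power.\<close>
    have step: "\<exists>h. \<exists>u\<in>R. y - ev h x - ev g x ^ k * u \<in> pR" for k
    proof (induction k)
      case 0
      have "y - ev 0 x - ev g x ^ 0 * y \<in> pR" using ideal_zero[OF is_ideal_pR] by simp
      then show ?case by (intro exI bexI[OF _ y])
    next
      case (Suc k)
      then obtain h u where h: "u \<in> R" "y - ev h x - ev g x ^ k * u \<in> pR" by (elim exE bexE)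
      obtain h' where h': "u - ev h' x \<in> J" using bspec[OF surj h(1)] by (elim exE)
      obtain u' where u': "u' \<in> R" "(u - ev h' x) - ev g x * u' \<in> pR"
        using bspec[OF x(4) h'] by (elim bexE)
      have "(y - ev h x - ev g x ^ k * u) + ev g x ^ k * ((u - ev h' x) - ev g x * u') \<in> pR"
        by (intro ideal_add[OF is_ideal_pR] ideal_mult[OF is_ideal_pR] h u' power_mem ev_mem x(1))
      then have "y - ev (h + g ^ k * h') x - ev g x ^ Suc k * u' \<in> pR" by (simp add: algebra_simps)
      then show ?case by (intro exI bexI[OF _ u'(1)])
    qed
    obtain h u where h: "u \<in> R" "y - ev h x - ev g x ^ N * u \<in> pR"
      using step[of N] by (elim exE bexE)
    have "(y - ev h x - ev g x ^ N * u) + ev g x ^ N * u \<in> pR"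
      by (intro ideal_add[OF is_ideal_pR] ideal_mult'[OF is_ideal_pR] h N)
    then have "y - ev h x \<in> pR" by simp
    then show ?thesis ..
  qed
  then show ?thesis by (intro bexI[OF _ x(1)] ballI)
qed

section \<open>Counting the primes over p\<close>

lemma card_le_rank:
  fixes z :: "'i \<Rightarrow> 'a"
  assumes A: "finite A" "\<And>i. i \<in> A \<Longrightarrow> z i \<in> R"
    and indep: "\<And>c i. (\<Sum>i\<in>A. of_int (c i) * z i) = 0 \<Longrightarrow> i \<in> A \<Longrightarrow> int p dvd c i"
  shows "card A \<le> n"
proof (rule ccontr)
  assume "\<not> card A \<le> n"
  then have "card {..n} \<le> card A" by simp
  then obtain g where g: "g ` {..n} \<subseteq> A" "inj_on g {..n}"
    using card_le_inj[of "{..n}" A] A(1) by auto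
  have "\<exists>c :: nat \<Rightarrow> int. (\<Sum>i\<le>n. of_int (c i) * z (g i)) = 0 \<and> (\<exists>i\<le>n. \<not> int p dvd c i)"
    by (rule rank) (use A(2) g(1) in auto)
  then obtain c :: "nat \<Rightarrow> int" and i where c: "(\<Sum>i\<le>n. of_int (c i) * z (g i)) = 0" "i \<le> n" "\<not> int p dvd c i"
    by (elim exE conjE)
  define d where "d j = (if j \<in> g ` {..n} then c (the_inv_into {..n} g j) else 0)" for j
  have d: "d (g j) = c j" if "j \<le> n" for j
    using that g(2) by (simp add: d_def the_inv_into_f_f)
  have "(\<Sum>j\<in>A. of_int (d j) * z j) = (\<Sum>j\<in>g ` {..n}. of_int (d j) * z j)"
    using A(1) g(1) by (intro sum.mono_neutral_right) (auto simp: d_def)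
  also have "\<dots> = (\<Sum>j\<le>n. of_int (c j) * z (g j))"
    by (simp add: sum.reindex[OF g(2)] d)
  finally have "int p dvd d (g i)" using c(1,2) g(1) by (intro indep) auto
  then show False using d c(2,3) by simp
qed

text \<open>A substitute for sum e f <= n: every prime counts once through \<open>e P\<close>, every
  prime of T once more through \<open>y P\<close>. Since \<open>y P\<close> may lie in P, the
  coefficients of the \<open>e P\<close> are read off modulo P first; what remains is a relation
  between the \<open>y P\<close> modulo pR, the form in which \<open>indep_y\<close> is
  required.\<close>

lemma card_primes_weighted:
  assumes T: "T \<subseteq> primes"
    and e: "\<And>P. P \<in> primes \<Longrightarrow> e P \<in> R" "\<And>P Q. P \<in> primes \<Longrightarrow> Q \<in> primes \<Longrightarrow> Q \<noteq> P \<Longrightarrow> e P \<in> Q"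
    and y: "\<And>P. P \<in> T \<Longrightarrow> y P \<in> R" "\<And>P Q. P \<in> T \<Longrightarrow> Q \<in> primes \<Longrightarrow> Q \<noteq> P \<Longrightarrow> y P \<in> Q"
    and indep: "\<And>P c. P \<in> primes \<Longrightarrow> P \<notin> T \<Longrightarrow> of_int c * e P \<in> P \<Longrightarrow> int p dvd c"
    and indep_T: "\<And>P c d. P \<in> T \<Longrightarrow> of_int c * e P + of_int d * y P \<in> P \<Longrightarrow> int p dvd c"
    and indep_y: "\<And>c P. (\<Sum>P\<in>T. of_int (c P) * y P) \<in> pR \<Longrightarrow> P \<in> T \<Longrightarrow> int p dvd c P"
  shows "card primes + card T \<le> n"
proof -
  have fT: "finite T" using T finite_primes by (rule finite_subset)
  define z where "z i = (case i of Inl P \<Rightarrow> e P | Inr P \<Rightarrow> y P)" for i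
  have "card (primes <+> T) \<le> n"
  proof (rule card_le_rank[of _ z])
    show "finite (primes <+> T)" using fT finite_primes by simp
    show "z i \<in> R" if "i \<in> primes <+> T" for i using that e y by (auto simp: z_def)
    fix c i assume c: "(\<Sum>i\<in>primes <+> T. of_int (c i) * z i) = 0" and i: "i \<in> primes <+> T"
    have eq: "(\<Sum>P\<in>primes. of_int (c (Inl P)) * e P) + (\<Sum>P\<in>T. of_int (c (Inr P)) * y P) = 0"
      using c by (simp add: sum.Plus[OF finite_primes fT] z_def)
    have dvd: "int p dvd c (Inl P)" if P: "P \<in> primes" for P
    proof -
      note iP = prime_ideal[OF P]
      have e_split: "(\<Sum>P\<in>primes. of_int (c (Inl P)) * e P) = of_int (c (Inl P)) * e P + (\<Sum>Q\<in>primes - {P}. of_int (c (Inl Q)) * e Q)"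
        using P finite_primes by (simp add: sum.remove[of primes P])
      have e_rest: "(\<Sum>Q\<in>primes - {P}. of_int (c (Inl Q)) * e Q) \<in> P"
        by (rule ideal_sum[OF iP], rule ideal_mult[OF iP of_int_mem], rule e(2)) (use P in auto)
      have y_rest: "(\<Sum>Q\<in>T - {P}. of_int (c (Inr Q)) * y Q) \<in> P"
        by (rule ideal_sum[OF iP], rule ideal_mult[OF iP of_int_mem], rule y(2)) (use P in auto)
      show ?thesis
      proof (cases "P \<in> T")
        case True
        then have "(\<Sum>P\<in>T. of_int (c (Inr P)) * y P) = of_int (c (Inr P)) * y P + (\<Sum>Q\<in>T - {P}. of_int (c (Inr Q)) * y Q)"
          using fT by (simp add: sum.remove[of T P])
        then have "of_int (c (Inl P)) * e P + of_int (c (Inr P)) * y P =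
          - ((\<Sum>Q\<in>primes - {P}. of_int (c (Inl Q)) * e Q) + (\<Sum>Q\<in>T - {P}. of_int (c (Inr Q)) * y Q))"
          using eq e_split by (simp add: algebra_simps eq_neg_iff_add_eq_0)
        also have "\<dots> \<in> P" by (rule ideal_uminus[OF iP ideal_add[OF iP e_rest y_rest]])
        finally show ?thesis by (rule indep_T[OF True])
      next
        case False
        then have "of_int (c (Inl P)) * e P =
          - ((\<Sum>Q\<in>primes - {P}. of_int (c (Inl Q)) * e Q) + (\<Sum>Q\<in>T - {P}. of_int (c (Inr Q)) * y Q))"
          using eq e_split by (simp add: algebra_simps eq_neg_iff_add_eq_0)
        also have "\<dots> \<in> P" by (rule ideal_uminus[OF iP ideal_add[OF iP e_rest y_rest]])
        finally show ?thesis by (rule indep[OF P False])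
      qed
    qed
    have "(\<Sum>P\<in>primes. of_int (c (Inl P)) * e P) \<in> pR"
    proof (rule ideal_sum[OF is_ideal_pR])
      fix P assume P: "P \<in> primes"
      then obtain k where "c (Inl P) = int p * k" using dvd by blast
      moreover have "of_nat p * (of_int k * e P) \<in> pR" by (rule pR_I, rule mult_mem[OF of_int_mem e(1)[OF P]])
      ultimately show "of_int (c (Inl P)) * e P \<in> pR" by (simp add: mult.assoc)
    qed
    then have "- (\<Sum>P\<in>primes. of_int (c (Inl P)) * e P) \<in> pR" by (rule ideal_uminus[OF is_ideal_pR])
    moreover have "(\<Sum>P\<in>T. of_int (c (Inr P)) * y P) = - (\<Sum>P\<in>primes. of_int (c (Inl P)) * e P)"
      using eq by (simp add: eq_neg_iff_add_eq_0 add.commute)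
    ultimately have y_sum: "(\<Sum>P\<in>T. of_int (c (Inr P)) * y P) \<in> pR" by simp
    show "int p dvd c i"
    proof (cases i)
      case (Inl P)
      then show ?thesis using dvd i by auto
    next
      case (Inr P)
      then show ?thesis using indep_y[of "\<lambda>P. c (Inr P)", OF y_sum] i by auto
    qed
  qed
  then show ?thesis using fT finite_primes by (simp add: card_Plus)
qed

lemma of_int_mult_in_prime:
  assumes "P \<in> primes" "z \<in> R" "z \<notin> P" "of_int c * z \<in> P"
  shows "int p dvd c"
  using prime_mult[OF assms(1) of_int_mem assms(2,4)] assms(3) of_int_in_prime[OF assms(1)] by simp

text \<open>The extra unit comes from an element \<open>z P\<close> congruent to no integer modulo
  P: \<open>e P\<close> and \<open>e P * z P\<close> are independent over Z/p in R/P.\<close>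

lemma card_primes_degree:
  "card primes + card {P \<in> primes. \<not> degree_one P} \<le> n"
proof -
  obtain e where e0: "\<forall>P\<in>primes. e P \<in> R \<and> e P - 1 \<in> P \<and> (\<forall>Q\<in>primes - {P}. e P \<in> Q)"
    using idempotent_family by (elim exE)
  have e: "e P \<in> R" "e P - 1 \<in> P" if "P \<in> primes" for P using e0 that by simp_all
  have eQ: "e P \<in> Q" if "P \<in> primes" "Q \<in> primes" "Q \<noteq> P" for P Q using e0 that by simp
  have e1: "e P \<notin> P" if P: "P \<in> primes" for P
    using ideal_diff[OF prime_ideal[OF P] _ e(2)[OF P], of "e P"] one_notin_prime[OF P] by auto
  have "\<forall>P\<in>{P \<in> primes. \<not> degree_one P}. \<exists>z. z \<in> R \<and> (\<forall>m :: int. z - of_int m \<notin> P)"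
    by (auto simp: degree_one_def)
  then obtain z where z: "\<forall>P\<in>{P \<in> primes. \<not> degree_one P}. z P \<in> R \<and> (\<forall>m :: int. z P - of_int m \<notin> P)"
    by (rule bchoice[THEN exE])
  let ?T = "{P \<in> primes. \<not> degree_one P}"
  have two: "int p dvd c \<and> int p dvd d" if P: "P \<in> ?T" and cd: "of_int c * e P + of_int d * (e P * z P) \<in> P" for P c d
  proof -
    have P': "P \<in> primes" using P by simp
    note iP = prime_ideal[OF P']
    have zR: "z P \<in> R" using z P by simp
    have "e P * (of_int c + of_int d * z P) \<in> P" using cd by (simp add: algebra_simps)
    then have *: "of_int c + of_int d * z P \<in> P"
      using prime_mult[OF P' e(1)[OF P'] add_mem[OF of_int_mem mult_mem[OF of_int_mem zR]]] e1[OF P'] by simp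
    have d: "int p dvd d"
    proof (rule ccontr)
      assume "\<not> int p dvd d"
      then obtain k where "int p dvd (k * d - 1)" by (rule exE[OF int_inverse_mod_p])
      then have "of_int (k * d - 1) \<in> P" by (rule iffD2[OF of_int_in_prime[OF P']])
      then have "of_int (k * d - 1) * z P \<in> P" by (rule ideal_mult'[OF iP zR])
      moreover have "of_int k * (of_int c + of_int d * z P) \<in> P" by (rule ideal_mult[OF iP of_int_mem *])
      ultimately have "of_int k * (of_int c + of_int d * z P) - of_int (k * d - 1) * z P \<in> P"
        by (rule ideal_diff[OF iP, rotated])
      then have "z P - of_int (- (k * c)) \<in> P" by (simp add: algebra_simps)
      with spec[OF conjunct2[OF bspec[OF z P]]] show False by (rule notE)
    qed
    then have "of_int d * z P \<in> P" using of_int_in_prime[OF P'] by (intro ideal_mult'[OF iP zR]) simp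
    then have "of_int c \<in> P" using * ideal_add_iff[OF iP] by simp
    then show ?thesis using d of_int_in_prime[OF P'] by simp
  qed
  show ?thesis
  proof (rule card_primes_weighted[of ?T e "\<lambda>P. e P * z P"])
    show "e P * z P \<in> R" if "P \<in> ?T" for P using that e z by (intro mult_mem) auto
    show "e P * z P \<in> Q" if "P \<in> ?T" "Q \<in> primes" "Q \<noteq> P" for P Q
      using that z eQ by (intro ideal_mult'[OF prime_ideal]) auto
    show "int p dvd c" if "P \<in> primes" "P \<notin> ?T" "of_int c * e P \<in> P" for P c
      using of_int_mult_in_prime[OF that(1) e(1) e1 that(3)] that(1) by simp
    show "int p dvd c" if "P \<in> ?T" "of_int c * e P + of_int d * (e P * z P) \<in> P" for P c d
      using two[OF that] by simp
    show "int p dvd c P" if c: "(\<Sum>P\<in>?T. of_int (c P) * (e P * z P)) \<in> pR" and P: "P \<in> ?T" for c P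
    proof -
      have P': "P \<in> primes" using P by simp
      note iP = prime_ideal[OF P']
      have "(\<Sum>P\<in>?T. of_int (c P) * (e P * z P)) = of_int (c P) * (e P * z P) + (\<Sum>Q\<in>?T - {P}. of_int (c Q) * (e Q * z Q))"
        using P finite_primes by (subst sum.remove[of ?T P]) simp_all
      moreover have "(\<Sum>Q\<in>?T - {P}. of_int (c Q) * (e Q * z Q)) \<in> P"
        using P z eQ by (intro ideal_sum[OF iP] ideal_mult[OF iP of_int_mem] ideal_mult'[OF iP]) auto
      moreover have "(\<Sum>P\<in>?T. of_int (c P) * (e P * z P)) \<in> P"
        using c pR_subset[OF iP p_in_prime[OF P']] by (rule subsetD[rotated])
      ultimately have "of_int (c P) * (e P * z P) \<in> P" using ideal_add_iff[OF iP] by simp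
      then show ?thesis using two[OF P, of 0 "c P"] by simp
    qed
  qed (use e eQ in auto)
qed

text \<open>In the localization at P, the number p generates P; the common denominator s keeps the
  statement inside R.\<close>

definition unramified :: "'a set \<Rightarrow> bool" where
  "unramified P \<longleftrightarrow> (\<exists>s\<in>R. s \<notin> P \<and> (\<forall>x\<in>P. s * x \<in> pR))"

text \<open>The ideal below plays the role of \<open>P\<^sup>2\<close> localized at \<open>P\<close>.\<close>

lemma ramified_square:
  assumes P: "P \<in> primes" and ram: "\<not> unramified P"
  shows "\<exists>Q \<pi>. is_ideal Q \<and> pR \<subseteq> Q \<and> \<pi> \<in> P \<and> (\<forall>x\<in>P. \<forall>y\<in>P. x * y \<in> Q) \<and>
    (\<forall>r\<in>R. r \<notin> P \<longrightarrow> r * \<pi> \<notin> Q)"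
proof -
  note iP = prime_ideal[OF P]
  have PR: "x \<in> R" if "x \<in> P" for x by (rule ideal_subset[OF iP that])
  obtain \<tau> \<pi> where tau: "\<forall>y\<in>P. \<tau> * y \<in> R" "\<pi> \<in> P" "\<tau> * \<pi> \<notin> P"
    using locally_invertible[OF P] by (elim exE conjE bexE)
  define s where "s = \<tau> * \<pi>"
  have s: "s \<in> R" "s \<notin> P" using tau by (simp_all add: s_def)
  \<comment> \<open>Up to the local unit s, every element x of P is a multiple of
    \<open>\<pi>\<close>, with factor \<open>\<tau> * x\<close>.\<close>
  have unif: "\<exists>u\<in>R. s * x = \<pi> * u" if "x \<in> P" for x
    by (rule bexI[of _ "\<tau> * x"]) (use tau(1) that in \<open>simp_all add: s_def\<close>)
  obtain u where u: "u \<in> R" "s * of_nat p = \<pi> * u" using unif[OF p_in_prime[OF P]] by (elim bexE)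
  have "s \<noteq> 0" using s(2) ideal_zero[OF iP] by auto
  then have pi0: "\<pi> \<noteq> 0" using u(2) by auto
  \<comment> \<open>If u were a unit at P, p would be a uniformizer just as \<open>\<pi>\<close> is,
    and \<open>s * u\<close> would witness that P is unramified.\<close>
  have uP: "u \<in> P"
  proof (rule ccontr)
    assume nu: "u \<notin> P"
    have "s * u \<in> R" "s * u \<notin> P" using s u(1) nu prime_mult[OF P s(1) u(1)] by auto
    moreover have "(s * u) * x \<in> pR" if x: "x \<in> P" for x
    proof -
      obtain v where v: "v \<in> R" "s * x = \<pi> * v" using unif[OF x] by (elim bexE)
      have "(s * u) * x = of_nat p * (s * v)" using v(2) u(2) by (metis mult.assoc mult.commute)
      with pR_I[OF mult_mem[OF s(1) v(1)]] show ?thesis by (simp only:)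
    qed
    ultimately show False using ram unfolding unramified_def by blast
  qed
  define Q where "Q = {y \<in> R. \<exists>t\<in>R. t \<notin> P \<and> (\<exists>z\<in>P. t * y = \<pi> * z)}"
  have QI: "y \<in> Q" if "y \<in> R" "t \<in> R" "t \<notin> P" "z \<in> P" "t * y = \<pi> * z" for y t z
    unfolding Q_def using that by blast
  have QR: "y \<in> R" if "y \<in> Q" for y using that by (simp add: Q_def)
  have QE: "\<exists>t z. t \<in> R \<and> t \<notin> P \<and> z \<in> P \<and> t * y = \<pi> * z" if "y \<in> Q" for y
  proof -
    have "\<exists>t\<in>R. t \<notin> P \<and> (\<exists>z\<in>P. t * y = \<pi> * z)" using that by (simp add: Q_def)
    then show ?thesis by (elim bexE conjE) (intro exI conjI)
  qed
  have "is_ideal Q"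
    unfolding is_ideal_def
  proof (intro conjI ballI)
    show "Q \<subseteq> R" by (auto simp: Q_def)
    show "0 \<in> Q" by (rule QI[OF zero_mem one_mem one_notin_prime[OF P] ideal_zero[OF iP]]) simp
    fix x y assume Q: "x \<in> Q" "y \<in> Q"
    obtain t1 z1 where t1: "t1 \<in> R" "t1 \<notin> P" "z1 \<in> P" "t1 * x = \<pi> * z1" using QE[OF Q(1)] by (elim exE conjE)
    obtain t2 z2 where t2: "t2 \<in> R" "t2 \<notin> P" "z2 \<in> P" "t2 * y = \<pi> * z2" using QE[OF Q(2)] by (elim exE conjE)
    show "x + y \<in> Q"
    proof (rule QI)
      show "t1 * t2 \<notin> P" using prime_mult[OF P t1(1) t2(1)] t1(2) t2(2) by auto
      show "t2 * z1 + t1 * z2 \<in> P" by (rule ideal_add[OF iP ideal_mult[OF iP t2(1) t1(3)] ideal_mult[OF iP t1(1) t2(3)]])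
      have "(t1 * t2) * (x + y) = t2 * (t1 * x) + t1 * (t2 * y)" by (simp add: algebra_simps)
      then show "(t1 * t2) * (x + y) = \<pi> * (t2 * z1 + t1 * z2)" unfolding t1(4) t2(4) by (simp add: algebra_simps)
      show "x + y \<in> R" by (rule add_mem[OF QR[OF Q(1)] QR[OF Q(2)]])
      show "t1 * t2 \<in> R" by (rule mult_mem[OF t1(1) t2(1)])
    qed
  next
    fix r x assume r: "r \<in> R" and Q: "x \<in> Q"
    obtain t z where t: "t \<in> R" "t \<notin> P" "z \<in> P" "t * x = \<pi> * z" using QE[OF Q] by (elim exE conjE)
    show "r * x \<in> Q"
    proof (rule QI[OF mult_mem[OF r QR[OF Q]] t(1,2) ideal_mult[OF iP r t(3)]])
      show "t * (r * x) = \<pi> * (r * z)" using t(4) by (simp add: mult.left_commute)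
    qed
  qed
  moreover have "of_nat p \<in> Q" by (rule QI[OF of_nat_mem s uP u(2)])
  then have "pR \<subseteq> Q" by (rule pR_subset[OF \<open>is_ideal Q\<close>])
  moreover have "x * y \<in> Q" if xy: "x \<in> P" "y \<in> P" for x y
  proof -
    obtain v where v: "v \<in> R" "s * x = \<pi> * v" using unif[OF xy(1)] by (elim bexE)
    show ?thesis
    proof (rule QI[OF mult_mem[OF PR PR] s ideal_mult[OF iP v(1) xy(2)]])
      show "s * (x * y) = \<pi> * (v * y)" using v(2) by (metis mult.assoc)
    qed (rule xy)+
  qed
  moreover have "r * \<pi> \<notin> Q" if r: "r \<in> R" "r \<notin> P" for r
  proof
    assume Q: "r * \<pi> \<in> Q"
    obtain t z where t: "t \<in> R" "t \<notin> P" "z \<in> P" "t * (r * \<pi>) = \<pi> * z" using QE[OF Q] by (elim exE conjE)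
    then have "\<pi> * (t * r) = \<pi> * z" by (simp add: algebra_simps)
    then have "t * r = z" using pi0 by simp
    then show False using prime_mult[OF P t(1) r(1)] t r by simp
  qed
  ultimately show ?thesis using tau(2) by (intro exI[of _ Q] exI[of _ \<pi>]) simp
qed

text \<open>The extra unit for a ramified P is a uniformizer: it is nonzero modulo the local square
  of P, while p already lies in that square.\<close>

lemma card_primes_ramified:
  "card primes + card {P \<in> primes. \<not> unramified P} \<le> n"
proof -
  obtain e where e0: "\<forall>P\<in>primes. e P \<in> R \<and> e P - 1 \<in> P \<and> (\<forall>Q\<in>primes - {P}. e P \<in> Q)"
    using idempotent_family by (elim exE)
  have e: "e P \<in> R" "e P - 1 \<in> P" if "P \<in> primes" for P using e0 that by simp_all
  have eQ: "e P \<in> Q" if "P \<in> primes" "Q \<in> primes" "Q \<noteq> P" for P Q using e0 that by simp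
  have e1: "e P \<notin> P" if P: "P \<in> primes" for P
    using ideal_diff[OF prime_ideal[OF P] _ e(2)[OF P], of "e P"] one_notin_prime[OF P] by auto
  let ?T = "{P \<in> primes. \<not> unramified P}"
  have "\<forall>P\<in>?T. \<exists>q. is_ideal (fst q) \<and> pR \<subseteq> fst q \<and> snd q \<in> P \<and> (\<forall>x\<in>P. \<forall>y\<in>P. x * y \<in> fst q) \<and>
    (\<forall>r\<in>R. r \<notin> P \<longrightarrow> r * snd q \<notin> fst q)"
    using ramified_square by auto
  then obtain q where q: "\<forall>P\<in>?T. is_ideal (fst (q P)) \<and> pR \<subseteq> fst (q P) \<and> snd (q P) \<in> P \<and>
    (\<forall>x\<in>P. \<forall>y\<in>P. x * y \<in> fst (q P)) \<and> (\<forall>r\<in>R. r \<notin> P \<longrightarrow> r * snd (q P) \<notin> fst (q P))"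
    by (rule bchoice[THEN exE])
  define S \<pi> where "S P = fst (q P)" and "\<pi> P = snd (q P)" for P
  have S: "is_ideal (S P)" "pR \<subseteq> S P" "\<pi> P \<in> P" "\<And>x y. x \<in> P \<Longrightarrow> y \<in> P \<Longrightarrow> x * y \<in> S P"
    "\<And>r. r \<in> R \<Longrightarrow> r \<notin> P \<Longrightarrow> r * \<pi> P \<notin> S P" if "P \<in> ?T" for P
    using bspec[OF q that] by (simp_all add: S_def \<pi>_def)
  have piR: "\<pi> P \<in> R" if "P \<in> ?T" for P using S(3)[OF that] that by (intro ideal_subset[OF prime_ideal]) auto
  show ?thesis
  \<comment> \<open>The weight is squared because \<open>e Q\<close> in P only gives
    \<open>(e Q)\<^sup>2\<close> in \<open>S P\<close>; with the square, the term at P alone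
    survives modulo \<open>S P\<close>.\<close>
  proof (rule card_primes_weighted[of ?T e "\<lambda>P. (e P)\<^sup>2 * \<pi> P"])
    show "(e P)\<^sup>2 * \<pi> P \<in> R" if "P \<in> ?T" for P using that e piR by (intro mult_mem power_mem) auto
    show "(e P)\<^sup>2 * \<pi> P \<in> Q" if "P \<in> ?T" "Q \<in> primes" "Q \<noteq> P" for P Q
      unfolding power2_eq_square using that e eQ piR
      by (intro ideal_mult'[OF prime_ideal[OF that(2)]]) auto
    show "int p dvd c" if "P \<in> primes" "P \<notin> ?T" "of_int c * e P \<in> P" for P c
      using of_int_mult_in_prime[OF that(1) e(1) e1 that(3)] that(1) by simp
    show "int p dvd c" if P: "P \<in> ?T" and "of_int c * e P + of_int d * ((e P)\<^sup>2 * \<pi> P) \<in> P" for P c d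
    proof -
      have P': "P \<in> primes" using P by simp
      have "of_int d * ((e P)\<^sup>2 * \<pi> P) \<in> P"
        by (rule ideal_mult[OF prime_ideal[OF P'] of_int_mem ideal_mult[OF prime_ideal[OF P'] power_mem[OF e(1)[OF P']] S(3)[OF P]]])
      then have "of_int c * e P \<in> P" using that(2) ideal_add_iff[OF prime_ideal[OF P']] by simp
      then show ?thesis by (rule of_int_mult_in_prime[OF P' e(1)[OF P'] e1[OF P']])
    qed
    show "int p dvd c P" if c: "(\<Sum>P\<in>?T. of_int (c P) * ((e P)\<^sup>2 * \<pi> P)) \<in> pR" and P: "P \<in> ?T" for c P
    proof (rule ccontr)
      assume nd: "\<not> int p dvd c P"
      have P': "P \<in> primes" using P by simp
      note iS = S(1)[OF P]
      have "(\<Sum>P\<in>?T. of_int (c P) * ((e P)\<^sup>2 * \<pi> P)) =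
        of_int (c P) * ((e P)\<^sup>2 * \<pi> P) + (\<Sum>Q\<in>?T - {P}. of_int (c Q) * ((e Q)\<^sup>2 * \<pi> Q))"
        using P finite_primes by (subst sum.remove[of ?T P]) simp_all
      moreover have "(\<Sum>Q\<in>?T - {P}. of_int (c Q) * ((e Q)\<^sup>2 * \<pi> Q)) \<in> S P"
      proof (rule ideal_sum[OF iS])
        fix Q assume Q: "Q \<in> ?T - {P}"
        have "e Q \<in> P" by (rule eQ) (use Q P in auto)
        then have "(e Q)\<^sup>2 \<in> S P" using S(4)[OF P] by (simp add: power2_eq_square)
        moreover have "\<pi> Q \<in> R" using piR Q by blast
        ultimately show "of_int (c Q) * ((e Q)\<^sup>2 * \<pi> Q) \<in> S P"
          by (intro ideal_mult[OF iS of_int_mem] ideal_mult'[OF iS])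
      qed
      moreover have "(\<Sum>P\<in>?T. of_int (c P) * ((e P)\<^sup>2 * \<pi> P)) \<in> S P"
        by (rule subsetD[OF S(2)[OF P] c])
      ultimately have "of_int (c P) * ((e P)\<^sup>2 * \<pi> P) \<in> S P" using ideal_add_iff[OF iS] by simp
      then have "(of_int (c P) * (e P)\<^sup>2) * \<pi> P \<in> S P" by (simp add: mult.assoc)
      moreover have "of_int (c P) * (e P)\<^sup>2 \<notin> P"
      proof
        assume "of_int (c P) * (e P)\<^sup>2 \<in> P"
        then have "of_int (c P) \<in> P \<or> (e P)\<^sup>2 \<in> P" by (rule prime_mult[OF P' of_int_mem power_mem[OF e(1)[OF P']]])
        then show False using prime_power[OF P' e(1)[OF P']] e1[OF P'] of_int_in_prime[OF P'] nd by blast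
      qed
      ultimately show False using S(5)[OF P mult_mem[OF of_int_mem power_mem[OF e(1)[OF P']]]] by simp
    qed
  qed (use e eQ in auto)
qed

section \<open>Integer approximation at an unramified prime of degree one\<close>

text \<open>This is p^k times the localization at P, intersected with R: congruence modulo it is
  p-adic agreement at P to precision k.\<close>

definition local_power :: "'a set \<Rightarrow> nat \<Rightarrow> 'a set" where
  "local_power P k = {z \<in> R. \<exists>s y. s \<in> R \<and> s \<notin> P \<and> y \<in> R \<and> s * z = of_nat p ^ k * y}"

lemma local_powerI:
  "z \<in> R \<Longrightarrow> s \<in> R \<Longrightarrow> s \<notin> P \<Longrightarrow> y \<in> R \<Longrightarrow> s * z = of_nat p ^ k * y \<Longrightarrow> z \<in> local_power P k"
  unfolding local_power_def by blast

lemma local_powerE: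
  assumes "z \<in> local_power P k"
  obtains s y where "z \<in> R" "s \<in> R" "s \<notin> P" "y \<in> R" "s * z = of_nat p ^ k * y"
  using assms unfolding local_power_def by blast

lemma is_ideal_local_power:
  assumes P: "P \<in> primes"
  shows "is_ideal (local_power P k)"
  unfolding is_ideal_def
proof (intro conjI ballI)
  show "local_power P k \<subseteq> R" by (auto elim: local_powerE)
  show "0 \<in> local_power P k"
    by (rule local_powerI[OF zero_mem one_mem one_notin_prime[OF P] zero_mem]) simp
next
  fix x y assume "x \<in> local_power P k" "y \<in> local_power P k"
  then obtain s1 z1 s2 z2 where x: "x \<in> R" "s1 \<in> R" "s1 \<notin> P" "z1 \<in> R" "s1 * x = of_nat p ^ k * z1"
    and y: "y \<in> R" "s2 \<in> R" "s2 \<notin> P" "z2 \<in> R" "s2 * y = of_nat p ^ k * z2"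
    by (elim local_powerE)
  show "x + y \<in> local_power P k"
  proof (rule local_powerI)
    show "s1 * s2 \<notin> P" using prime_mult[OF P x(2) y(2)] x(3) y(3) by auto
    have "(s1 * s2) * (x + y) = s2 * (s1 * x) + s1 * (s2 * y)" by (simp add: algebra_simps)
    then show "(s1 * s2) * (x + y) = of_nat p ^ k * (s2 * z1 + s1 * z2)"
      unfolding x(5) y(5) by (simp add: algebra_simps)
    show "s2 * z1 + s1 * z2 \<in> R" by (rule add_mem[OF mult_mem[OF y(2) x(4)] mult_mem[OF x(2) y(4)]])
  qed (rule add_mem[OF x(1) y(1)] mult_mem[OF x(2) y(2)])+
next
  fix r x assume r: "r \<in> R" and "x \<in> local_power P k"
  then obtain s z where x: "x \<in> R" "s \<in> R" "s \<notin> P" "z \<in> R" "s * x = of_nat p ^ k * z"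
    by (elim local_powerE)
  show "r * x \<in> local_power P k"
    by (rule local_powerI[OF mult_mem[OF r x(1)] x(2,3) mult_mem[OF r x(4)]])
      (simp add: x(5) mult.left_commute)
qed

lemma local_power_mono:
  assumes "z \<in> local_power P k" "j \<le> k"
  shows "z \<in> local_power P j"
proof -
  obtain s y where z: "z \<in> R" "s \<in> R" "s \<notin> P" "y \<in> R" "s * z = of_nat p ^ k * y"
    using assms(1) by (elim local_powerE)
  have "s * z = of_nat p ^ j * (of_nat p ^ (k - j) * y)"
    using z(5) assms(2) by (simp add: mult.assoc[symmetric] flip: power_add)
  then show ?thesis by (rule local_powerI[OF z(1-3) mult_mem[OF power_mem[OF of_nat_mem] z(4)]])
qed

lemma local_power_cancel:
  assumes P: "P \<in> primes" and u: "u \<in> R" "u \<notin> P" and z: "z \<in> R" "u * z \<in> local_power P k"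
  shows "z \<in> local_power P k"
proof -
  obtain s y where s: "s \<in> R" "s \<notin> P" "y \<in> R" "s * (u * z) = of_nat p ^ k * y"
    using z(2) by (elim local_powerE)
  have "s * u \<notin> P" using prime_mult[OF P s(1) u(1)] s(2) u(2) by auto
  then show ?thesis using local_powerI[OF z(1) mult_mem[OF s(1) u(1)] _ s(3)] s(4) by (simp add: mult.assoc)
qed

text \<open>Cancel the exact power of p in c. If its exponent were below k, a product of s with an
  integer prime to p would lie in P.\<close>

lemma of_int_in_local_power:
  assumes P: "P \<in> primes"
  shows "of_int c \<in> local_power P k \<longleftrightarrow> int p ^ k dvd c"
proof
  assume "int p ^ k dvd c"
  then obtain d where "c = int p ^ k * d" by (elim dvdE)
  then show "of_int c \<in> local_power P k"
    using local_powerI[OF of_int_mem one_mem one_notin_prime[OF P] of_int_mem, of c k d] by simp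
next
  assume "of_int c \<in> local_power P k"
  then obtain s y where s: "s \<in> R" "s \<notin> P" "y \<in> R" "s * of_int c = of_nat p ^ k * y"
    by (elim local_powerE)
  show "int p ^ k dvd c"
  proof (rule ccontr)
    assume nd: "\<not> int p ^ k dvd c"
    then have c: "c \<noteq> 0" by auto
    define j where "j = multiplicity (int p) c"
    have "\<not> is_unit (int p)" using p_gt_1 by auto
    then obtain d where d: "c = int p ^ j * d" "\<not> int p dvd d"
      unfolding j_def using multiplicity_decompose'[OF c] by metis
    have j: "j < k" using nd d(1) by (metis dvd_mult2 le_imp_power_dvd not_le)
    have "of_nat p ^ j * (s * of_int d) = of_nat p ^ j * (of_nat p ^ (k - j) * y)"
      using s(4) j unfolding d(1) by (simp add: algebra_simps flip: power_add)
    then have "s * of_int d = of_nat p ^ (k - j) * y" by simp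
    also have "of_nat p ^ (k - j) = of_nat p * (of_nat p ^ (k - j - 1) :: 'a)"
      using j by (cases "k - j") simp_all
    finally have e: "s * of_int d = of_nat p * of_nat p ^ (k - j - 1) * y" .
    have "of_nat p * of_nat p ^ (k - j - 1) * y \<in> P"
      by (rule ideal_mult'[OF prime_ideal[OF P] s(3) ideal_mult'[OF prime_ideal[OF P] power_mem[OF of_nat_mem] p_in_prime[OF P]]])
    then have "s * of_int d \<in> P" unfolding e .
    then have "of_int d \<in> P" using prime_mult[OF P s(1) of_int_mem] s(2) by simp
    then show False using d(2) of_int_in_prime[OF P] by simp
  qed
qed

lemma power_in_local_power:
  assumes P: "P \<in> primes" "unramified P" and x: "x \<in> P"
  shows "x ^ k \<in> local_power P k"
proof -
  obtain s where s: "s \<in> R" "s \<notin> P" "\<forall>x\<in>P. s * x \<in> pR" using P(2) unfolding unramified_def by (elim bexE conjE)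
  have xR: "x \<in> R" by (rule ideal_subset[OF prime_ideal[OF P(1)] x])
  obtain y where y: "y \<in> R" "s * x = of_nat p * y" using bspec[OF s(3) x] by (auto simp: pR_def)
  have "s ^ k * x ^ k = of_nat p ^ k * y ^ k" using y(2) by (simp flip: power_mult_distrib)
  moreover have "s ^ k \<notin> P" using prime_power[OF P(1) s(1)] s(2) by auto
  ultimately show ?thesis using local_powerI[OF power_mem[OF xR] power_mem[OF s(1)] _ power_mem[OF y(1)]] by simp
qed

text \<open>The p-adic expansion of x at P, one digit at a time: p is a uniformizer and the integers
  represent the residue field.\<close>

lemma integer_approximation:
  assumes P: "P \<in> primes" "unramified P" "degree_one P" and x: "x \<in> R"
  shows "\<exists>m :: int. x - of_int m \<in> local_power P k"
proof (induction k)
  case 0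
  have "x - of_int 0 \<in> local_power P 0"
    by (rule local_powerI[OF _ one_mem one_notin_prime[OF P(1)], of _ x]) (use x in simp_all)
  then show ?case ..
next
  case (Suc k)
  then obtain m where m: "x - of_int m \<in> local_power P k" by (elim exE)
  note iP = prime_ideal[OF P(1)]
  obtain s y where s: "s \<in> R" "s \<notin> P" "y \<in> R" "s * (x - of_int m) = of_nat p ^ k * y"
    using m by (elim local_powerE)
  obtain v where v: "v \<in> R" "s * v - 1 \<in> P" using prime_inverse[OF P(1) s(1,2)] by (elim bexE)
  \<comment> \<open>The next digit is y / s modulo P, where v is the inverse of s.\<close>
  obtain d :: int where d: "y * v - of_int d \<in> P"
    using bspec[OF P(3)[unfolded degree_one_def] mult_mem[OF s(3) v(1)]] by (elim exE)
  have "- (y * (s * v - 1)) + s * (y * v - of_int d) \<in> P"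
    by (rule ideal_add[OF iP ideal_uminus[OF iP ideal_mult[OF iP s(3) v(2)]] ideal_mult[OF iP s(1) d]])
  then have ysd: "y - s * of_int d \<in> P" by (simp add: algebra_simps)
  obtain t where t: "t \<in> R" "t \<notin> P" "\<forall>x\<in>P. t * x \<in> pR" using P(2) unfolding unramified_def by (elim bexE conjE)
  obtain w where w: "w \<in> R" "t * (y - s * of_int d) = of_nat p * w" using bspec[OF t(3) ysd] by (auto simp: pR_def)
  have "x - of_int (m + int p ^ k * d) \<in> local_power P (Suc k)"
  proof (rule local_powerI)
    show "t * s \<notin> P" using prime_mult[OF P(1) t(1) s(1)] t(2) s(2) by auto
    have "(t * s) * (x - of_int (m + int p ^ k * d)) = t * (s * (x - of_int m)) - t * s * of_nat p ^ k * of_int d"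
      by (simp add: algebra_simps)
    also have "\<dots> = of_nat p ^ k * (t * (y - s * of_int d))" unfolding s(4) by (simp add: algebra_simps)
    also have "\<dots> = of_nat p ^ Suc k * w" unfolding w(2) by simp
    finally show "(t * s) * (x - of_int (m + int p ^ k * d)) = of_nat p ^ Suc k * w" .
  qed (rule diff_mem[OF x of_int_mem] mult_mem[OF t(1) s(1)] w(1))+
  then show ?case ..
qed

text \<open>Unramified primes of degree one are places with completion \<open>\<int>\<^sub>p\<close>, where the trinomial
  has a root; at most one prime of degree one could be ramified if there were six of them.\<close>

lemma card_degree_one_le_5:
  fixes a b d :: int
  assumes p: "p = 5" and n: "n = 7"
    and \<theta>: "\<theta> \<in> R" "\<theta> ^ 7 + of_int a * \<theta> + of_int b = 0"
    and d: "d \<noteq> 0" "\<And>x. x \<in> R \<Longrightarrow> \<exists>h. of_int d * x = ev h \<theta>"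
  shows "card {P \<in> primes. degree_one P} \<le> 5"
proof (rule ccontr)
  let ?S = "{P \<in> primes. degree_one P}" and ?U = "{P \<in> primes. \<not> unramified P}"
  assume "\<not> card ?S \<le> 5"
  moreover have fin: "finite ?S" "finite ?U" using finite_primes by simp_all
  moreover have "card ?S \<le> card primes" by (rule card_mono[OF finite_primes]) auto
  ultimately have "card ?U \<le> 1" "card ?S \<ge> 6" using card_primes_ramified n by linarith+
  moreover have "card ?S \<le> card (?S - ?U) + card ?U"
    by (rule order_trans[OF card_mono card_Un_le]) (use fin in auto)
  ultimately have "card {..<5::nat} \<le> card (?S - ?U)" by simp
  then obtain P where P0: "P ` {..<5::nat} \<subseteq> ?S - ?U" "inj_on P {..<5::nat}"
    using card_le_inj[of "{..<5::nat}" "?S - ?U"] fin by auto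
  have P: "P i \<in> primes" "unramified (P i)" "degree_one (P i)" if "i < 5" for i
    using P0(1) that by (auto simp: image_subset_iff)
  \<comment> \<open>The denominator d limits how close two of the approximate roots can be: they
    will be shown to differ modulo 5^m. This m fixes the precision \<open>9 * m\<close>.\<close>
  obtain m where m: "\<not> (5::int) ^ m dvd d"
  proof
    have "\<bar>d\<bar> < (5::int) ^ nat \<bar>d\<bar>"
      using of_nat_less_two_power[of "nat \<bar>d\<bar>", where 'a = int] power_mono[of "2::int" 5 "nat \<bar>d\<bar>"] by simp
    then show "\<not> (5::int) ^ nat \<bar>d\<bar> dvd d" using d(1) by (metis zdvd_not_zless abs_dvd_iff dvd_abs_iff zero_less_abs_iff)
  qed
  have "\<forall>i\<in>{..<5}. \<exists>t :: int. \<theta> - of_int t \<in> local_power (P i) (9 * m)"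
    using integer_approximation[OF P \<theta>(1)] by simp
  then obtain t where t: "\<forall>i\<in>{..<5}. \<theta> - of_int (t i) \<in> local_power (P i) (9 * m)"
    by (rule bchoice[THEN exE])
  have cong: "ev h \<theta> - of_int (poly h (t i)) \<in> local_power (P i) (9 * m)" if "i < 5" for h i
    using ev_cong[OF is_ideal_local_power[OF P(1)[OF that]] \<theta>(1) of_int_mem, of "t i" _ h] t that by (simp add: ev_of_int)
  show False
  proof (rule no_five_distinct_approximate_roots)
    fix i :: nat assume i: "i < 5"
    let ?f = "monom 1 7 + monom a 1 + [:b:]"
    have "ev ?f \<theta> = 0" using \<theta>(2) by simp
    then have "- of_int (poly ?f (t i)) \<in> local_power (P i) (9 * m)" using cong[OF i, of ?f] by (simp del: ev_add)
    then have "of_int (- poly ?f (t i)) \<in> local_power (P i) (9 * m)" by (simp only: of_int_minus)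
    then have "int p ^ (9 * m) dvd - poly ?f (t i)" using of_int_in_local_power[OF P(1)[OF i]] by blast
    then have "int p ^ (9 * m) dvd poly ?f (t i)" by (simp only: dvd_minus_iff)
    then show "5 ^ (9 * m) dvd t i ^ 7 + a * t i + b" by (simp add: p poly_monom add_ac)
  next
    \<comment> \<open>An element y of \<open>P i\<close> outside \<open>P j\<close> tells the roots
      apart. Writing \<open>d * y ^ m\<close> as h at \<open>\<theta>\<close>, 5^m divides h(t_i);
      if t_i and t_j agreed modulo 5^m, it would divide h(t_j) as well, and cancelling
      \<open>y ^ m\<close> at \<open>P j\<close> would make 5^m divide d.\<close>
    fix i j :: nat assume ij: "i < 5" "j < 5" "i \<noteq> j"
    have "P i \<noteq> P j" using P0(2) ij by (auto dest: inj_onD)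
    then obtain y where y: "y \<in> R" "y \<notin> P j" "y \<in> P i"
      using separating_element[OF P(1)[OF ij(2)]] P(1)[OF ij(1)] by blast
    obtain h where h: "of_int d * y ^ m = ev h \<theta>" using d(2)[OF power_mem[OF y(1)], of m] by (elim exE)
    have mm: "m \<le> 9 * m" by simp
    note cong' = local_power_mono[OF cong mm]
    note ideal = is_ideal_local_power[OF P(1)]
    have "ev h \<theta> \<in> local_power (P i) m" unfolding h[symmetric]
      by (rule ideal_mult[OF ideal[OF ij(1)] of_int_mem power_in_local_power[OF P(1,2) y(3)]]) (rule ij(1))+
    then have "ev h \<theta> - (ev h \<theta> - of_int (poly h (t i))) \<in> local_power (P i) m"
      by (rule ideal_diff[OF ideal[OF ij(1)] _ cong'[OF ij(1)]])
    then have 1: "5 ^ m dvd poly h (t i)" using of_int_in_local_power[OF P(1)[OF ij(1)]] p by simp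
    show "\<not> 5 ^ m dvd t i - t j"
    proof
      assume "5 ^ m dvd t i - t j"
      then have "5 ^ m dvd poly h (t i) - poly h (t j)" using diff_dvd_poly_diff by (rule dvd_trans)
      from dvd_diff[OF 1 this] have "5 ^ m dvd poly h (t j)" by simp
      then have "of_int (poly h (t j)) \<in> local_power (P j) m" using of_int_in_local_power[OF P(1)[OF ij(2)]] p by simp
      then have "(ev h \<theta> - of_int (poly h (t j))) + of_int (poly h (t j)) \<in> local_power (P j) m"
        by (rule ideal_add[OF ideal[OF ij(2)] cong'[OF ij(2)]])
      then have "y ^ m * of_int d \<in> local_power (P j) m" using h by (simp add: mult.commute)
      moreover have "y ^ m \<notin> P j" using prime_power[OF P(1)[OF ij(2)] y(1)] y(2) by auto
      ultimately have "of_int d \<in> local_power (P j) m"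
        using local_power_cancel[OF P(1)[OF ij(2)] power_mem[OF y(1)] _ of_int_mem] by simp
      then show False using m of_int_in_local_power[OF P(1)[OF ij(2)]] p by simp
    qed
  qed
qed

theorem monogenic_mod_p_trinomial:
  fixes a b d :: int
  assumes p: "p \<ge> 5" and n: "n = 7"
    and \<theta>: "\<theta> \<in> R" "\<theta> ^ 7 + of_int a * \<theta> + of_int b = 0"
    and d: "d \<noteq> 0" "\<And>x. x \<in> R \<Longrightarrow> \<exists>h. of_int d * x = ev h \<theta>"
  shows "\<exists>x\<in>R. \<forall>y\<in>R. \<exists>h. y - ev h x \<in> pR"
proof (rule monogenic_mod_p)
  let ?A = "{P \<in> primes. degree_one P}" and ?B = "{P \<in> primes. \<not> degree_one P}"
  have "card primes = card ?A + card ?B"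
    using finite_primes by (subst card_Un_disjoint[symmetric]) (auto intro: arg_cong[where f = card])
  then have *: "card ?A + 2 * card ?B \<le> 7" using card_primes_degree n by simp
  show "card ?A \<le> p"
  proof (cases "p = 5")
    case True
    then show ?thesis using card_degree_one_le_5[OF True n \<theta> d] by simp
  next
    case False
    have "p \<noteq> 6"
    proof
      assume "p = 6"
      have "\<forall>m. m dvd p \<longrightarrow> m = 1 \<or> m = p" using prime_p prime_nat_iff by blast
      from spec[OF this, of 2] show False using \<open>p = 6\<close> by simp
    qed
    then show ?thesis using * p False by simp
  qed
  \<comment> \<open>At most three primes have larger residue fields, and 7 * 3 = 21 is below 5 * 4 +
    7.\<close>
  have "5 * 4 \<le> p * (p - 1)" using p by (intro mult_le_mono) auto
  moreover have "n * card ?B \<le> 21" using * n by simp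
  ultimately show "n * card ?B < p * (p - 1) + n" using n by linarith
qed

end

section \<open>Algebraic integers\<close>

definition int_span :: "('i \<Rightarrow> 'a::field_char_0) \<Rightarrow> 'i set \<Rightarrow> 'a set" where
  "int_span v I = {\<Sum>i\<in>I. of_int (c i) * v i | c. True}"

lemma int_span_I: "x = (\<Sum>i\<in>I. of_int (c i) * v i) \<Longrightarrow> x \<in> int_span v I"
  by (auto simp: int_span_def)

lemma int_span_generator: "finite I \<Longrightarrow> i \<in> I \<Longrightarrow> v i \<in> int_span v I"
  by (rule int_span_I[of _ "\<lambda>j. if j = i then 1 else 0"]) (simp add: if_distrib[of of_int] if_distrib[of "\<lambda>x. x * _"] cong: if_cong)

lemma int_span_0: "0 \<in> int_span v I"
  by (rule int_span_I[of _ "\<lambda>_. 0"]) simp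

lemma int_span_add:
  assumes "x \<in> int_span v I" "y \<in> int_span v I" shows "x + y \<in> int_span v I"
proof -
  obtain c d where "x = (\<Sum>i\<in>I. of_int (c i) * v i)" "y = (\<Sum>i\<in>I. of_int (d i) * v i)"
    using assms by (auto simp: int_span_def)
  then show ?thesis
    by (intro int_span_I[of _ "\<lambda>i. c i + d i"]) (simp add: sum.distrib distrib_right)
qed

lemma int_span_scale:
  assumes "x \<in> int_span v I" shows "of_int k * x \<in> int_span v I"
proof -
  obtain c where "x = (\<Sum>i\<in>I. of_int (c i) * v i)" using assms by (auto simp: int_span_def)
  then show ?thesis
    by (intro int_span_I[of _ "\<lambda>i. k * c i"]) (simp add: sum_distrib_left mult.assoc)
qed

lemma int_span_sum: "(\<And>j. j \<in> A \<Longrightarrow> g j \<in> int_span v I) \<Longrightarrow> sum g A \<in> int_span v I"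
  by (induction A rule: infinite_finite_induct) (auto simp: int_span_0 int_span_add)

lemma int_span_stable:
  assumes "\<And>i. i \<in> I \<Longrightarrow> x * v i \<in> int_span v I" "y \<in> int_span v I"
  shows "x * y \<in> int_span v I"
proof -
  obtain c where "y = (\<Sum>i\<in>I. of_int (c i) * v i)" using assms(2) by (auto simp: int_span_def)
  then have "x * y = (\<Sum>i\<in>I. of_int (c i) * (x * v i))" by (simp add: sum_distrib_left mult.left_commute)
  then show ?thesis using assms(1) by (simp add: int_span_sum int_span_scale)
qed

text \<open>The determinant trick: \<open>x\<close> is an eigenvalue of an integer matrix.\<close>

lemma algebraic_int_if_stable:
  fixes x :: "'a::field_char_0"
  assumes fin: "finite I" and stable: "\<And>i. i \<in> I \<Longrightarrow> x * v i \<in> int_span v I" and nz: "i0 \<in> I" "v i0 \<noteq> 0"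
  shows "algebraic_int x"
proof -
  define n where "n = card I"
  obtain g where g: "bij_betw g {0..<n} I" using ex_bij_betw_nat_finite[OF fin] unfolding n_def by blast
  have "\<forall>i\<in>I. \<exists>c. x * v i = (\<Sum>j\<in>I. of_int (c j) * v j)" using stable by (auto simp: int_span_def)
  then obtain A where A: "\<forall>i\<in>I. x * v i = (\<Sum>j\<in>I. of_int (A i j) * v j)" by (rule bchoice[THEN exE])
  define M :: "int mat" where "M = mat n n (\<lambda>(i, j). A (g i) (g j))"
  define M' :: "'a mat" where "M' = map_mat of_int M"
  define w where "w = vec n (\<lambda>i. v (g i))"
  have M': "M' \<in> carrier_mat n n" and M: "M \<in> carrier_mat n n" by (simp_all add: M'_def M_def)
  have "M' *\<^sub>v w = x \<cdot>\<^sub>v w"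
  proof (rule eq_vecI)
    fix i assume "i < dim_vec (x \<cdot>\<^sub>v w)"
    then have i: "i < n" by (simp add: w_def)
    then have gi: "g i \<in> I" using g by (auto simp: bij_betw_def)
    have "vec_index (M' *\<^sub>v w) i = (\<Sum>j = 0..<n. of_int (A (g i) (g j)) * v (g j))"
      using i by (simp add: M'_def M_def w_def scalar_prod_def)
    also have "\<dots> = (\<Sum>j\<in>I. of_int (A (g i) j) * v j)"
      by (rule sum.reindex_bij_betw[OF g])
    also have "\<dots> = x * v (g i)" using A gi by simp
    finally show "vec_index (M' *\<^sub>v w) i = vec_index (x \<cdot>\<^sub>v w) i" using i by (simp add: w_def)
  qed (simp add: w_def M'_def M_def)
  moreover have "w \<noteq> 0\<^sub>v n"
  proof
    assume w0: "w = 0\<^sub>v n"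
    obtain i where i: "i < n" "g i = i0" using g nz(1) by (auto simp: bij_betw_def)
    have "vec_index w i = 0" using w0 i by simp
    then show False using i nz(2) by (simp add: w_def)
  qed
  ultimately have "eigenvector M' w x" by (simp add: eigenvector_def M'_def M_def w_def)
  then have "eigenvalue M' x" unfolding eigenvalue_def by blast
  then have "poly (char_poly M') x = 0" using eigenvalue_root_char_poly[OF M'] by simp
  moreover have "char_poly M' = map_poly of_int (char_poly M)"
    unfolding M'_def by (rule of_int_hom.char_poly_hom[OF M])
  moreover have "lead_coeff (char_poly M) = 1" using degree_monic_char_poly[OF M] by simp
  ultimately show ?thesis unfolding algebraic_int_altdef_ipoly by auto
qed

text \<open>The monic equation rewrites x^n, so the span of the lower powers is stable under x; n >
  0 ensures that it contains 1.\<close>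

lemma algebraic_int_power_span:
  assumes "algebraic_int x"
  shows "\<exists>n>0. \<forall>h. ev h x \<in> int_span (\<lambda>i. x ^ i) {..<n}"
proof -
  obtain q where q: "ev q x = 0" "lead_coeff q = 1"
    using assms unfolding algebraic_int_altdef_ipoly ev_def by blast
  define n where "n = degree q"
  let ?S = "int_span (\<lambda>i. x ^ i) {..<n}"
  have n: "n > 0"
  proof (rule ccontr)
    assume "\<not> n > 0"
    then have "q = [:1:]" using q(2) by (metis degree_eq_zeroE gr0I lead_coeff_pCons(2) n_def)
    then show False using q(1) by simp
  qed
  have "(\<Sum>i\<le>n. monom (coeff q i) i) = q" by (simp add: n_def poly_as_sum_of_monoms)
  then have "ev (\<Sum>i\<le>n. monom (coeff q i) i) x = 0" using q(1) by simp
  then have "0 = (\<Sum>i\<le>n. of_int (coeff q i) * x ^ i)" by simp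
  also have "\<dots> = x ^ n + (\<Sum>i<n. of_int (coeff q i) * x ^ i)"
    using q(2) by (simp add: n_def lessThan_Suc_atMost[symmetric])
  finally have "x ^ n = (\<Sum>i<n. of_int (- coeff q i) * x ^ i)"
    by (simp add: sum_negf eq_neg_iff_add_eq_0)
  then have xn: "x ^ n \<in> ?S" by (rule int_span_I)
  have stable: "x * x ^ i \<in> ?S" if "i \<in> {..<n}" for i
  proof (cases "Suc i = n")
    case True
    then show ?thesis using xn by auto
  next
    case False
    then show ?thesis using int_span_generator[of "{..<n}" "Suc i" "\<lambda>i. x ^ i"] that by simp
  qed
  have "ev h x \<in> ?S" for h
  proof (induction h)
    case (pCons c h)
    have "of_int c * x ^ 0 \<in> ?S"
      by (rule int_span_scale, rule int_span_generator[where v = "\<lambda>i. x ^ i"]) (use n in simp_all)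
    moreover have "x * ev h x \<in> ?S" by (rule int_span_stable[OF stable pCons.IH])
    ultimately show ?case using int_span_add by fastforce
  qed (simp add: int_span_0)
  then show ?thesis using n by (intro exI[of _ n] conjI allI)
qed

lemma int_span_mult:
  assumes x: "x \<in> int_span u I" and y: "y \<in> int_span v J"
  shows "x * y \<in> int_span (\<lambda>(i, j). u i * v j) (I \<times> J)"
proof -
  obtain c d where "x = (\<Sum>i\<in>I. of_int (c i) * u i)" "y = (\<Sum>i\<in>J. of_int (d i) * v i)"
    using assms by (auto simp: int_span_def)
  then have "x * y = (\<Sum>(i, j)\<in>I \<times> J. of_int (c i * d j) * (u i * v j))"
    by (simp add: sum_product sum.cartesian_product mult_ac)
  then show ?thesis by (intro int_span_I[of _ "\<lambda>(i, j). c i * d j"]) (simp add: case_prod_unfold)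
qed

text \<open>The products x^i y^j below the two degrees span a module stable under x and under y,
  hence under their sum and product.\<close>

lemma algebraic_int_add_mult:
  fixes x y :: "'a::field_char_0"
  assumes "algebraic_int x" "algebraic_int y"
  shows "algebraic_int (x + y)" "algebraic_int (x * y)"
proof -
  obtain m where m: "m > 0" "\<forall>h. ev h x \<in> int_span (\<lambda>i. x ^ i) {..<m}"
    using algebraic_int_power_span[OF assms(1)] by blast
  obtain n where n: "n > 0" "\<forall>h. ev h y \<in> int_span (\<lambda>i. y ^ i) {..<n}"
    using algebraic_int_power_span[OF assms(2)] by blast
  let ?v = "\<lambda>(i, j). x ^ i * y ^ j" and ?I = "{..<m} \<times> {..<n}"
  have span: "x ^ i * y ^ j \<in> int_span ?v ?I" for i j
    using int_span_mult[OF spec[OF m(2), of "monom 1 i"] spec[OF n(2), of "monom 1 j"]] by simp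
  have x: "x * ?v k \<in> int_span ?v ?I" for k using span[of "Suc (fst k)" "snd k"] by (simp add: case_prod_unfold mult.assoc)
  have y: "y * ?v k \<in> int_span ?v ?I" for k using span[of "fst k" "Suc (snd k)"] by (simp add: case_prod_unfold mult.left_commute)
  have 0: "(0, 0) \<in> ?I" using m n by simp
  show "algebraic_int (x + y)"
    by (rule algebraic_int_if_stable[of ?I _ ?v, OF _ _ 0]) (use int_span_add[OF x y] in \<open>simp_all add: distrib_right\<close>)
  have xy: "x * y * ?v k \<in> int_span ?v ?I" for k
    using int_span_stable[of ?I x ?v, OF x y[of k]] by (simp add: mult.assoc)
  show "algebraic_int (x * y)"
    by (rule algebraic_int_if_stable[of ?I _ ?v, OF _ xy 0]) simp_all
qed

lemma algebraic_int_sum: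
  fixes g :: "'i \<Rightarrow> 'a::field_char_0"
  shows "(\<And>i. i \<in> A \<Longrightarrow> algebraic_int (g i)) \<Longrightarrow> algebraic_int (sum g A)"
  by (induction A rule: infinite_finite_induct) (auto simp: algebraic_int_add_mult)

lemma algebraic_int_prod:
  fixes g :: "'i \<Rightarrow> 'a::field_char_0"
  shows "(\<And>i. i \<in> A \<Longrightarrow> algebraic_int (g i)) \<Longrightarrow> algebraic_int (prod g A)"
  by (induction A rule: infinite_finite_induct) (auto simp: algebraic_int_add_mult)

lemma algebraic_int_ev: "algebraic_int x \<Longrightarrow> algebraic_int (ev h x)"
  by (induction h) (auto simp: algebraic_int_add_mult)

text \<open>Transitivity of integrality: x is a root of a monic polynomial over Z[y], and the
  products y^i x^j span a finitely generated module stable under x.\<close>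

lemma algebraic_int_trans:
  fixes x y :: "'a::field_char_0"
  assumes y: "algebraic_int y" and x: "x ^ Suc k = (\<Sum>j\<le>k. ev (g j) y * x ^ j)"
  shows "algebraic_int x"
proof -
  obtain n where n: "n > 0" "\<forall>h. ev h y \<in> int_span (\<lambda>i. y ^ i) {..<n}"
    using algebraic_int_power_span[OF y] by blast
  let ?v = "\<lambda>(i, j). y ^ i * x ^ j" and ?I = "{..<n} \<times> {..k}"
  have gen: "ev h y * x ^ j \<in> int_span ?v ?I" if "j \<le> k" for h j
    using int_span_mult[OF spec[OF n(2), of h] int_span_generator[of "{..k}" j "\<lambda>j. x ^ j"]] that by simp
  have stable: "x * ?v l \<in> int_span ?v ?I" if l: "l \<in> ?I" for l
  proof -
    obtain i j where ij: "l = (i, j)" "j \<le> k" using l by auto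
    show ?thesis
    proof (cases "j = k")
      case True
      have "x * ?v l = y ^ i * x ^ Suc k" using ij True by simp
      also have "\<dots> = (\<Sum>j\<le>k. ev (monom 1 i * g j) y * x ^ j)"
        unfolding x by (simp add: sum_distrib_left mult.assoc)
      also have "\<dots> \<in> int_span ?v ?I" by (intro int_span_sum gen) simp
      finally show ?thesis .
    next
      case False
      then show ?thesis using gen[of "Suc j" "monom 1 i"] ij by (simp add: mult.left_commute)
    qed
  qed
  show ?thesis
    by (rule algebraic_int_if_stable[of ?I x ?v "(0, 0)"]) (use stable n in auto)
qed

text \<open>Factors X are stripped from an integral equation, as x is nonzero; the constant term
  that remains is a multiple of x. This turns an algebraic denominator into a rational one.\<close>

lemma algebraic_int_dvd_int:
  fixes x :: "'a::field_char_0"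
  assumes "algebraic_int x" "x \<noteq> 0"
  shows "\<exists>c g. c \<noteq> 0 \<and> of_int c = x * ev g x"
proof -
  obtain q where q: "ev q x = 0" "lead_coeff q = 1"
    using assms(1) unfolding algebraic_int_altdef_ipoly ev_def by blast
  then have "q \<noteq> 0" by auto
  with q(1) show ?thesis
  proof (induction q)
    case (pCons c q)
    show ?case
    proof (cases "c = 0")
      case True
      then show ?thesis using pCons assms(2) by auto
    next
      case False
      have "ev (- q) x = - ev q x" using ev_diff[of 0 q x] by simp
      moreover have "of_int c = - (x * ev q x)" using pCons.prems(1) by (simp add: eq_neg_iff_add_eq_0)
      ultimately have "of_int c = x * ev (- q) x" by simp
      then show ?thesis using False by blast
    qed
  qed simp
qed

section \<open>Rings of integers of simple extensions\<close>

definition evr :: "rat poly \<Rightarrow> 'a::field_char_0 \<Rightarrow> 'a" where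
  "evr h x = poly (map_poly of_rat h) x"

lemma evr_0 [simp]: "evr 0 x = 0"
  and evr_1 [simp]: "evr 1 x = 1"
  and evr_pCons [simp]: "evr (pCons c h) x = of_rat c + x * evr h x"
  and evr_add [simp]: "evr (g + h) x = evr g x + evr h x"
  by (simp_all add: evr_def map_poly_pCons hom_distribs)

lemma evr_smult [simp]: "evr (Polynomial.smult c h) x = of_rat c * evr h x"
  by (induction h) (simp_all add: algebra_simps of_rat_mult)

lemma evr_minus [simp]: "evr (- h) x = - evr h x"
  using evr_smult[of "- 1" h x] by (simp add: of_rat_minus)

lemma evr_mult [simp]: "evr (g * h) x = evr g x * evr h x"
  by (induction g) (simp_all add: algebra_simps)

lemma evr_sum [simp]: "evr (sum g A) x = (\<Sum>i\<in>A. evr (g i) x)"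
  by (induction A rule: infinite_finite_induct) auto

lemma evr_monom [simp]: "evr (monom c k) x = of_rat c * x ^ k"
  by (simp add: evr_def map_poly_monom poly_monom)

lemma evr_of_int_poly: "evr (map_poly of_int h) x = ev h x"
  by (induction h) (simp_all add: map_poly_pCons)

lemma evr_pcompose: "evr (pcompose g h) x = evr g (evr h x)"
  by (induction g) (simp_all add: pcompose_pCons)

lemma subfield_of_rat:
  fixes S :: "'a::field_char_0 set"
  assumes "subfield S"
  shows "of_rat q \<in> S"
proof -
  have nat: "of_nat k \<in> S" for k using assms by (induction k) (auto simp: subfield_def)
  have int: "of_int k \<in> S" for k using assms nat by (cases k) (auto simp: subfield_def simp del: of_nat_Suc)
  obtain a b where "q = of_int a / of_int b" by (metis Fract_of_int_quotient Rat_cases)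
  then have "of_rat q = (of_int a * inverse (of_int b) :: 'a)" by (simp add: of_rat_divide field_simps)
  then show ?thesis using int assms by (simp add: subfield_def)
qed

lemma subfield_evr:
  assumes S: "subfield S" and x: "x \<in> S"
  shows "evr h x \<in> S"
  using S x subfield_of_rat[OF S] by (induction h) (auto simp: subfield_def)

lemma rat_adjoin_subset:
  assumes "subfield S" "x \<in> S"
  shows "rat_adjoin x \<subseteq> S"
  unfolding rat_adjoin_def by (rule hull_minimal) (use assms in auto)

lemma subfield_rat_adjoin: "subfield (rat_adjoin x)"
  unfolding rat_adjoin_def hull_def by (auto simp: subfield_def)

lemma mem_rat_adjoin: "x \<in> rat_adjoin x"
  unfolding rat_adjoin_def hull_def by auto

locale simple_extension =
  fixes f :: "rat poly" and F :: "int poly" and \<theta> :: "'a::field_char_0" and N :: nat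
  assumes f_def: "f = map_poly of_int F"
    and monic: "lead_coeff F = 1" and degree_F: "degree F = N"
    and irred: "irreducible f"
    and root: "ev F \<theta> = 0"
begin

definition K :: "'a set" where "K = range (\<lambda>h. evr h \<theta>)"

definition OK :: "'a set" where "OK = ring_of_integers K"

lemma degree_f: "degree f = N"
  using degree_F by (simp add: f_def degree_map_poly)

lemma N_pos: "N > 0"
proof (rule ccontr)
  assume "\<not> N > 0"
  then have "degree f = 0" using degree_f by simp
  moreover have "f \<noteq> 0" using irred by auto
  ultimately have "is_unit f" by (simp add: is_unit_iff_degree)
  then show False using irred by auto
qed

lemma bezout_f:
  assumes "\<not> f dvd h"
  shows "\<exists>u v. u * f + v * h = 1"
proof -
  have "coprime f h"
  proof (rule coprimeI)
    fix d assume d: "d dvd f" "d dvd h"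
    then obtain k where k: "f = d * k" by auto
    then have "is_unit d \<or> is_unit k" using irred irreducibleD by blast
    then show "is_unit d"
    proof
      assume "is_unit k"
      then have "f dvd d" using k by (simp add: mult_unit_dvd_iff)
      then show ?thesis using d(2) assms dvd_trans by blast
    qed
  qed
  then have "fst (bezout_coefficients f h) * f + snd (bezout_coefficients f h) * h = 1"
    by (simp add: bezout_coefficients_fst_snd)
  then show ?thesis by blast
qed

lemma evr_f: "evr f \<theta> = 0"
  using root by (simp add: f_def evr_of_int_poly)

lemma evr_eq_0_iff: "evr h \<theta> = 0 \<longleftrightarrow> f dvd h"
proof
  assume h: "evr h \<theta> = 0"
  show "f dvd h"
  proof (rule ccontr)
    assume "\<not> f dvd h"
    then obtain u v where "u * f + v * h = 1" using bezout_f by blast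
    then have "evr (u * f + v * h) \<theta> = 1" by simp
    then show False using h evr_f by simp
  qed
qed (auto simp: evr_f)

lemma subfield_K: "subfield K"
proof -
  have "inverse (evr h \<theta>) \<in> K" for h
  proof (cases "evr h \<theta> = 0")
    case True
    then show ?thesis unfolding K_def by (intro image_eqI[of _ _ 0]) auto
  next
    case False
    then obtain u v where "u * f + v * h = 1" using bezout_f evr_eq_0_iff by blast
    then have "evr (u * f + v * h) \<theta> = 1" by simp
    then have "evr v \<theta> * evr h \<theta> = 1" using evr_f by simp
    then have "inverse (evr h \<theta>) = evr v \<theta>" using False by (simp add: field_simps)
    then show ?thesis by (simp add: K_def)
  qed
  then show ?thesis
    unfolding subfield_def K_def by (auto intro: image_eqI[of _ _ 0] image_eqI[of _ _ 1] image_eqI[of _ _ "_ + _"]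
      image_eqI[of _ _ "_ * _"] image_eqI[of _ _ "- _"])
qed

lemma theta_in_K: "\<theta> \<in> K"
  unfolding K_def by (rule image_eqI[of _ _ "monom 1 1"]) simp_all

lemma K_eq: "K = rat_adjoin \<theta>"
proof
  show "rat_adjoin \<theta> \<subseteq> K" by (rule rat_adjoin_subset[OF subfield_K theta_in_K])
  show "K \<subseteq> rat_adjoin \<theta>"
    unfolding K_def using subfield_evr[OF subfield_rat_adjoin mem_rat_adjoin] by auto
qed

lemma K_reduced:
  assumes "x \<in> K"
  shows "\<exists>h. degree h < N \<and> x = evr h \<theta>"
proof -
  obtain h where h: "x = evr h \<theta>" using assms by (auto simp: K_def)
  have f0: "f \<noteq> 0" using irred by auto
  have "evr h \<theta> = evr (f * (h div f) + h mod f) \<theta>" by simp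
  also have "\<dots> = evr (h mod f) \<theta>" by (simp only: evr_add evr_mult evr_f) simp
  finally have "x = evr (h mod f) \<theta>" using h by simp
  moreover have "degree (h mod f) < N"
    using degree_mod_less[OF f0, of h] degree_f N_pos by auto
  ultimately show ?thesis by blast
qed

lemma OK_iff: "x \<in> OK \<longleftrightarrow> x \<in> K \<and> algebraic_int x"
  by (simp add: OK_def ring_of_integers_def)

lemma algebraic_int_theta: "algebraic_int \<theta>"
  using root monic unfolding algebraic_int_altdef_ipoly ev_def by blast

lemma theta_in_OK: "\<theta> \<in> OK"
  using theta_in_K algebraic_int_theta by (simp add: OK_iff)

text \<open>The ambient field of \<open>\<theta>\<close> need not contain the other roots of f, so
  conjugates are taken in the complex numbers. They are distinct because an irreducible f is coprime
  to its derivative.\<close>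

lemma f_roots_complex:
  "\<exists>Z :: complex set. finite Z \<and> card Z = N \<and> (\<forall>z\<in>Z. evr f z = 0 \<and> algebraic_int z)"
proof -
  let ?g = "map_poly of_rat f :: complex poly"
  have deg: "degree ?g = N" using degree_f by (simp add: degree_map_poly)
  have "\<not> f dvd pderiv f"
  proof
    assume "f dvd pderiv f"
    moreover have "pderiv f \<noteq> 0" using N_pos degree_f by (simp add: pderiv_eq_0_iff)
    ultimately have "degree f \<le> degree (pderiv f)" by (rule dvd_imp_degree_le)
    then show False using N_pos degree_f by (simp add: degree_pderiv)
  qed
  then obtain u v where uv: "u * f + v * pderiv f = 1" using bezout_f by blast
  have "rsquarefree ?g"
    unfolding rsquarefree_roots
  proof (intro allI notI)
    fix z assume z: "poly ?g z = 0 \<and> poly (pderiv ?g) z = 0"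
    have "pderiv ?g = map_poly of_rat (pderiv f)" by (simp add: of_rat_hom.map_poly_pderiv)
    then have "evr f z = 0" "evr (pderiv f) z = 0" using z by (simp_all add: evr_def)
    moreover have "evr (u * f + v * pderiv f) z = 1" using uv by simp
    ultimately show False by simp
  qed
  then have "Polynomial.smult (lead_coeff ?g) (\<Prod>z | poly ?g z = 0. [:- z, 1:]) = ?g"
    by (rule complex_poly_decompose_rsquarefree)
  then have "degree (Polynomial.smult (lead_coeff ?g) (\<Prod>z | poly ?g z = 0. [:- z, 1:])) = N"
    using deg by simp
  moreover have g0: "?g \<noteq> 0" using irred by auto
  ultimately have "degree (\<Prod>z | poly ?g z = 0. [:- z, 1:]) = N" by simp
  then have "card {z. poly ?g z = 0} = N" by (simp add: degree_prod_eq_sum_degree)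
  moreover have "algebraic_int z" if "poly ?g z = 0" for z
  proof -
    have "ev F z = 0" using that by (simp add: evr_def[symmetric] f_def evr_of_int_poly)
    then show ?thesis using monic unfolding algebraic_int_altdef_ipoly ev_def by blast
  qed
  moreover have "finite {z. poly ?g z = 0}" using g0 by (rule poly_roots_finite)
  ultimately show ?thesis by (intro exI[of _ "{z. poly ?g z = 0}"]) (simp add: evr_def)
qed

text \<open>If q is an integral equation at \<open>\<theta>\<close>, then f divides q composed with
  h, so the same q works at every conjugate.\<close>

lemma conjugate_algebraic_int:
  assumes x: "algebraic_int (evr h \<theta>)" and z: "evr f z = 0"
  shows "algebraic_int (evr h z)"
proof -
  obtain q where q: "ev q (evr h \<theta>) = 0" "lead_coeff q = 1"
    using x unfolding algebraic_int_altdef_ipoly ev_def by blast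
  then have "evr (pcompose (map_poly of_int q) h) \<theta> = 0" by (simp add: evr_pcompose evr_of_int_poly)
  then have "f dvd pcompose (map_poly of_int q) h" by (simp only: evr_eq_0_iff)
  then obtain k where "pcompose (map_poly of_int q) h = f * k" by auto
  then have "evr (pcompose (map_poly of_int q) h) z = 0" using z by simp
  then have "ev q (evr h z) = 0" by (simp add: evr_pcompose evr_of_int_poly)
  then show ?thesis using q(2) unfolding algebraic_int_altdef_ipoly ev_def by blast
qed

end

section \<open>Linear relations, denominators and finiteness of classes\<close>

interpretation rat_vs: vector_space "\<lambda>(q :: rat) (x :: 'a::field_char_0). of_rat q * x"
  by unfold_locales (simp_all add: algebra_simps of_rat_add of_rat_mult)

lemma evr_bounded_degree:
  assumes "degree h < n"
  shows "evr h x = (\<Sum>i<n. of_rat (coeff h i) * x ^ i)"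
proof -
  have "(\<Sum>i\<le>n - 1. monom (coeff h i) i) = h"
    using assms by (intro poly_as_sum_of_monoms') simp
  moreover have "{..n - 1} = {..<n}" using assms by auto
  ultimately have "evr h x = evr (\<Sum>i<n. monom (coeff h i) i) x" by simp
  then show ?thesis by simp
qed

lemma evr_in_rat_span: "evr h x \<in> rat_vs.span (range (\<lambda>i. x ^ i))"
  unfolding evr_bounded_degree[OF lessI]
  by (intro rat_vs.span_sum rat_vs.span_scale rat_vs.span_base rangeI)

lemma rational_relation:
  fixes z :: "nat \<Rightarrow> 'a::field_char_0"
  assumes B: "finite B" "card B \<le> n" and z: "\<And>i. i \<le> n \<Longrightarrow> z i \<in> rat_vs.span B"
  shows "\<exists>c :: nat \<Rightarrow> rat. (\<Sum>i\<le>n. of_rat (c i) * z i) = 0 \<and> (\<exists>i\<le>n. c i \<noteq> 0)"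
proof (cases "inj_on z {..n}")
  case True
  have "rat_vs.dependent (z ` {..n})"
  proof (rule ccontr)
    assume "\<not> ?thesis"
    then have "card (z ` {..n}) \<le> card B" using rat_vs.independent_span_bound[OF B(1)] z by blast
    then show False using B(2) True by (simp add: card_image)
  qed
  then obtain u v where u: "v \<in> z ` {..n}" "u v \<noteq> 0" "(\<Sum>v\<in>z ` {..n}. of_rat (u v) * v) = 0"
    using rat_vs.dependent_finite[of "z ` {..n}"] by auto
  then have "(\<Sum>i\<le>n. of_rat (u (z i)) * z i) = 0" by (simp add: sum.reindex[OF True])
  then show ?thesis using u(1,2) by (intro exI[of _ "\<lambda>i. u (z i)"]) auto
next
  case False
  then obtain i j where ij: "i \<le> n" "j \<le> n" "i \<noteq> j" "z i = z j" by (auto simp: inj_on_def)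
  define c :: "nat \<Rightarrow> rat" where "c k = (if k = i then 1 else if k = j then - 1 else 0)" for k
  have "{..n} = insert i (insert j ({..n} - {i, j}))" using ij by auto
  then have "(\<Sum>k\<le>n. of_rat (c k) * z k) = (\<Sum>k\<in>insert i (insert j ({..n} - {i, j})). of_rat (c k) * z k)" by simp
  also have "\<dots> = 0" using ij by (simp add: c_def)
  finally show ?thesis using ij(1) by (intro exI[of _ c]) (auto simp: c_def)
qed

lemma clear_denominators:
  fixes c :: "'i \<Rightarrow> rat"
  assumes "finite A"
  shows "\<exists>e>0. \<forall>i\<in>A. of_int e * c i \<in> \<int>"
  using assms
proof (induction A)
  case (insert i A)
  then obtain e where e: "e > 0" "\<forall>i\<in>A. of_int e * c i \<in> \<int>" by blast
  obtain a b where ab: "b > 0" "c i = of_int a / of_int b"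
    by (metis quotient_of_denom_pos quotient_of_div surj_pair)
  show ?case
  proof (intro exI[of _ "e * b"] conjI ballI)
    fix j assume "j \<in> insert i A"
    moreover have "of_int (e * b) * c j = of_int b * (of_int e * c j)" for j by simp
    moreover have "of_int (e * b) * c i = of_int (e * a)" using ab by simp
    ultimately show "of_int (e * b) * c j \<in> \<int>" using e(2) by (metis Ints_mult Ints_of_int insert_iff)
  qed (use e ab in simp)
qed (intro exI[of _ 1], simp)

lemma integer_relation:
  fixes c :: "nat \<Rightarrow> rat" and z :: "nat \<Rightarrow> 'a::field_char_0"
  assumes "(\<Sum>i\<le>n. of_rat (c i) * z i) = 0" "i0 \<le> n" "c i0 \<noteq> 0"
  shows "\<exists>d :: nat \<Rightarrow> int. (\<Sum>i\<le>n. of_int (d i) * z i) = 0 \<and> d i0 \<noteq> 0"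
proof -
  obtain e where e: "e > 0" "\<forall>i\<in>{..n}. of_int e * c i \<in> \<int>" using clear_denominators[of "{..n}" c] by auto
  have "\<forall>i\<in>{..n}. \<exists>d. of_int e * c i = of_int d" using e(2) Ints_cases by metis
  then obtain d where d: "\<forall>i\<in>{..n}. of_int e * c i = of_int (d i)" by (rule bchoice[THEN exE])
  have "of_int (d i) = (of_int e * of_rat (c i) :: 'a)" if "i \<le> n" for i
  proof -
    have "of_rat (of_int e * c i) = (of_rat (of_int (d i)) :: 'a)" using d that by simp
    then show ?thesis by (simp add: of_rat_mult)
  qed
  then have "(\<Sum>i\<le>n. of_int (d i) * z i) = of_int e * (\<Sum>i\<le>n. of_rat (c i) * z i)"
    by (simp add: sum_distrib_left mult.assoc)
  moreover have "d i0 \<noteq> 0"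
  proof
    assume "d i0 = 0"
    then have "of_int e * c i0 = 0" using d assms(2) by simp
    then show False using e(1) assms(3) by simp
  qed
  ultimately show ?thesis using assms(1) by (intro exI[of _ d]) simp
qed

text \<open>As long as p divides all coefficients, divide by p; the nonzero coefficient at i0
  shrinks, so this ends.\<close>

lemma primitive_relation:
  fixes d :: "nat \<Rightarrow> int" and z :: "nat \<Rightarrow> 'a::field_char_0"
  assumes p: "p > 1" and "(\<Sum>i\<le>n. of_int (d i) * z i) = 0" "i0 \<le> n" "d i0 \<noteq> 0"
  shows "\<exists>d :: nat \<Rightarrow> int. (\<Sum>i\<le>n. of_int (d i) * z i) = 0 \<and> (\<exists>i\<le>n. \<not> p dvd d i)"
  using assms(2,4)
proof (induction "nat \<bar>d i0\<bar>" arbitrary: d rule: less_induct)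
  case less
  show ?case
  proof (cases "\<forall>i\<le>n. p dvd d i")
    case True
    define d' where "d' i = d i div p" for i
    have d': "d i = p * d' i" if "i \<le> n" for i using True that by (simp add: d'_def)
    have "of_int p * (\<Sum>i\<le>n. of_int (d' i) * z i) = 0"
      using less.prems(1) by (simp add: sum_distrib_left d' mult.assoc)
    then have 1: "(\<Sum>i\<le>n. of_int (d' i) * z i) = 0" using p by simp
    have 2: "d' i0 \<noteq> 0" using less.prems(2) d' assms(3) by auto
    have "\<bar>d i0\<bar> = p * \<bar>d' i0\<bar>" using d'[OF assms(3)] p by (simp add: abs_mult)
    moreover have "1 * \<bar>d' i0\<bar> < p * \<bar>d' i0\<bar>" using p 2 by (intro mult_strict_right_mono) auto
    ultimately have "nat \<bar>d' i0\<bar> < nat \<bar>d i0\<bar>" by simp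
    then show ?thesis using less.hyps 1 2 by blast
  qed (use less.prems in blast)
qed

text \<open>The class of x lists the coefficients of D x modulo m. It serves twice: with m = D p for
  finiteness modulo p, and with m = D for finiteness of an index.\<close>

lemma finite_coefficient_classes:
  fixes \<theta> :: "'a::field_char_0"
  assumes D: "\<And>x. x \<in> S \<Longrightarrow> \<exists>g. degree g < n \<and> of_int D * x = ev g \<theta>" and m: "m > 0"
  shows "\<exists>\<phi> :: 'a \<Rightarrow> int list. finite (\<phi> ` S) \<and>
    (\<forall>x\<in>S. \<forall>y\<in>S. \<phi> x = \<phi> y \<longrightarrow> (\<exists>g. of_int D * (x - y) = of_int m * ev g \<theta>))"
proof -
  have "\<forall>x\<in>S. \<exists>g. degree g < n \<and> of_int D * x = ev g \<theta>" using D by blast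
  then obtain g where g: "\<forall>x\<in>S. degree (g x) < n \<and> of_int D * x = ev (g x) \<theta>" by (rule bchoice[THEN exE])
  define \<phi> where "\<phi> x = map (\<lambda>i. coeff (g x) i mod m) [0..<n]" for x
  have "\<phi> ` S \<subseteq> {xs. set xs \<subseteq> {0..<m} \<and> length xs = n}"
    using m by (auto simp: \<phi>_def)
  then have "finite (\<phi> ` S)" by (rule finite_subset) (simp add: finite_lists_length_eq)
  moreover have "\<exists>h. of_int D * (x - y) = of_int m * ev h \<theta>" if xy: "x \<in> S" "y \<in> S" "\<phi> x = \<phi> y" for x y
  proof -
    have "m dvd coeff (g x - g y) i" for i
    proof (cases "i < n")
      case True
      have "\<phi> x ! i = \<phi> y ! i" using xy by simp
      then have "coeff (g x) i mod m = coeff (g y) i mod m" using True by (simp add: \<phi>_def)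
      then show ?thesis by (simp add: mod_eq_dvd_iff)
    next
      case False
      then have "degree (g x) < i" "degree (g y) < i" using g xy by auto
      then show ?thesis by (simp add: coeff_eq_0)
    qed
    then have "[:m:] dvd g x - g y" by (simp add: const_poly_dvd_iff)
    then obtain h where "g x - g y = [:m:] * h" by auto
    then have "ev (g x - g y) \<theta> = ev ([:m:] * h) \<theta>" by simp
    then have "ev (g x) \<theta> - ev (g y) \<theta> = of_int m * ev h \<theta>" by (simp only: ev_diff ev_mult) simp
    then show ?thesis using g xy by (intro exI[of _ h]) (simp add: right_diff_distrib)
  qed
  ultimately show ?thesis by blast
qed

lemma ascending_chain_stabilizes:
  fixes C :: "nat \<Rightarrow> 'b set"
  assumes fin: "finite U" and C: "\<And>k. C k \<subseteq> U" "\<And>k. C k \<subseteq> C (Suc k)"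
  shows "\<exists>k. C (Suc k) = C k"
proof (rule ccontr)
  assume no: "\<not> ?thesis"
  have fC: "finite (C k)" for k using fin C(1) finite_subset by blast
  have "k \<le> card (C k)" for k
  proof (induction k)
    case (Suc k)
    have "C k \<subset> C (Suc k)" using C(2) no by blast
    then have "card (C k) < card (C (Suc k))" using fC psubset_card_mono by blast
    then show ?case using Suc by simp
  qed simp
  moreover have "card (C (Suc (card U))) \<le> card U" using fin C(1) card_mono by blast
  ultimately show False using not_less_eq_eq by blast
qed

lemma algebraic_int_coeff_prod:
  fixes Z :: "'a::field_char_0 set"
  assumes "\<And>w. w \<in> Z \<Longrightarrow> algebraic_int w"
  shows "algebraic_int (coeff (\<Prod>w\<in>Z. [:- w, 1:]) i)"
  using assms
proof (induction Z arbitrary: i rule: infinite_finite_induct)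
  case (insert w Z)
  have IH: "algebraic_int (coeff (\<Prod>w\<in>Z. [:- w, 1:]) i)" for i using insert by blast
  have w: "algebraic_int w" using insert.prems by simp
  show ?case
  proof (cases i)
    case 0
    then show ?thesis using insert.hyps algebraic_int_add_mult(2)[OF w IH[of 0]] by simp
  next
    case (Suc j)
    have "algebraic_int (coeff (\<Prod>w\<in>Z. [:- w, 1:]) j + - (w * coeff (\<Prod>w\<in>Z. [:- w, 1:]) i))"
      by (rule algebraic_int_add_mult(1)[OF IH]) (simp add: algebraic_int_add_mult(2)[OF w IH])
    then show ?thesis using insert.hyps Suc by simp
  qed
qed (auto simp: coeff_1)

context simple_extension
begin

text \<open>Lagrange interpolation over the complex conjugates of \<open>\<theta>\<close> shows that the coordinates of
  an algebraic integer, times the product of all root differences, are algebraic integers.\<close>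

lemma common_denominator:
  "\<exists>D :: int. D > 0 \<and> (\<forall>x\<in>OK. \<exists>g. degree g < N \<and> of_int D * x = ev g \<theta>)"
proof -
  obtain Z :: "complex set" where Z: "finite Z" "card Z = N" "\<forall>z\<in>Z. evr f z = 0 \<and> algebraic_int z"
    using f_roots_complex by blast
  define L where "L z = (\<Prod>w\<in>Z - {z}. [:- w, 1:])" for z
  define e where "e z = (\<Prod>w\<in>Z - {z}. z - w)" for z
  \<comment> \<open>Up to sign the discriminant of f. It is treated only as a nonzero algebraic
    integer, which is why the integral multiple c is introduced.\<close>
  define E where "E = (\<Prod>z\<in>Z. e z)"
  have e_int: "algebraic_int (e z)" if "z \<in> Z" for z
  proof -
    have "algebraic_int (z - w)" if "w \<in> Z" for w
      using algebraic_int_add_mult(1)[of z "- w"] Z(3) that \<open>z \<in> Z\<close> by auto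
    then show ?thesis unfolding e_def by (intro algebraic_int_prod) auto
  qed
  have "algebraic_int E" unfolding E_def by (intro algebraic_int_prod e_int)
  moreover have "E \<noteq> 0" unfolding E_def e_def using Z(1) by auto
  ultimately obtain c q where c: "c \<noteq> 0" "of_int c = E * ev q E" using algebraic_int_dvd_int by blast
  have coeff: "algebraic_int (E * of_rat (coeff h i))"
    if h: "degree h < N" "algebraic_int (evr h \<theta>)" for h i
  proof -
    let ?h = "map_poly of_rat h :: complex poly"
    let ?S = "\<Sum>z\<in>Z. Polynomial.smult (evr h z * (\<Prod>z'\<in>Z - {z}. e z')) (L z)"
    have degL: "degree (Polynomial.smult a (L z)) < N" if "z \<in> Z" for z a
    proof -
      have "degree (L z) = card (Z - {z})" unfolding L_def
        by (subst degree_prod_eq_sum_degree) (use Z(1) in auto)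
      also have "\<dots> < N" using Z that by (metis card_Diff1_less)
      finally show ?thesis using degree_smult_le le_less_trans by blast
    qed
    \<comment> \<open>Lagrange's formula multiplied by E: the factor \<open>e z\<close> left out of
      the product is the Lagrange denominator at z. Both sides have degree below N and agree at the
      N conjugates.\<close>
    have eq: "Polynomial.smult E ?h = ?S"
    proof (rule poly_eqI_degree)
      show "degree (Polynomial.smult E ?h) < card Z"
        using h(1) Z(2) degree_smult_le[of E ?h] by (simp add: degree_map_poly)
      show "degree ?S < card Z" unfolding Z(2) using degL N_pos by (intro degree_sum_less)
      fix y assume y: "y \<in> Z"
      have "poly (L z) y = (\<Prod>w\<in>Z - {z}. y - w)" for z by (simp add: L_def poly_prod)
      then have Ly: "poly (L z) y = (if z = y then e y else 0)" if "z \<in> Z" for z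
        using y Z(1) that by (auto simp: e_def intro!: prod_zero)
      have "poly ?S y = (\<Sum>z\<in>Z. if z = y then evr h y * (\<Prod>z'\<in>Z - {y}. e z') * e y else 0)"
        unfolding poly_sum poly_smult by (intro sum.cong) (auto simp: Ly)
      also have "\<dots> = evr h y * (\<Prod>z'\<in>Z - {y}. e z') * e y" using y Z(1) by simp
      also have "\<dots> = evr h y * E" unfolding E_def using Z(1) y by (simp add: prod.remove[of Z y e] mult_ac)
      finally show "poly (Polynomial.smult E ?h) y = poly ?S y" by (simp add: evr_def)
    qed
    have "E * of_rat (coeff h i) = coeff (Polynomial.smult E ?h) i" by simp
    also have "\<dots> = (\<Sum>z\<in>Z. (evr h z * (\<Prod>z'\<in>Z - {z}. e z')) * coeff (L z) i)"
      unfolding eq by (simp add: coeff_sum)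
    also have "algebraic_int \<dots>"
    proof (intro algebraic_int_sum algebraic_int_add_mult(2))
      fix z assume z: "z \<in> Z"
      show "algebraic_int (evr h z)" using conjugate_algebraic_int[OF h(2)] Z(3) z by blast
      show "algebraic_int (\<Prod>z'\<in>Z - {z}. e z')" by (intro algebraic_int_prod e_int) auto
      show "algebraic_int (coeff (L z) i)" unfolding L_def
        by (intro algebraic_int_coeff_prod) (use Z(3) in auto)
    qed
    finally show ?thesis .
  qed
  show ?thesis
  proof (intro exI[of _ "c * c"] conjI ballI)
    \<comment> \<open>Already c makes the coordinates integral, as they become rational algebraic
      integers; the square only provides a positive denominator.\<close>
    show "c * c > 0" using c(1) by (auto simp: zero_less_mult_iff linorder_neq_iff)
    fix x assume "x \<in> OK"
    then have x: "x \<in> K" "algebraic_int x" by (simp_all add: OK_iff)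
    obtain h where h: "degree h < N" "x = evr h \<theta>" using K_reduced[OF x(1)] by (elim exE conjE)
    have h_int: "algebraic_int (evr h \<theta>)" using x(2) h(2) by simp
    have "\<exists>m :: int. of_int c * coeff h i = of_int m" for i
    proof -
      have "algebraic_int (ev q E * (E * of_rat (coeff h i)))"
        by (intro algebraic_int_add_mult(2) algebraic_int_ev coeff h h_int \<open>algebraic_int E\<close>)
      moreover have "ev q E * (E * of_rat (coeff h i)) = of_rat (of_int c * coeff h i)"
        using c(2) by (simp add: of_rat_mult mult_ac)
      ultimately have "of_rat (of_int c * coeff h i) \<in> (\<int> :: complex set)"
        using rational_algebraic_int_is_int Rats_of_rat by metis
      then obtain m where "of_rat (of_int c * coeff h i) = (of_int m :: complex)" by (elim Ints_cases)
      then have "of_rat (of_int c * coeff h i) = (of_rat (of_int m) :: complex)" by simp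
      then have "of_int c * coeff h i = of_int m" by (simp only: of_rat_eq_iff)
      then show ?thesis ..
    qed
    then obtain m :: "nat \<Rightarrow> int" where m: "\<And>i. of_int c * coeff h i = of_int (m i)" by metis
    have m': "of_int (m i) = (of_int c * of_rat (coeff h i) :: 'a)" for i
      using arg_cong[OF m[of i], of "of_rat :: rat \<Rightarrow> 'a"] by (simp add: of_rat_mult)
    define g where "g = (\<Sum>i<N. monom (c * m i) i)"
    have "degree g < N" unfolding g_def
      using N_pos by (intro degree_sum_less) (auto intro: le_less_trans[OF degree_monom_le])
    moreover have "of_int (c * c) * x = ev g \<theta>"
      unfolding g_def h(2) evr_bounded_degree[OF h(1)] by (simp add: m' sum_distrib_left mult.assoc)
    ultimately show "\<exists>g. degree g < N \<and> of_int (c * c) * x = ev g \<theta>"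
      by (intro exI[of _ g] conjI)
  qed
qed

lemma K_closed:
  shows "0 \<in> K" "1 \<in> K" "x \<in> K \<Longrightarrow> y \<in> K \<Longrightarrow> x + y \<in> K" "x \<in> K \<Longrightarrow> y \<in> K \<Longrightarrow> x * y \<in> K"
    "x \<in> K \<Longrightarrow> - x \<in> K" "x \<in> K \<Longrightarrow> inverse x \<in> K"
  using subfield_K by (simp_all add: subfield_def)

lemma ev_theta_in_OK: "ev h \<theta> \<in> OK"
proof -
  have "ev h \<theta> \<in> K" unfolding K_def evr_of_int_poly[symmetric] by simp
  then show ?thesis using algebraic_int_ev[OF algebraic_int_theta] by (simp add: OK_iff)
qed

lemma OK_closed:
  shows "x \<in> OK \<Longrightarrow> y \<in> OK \<Longrightarrow> x + y \<in> OK" "x \<in> OK \<Longrightarrow> - x \<in> OK"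
    "x \<in> OK \<Longrightarrow> y \<in> OK \<Longrightarrow> x * y \<in> OK"
  by (simp_all add: OK_iff K_closed algebraic_int_add_mult)

lemma OK_sum: "(\<And>i. i \<in> A \<Longrightarrow> g i \<in> OK) \<Longrightarrow> sum g A \<in> OK"
  by (induction A rule: infinite_finite_induct) (auto simp: OK_closed OK_iff K_closed algebraic_int_add_mult)

lemma OK_classes:
  assumes p: "p > 0"
  shows "\<exists>\<phi> :: 'a \<Rightarrow> int list. finite (\<phi> ` OK) \<and>
    (\<forall>x\<in>OK. \<forall>y\<in>OK. \<phi> x = \<phi> y \<longrightarrow> (\<exists>g. x - y = of_nat p * ev g \<theta>))"
proof -
  obtain D where D: "D > 0" "\<forall>x\<in>OK. \<exists>g. degree g < N \<and> of_int D * x = ev g \<theta>"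
    using common_denominator by (elim exE conjE)
  obtain \<phi> :: "'a \<Rightarrow> int list" where phi: "finite (\<phi> ` OK)"
    "\<forall>x\<in>OK. \<forall>y\<in>OK. \<phi> x = \<phi> y \<longrightarrow> (\<exists>g. of_int D * (x - y) = of_int (D * int p) * ev g \<theta>)"
    using finite_coefficient_classes[of OK N D \<theta> "D * int p"] D p by auto
  have "\<exists>g. x - y = of_nat p * ev g \<theta>" if xy: "x \<in> OK" "y \<in> OK" "\<phi> x = \<phi> y" for x y
  proof -
    obtain g where "of_int D * (x - y) = of_int (D * int p) * ev g \<theta>" using phi(2) xy by blast
    then have "of_int D * (x - y) = of_int D * (of_nat p * ev g \<theta>)" by (simp add: mult.assoc)
    then have "x - y = of_nat p * ev g \<theta>" using D(1) by simp
    then show ?thesis ..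
  qed
  then show ?thesis using phi(1) by (intro exI[of _ \<phi>]) simp
qed

text \<open>The \<open>\<int>[\<theta>]\<close>-modules generated by \<open>p, p x, \<dots>, p x\<^sup>k\<close> all lie between \<open>p \<int>[\<theta>]\<close> and \<open>OK\<close>,
  so they stabilize, which makes \<open>x\<close> integral over \<open>\<int>[\<theta>]\<close>.\<close>

lemma OK_bounded_powers:
  assumes p: "p > 0" and x: "\<And>k. of_nat p * x ^ k \<in> OK"
  shows "x \<in> OK"
proof -
  obtain \<phi> :: "'a \<Rightarrow> int list" where phi: "finite (\<phi> ` OK)"
    "\<forall>x\<in>OK. \<forall>y\<in>OK. \<phi> x = \<phi> y \<longrightarrow> (\<exists>g. x - y = of_nat p * ev g \<theta>)"
    using OK_classes[OF p] by (elim exE conjE)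
  define M where "M k = range (\<lambda>g. \<Sum>j\<le>k. ev (g j) \<theta> * (of_nat p * x ^ j))" for k :: nat
  have M_I: "(\<Sum>j\<le>k. ev (g j) \<theta> * (of_nat p * x ^ j)) \<in> M k" for g k
    using rangeI[of "\<lambda>g. \<Sum>j\<le>k. ev (g j) \<theta> * (of_nat p * x ^ j)" g] by (simp add: M_def)
  have M_OK: "M k \<subseteq> OK" for k unfolding M_def by (auto intro!: OK_sum OK_closed(3) ev_theta_in_OK x)
  have M_mono: "M k \<subseteq> M (Suc k)" for k
  proof
    fix y assume "y \<in> M k"
    then obtain g where "y = (\<Sum>j\<le>k. ev (g j) \<theta> * (of_nat p * x ^ j))" by (auto simp: M_def)
    then have "y = (\<Sum>j\<le>Suc k. ev ((g(Suc k := 0)) j) \<theta> * (of_nat p * x ^ j))" by simp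
    with M_I[of "g(Suc k := 0)" "Suc k"] show "y \<in> M (Suc k)" by (simp only:)
  qed
  \<comment> \<open>What stabilizes is the image of the modules in the finite set of classes, so
    \<open>p * x ^ Suc k\<close> agrees with an element of \<open>M k\<close> only up to p
    Z[\<open>\<theta>\<close>].\<close>
  have "\<exists>k. \<phi> ` M (Suc k) = \<phi> ` M k"
    by (rule ascending_chain_stabilizes[OF phi(1)]) (rule image_mono, rule M_OK M_mono)+
  then obtain k where k: "\<phi> ` M (Suc k) = \<phi> ` M k" by (elim exE)
  define y where "y = of_nat p * x ^ Suc k"
  have "y = (\<Sum>j\<le>Suc k. ev ((\<lambda>j. if j = Suc k then 1 else 0) j) \<theta> * (of_nat p * x ^ j))"
    by (simp add: y_def)
  with M_I[of "\<lambda>j. if j = Suc k then 1 else 0" "Suc k"] have "y \<in> M (Suc k)" by (simp only:)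
  then have "\<phi> y \<in> \<phi> ` M k" using k by blast
  then obtain a where a: "a \<in> M k" "\<phi> y = \<phi> a" by blast
  have "y \<in> OK" unfolding y_def by (rule x)
  moreover have "a \<in> OK" using M_OK a(1) by blast
  ultimately obtain g where g: "y - a = of_nat p * ev g \<theta>" using phi(2) a(2) by blast
  obtain h where h: "a = (\<Sum>j\<le>k. ev (h j) \<theta> * (of_nat p * x ^ j))" using a(1) by (auto simp: M_def)
  \<comment> \<open>The error in p Z[\<open>\<theta>\<close>] is absorbed by the coefficient of
    \<open>p * x ^ 0\<close>.\<close>
  define h' where "h' = h(0 := h 0 + g)"
  have "(\<Sum>j\<le>k. ev (h' j) \<theta> * (of_nat p * x ^ j)) = ev (h' 0) \<theta> * of_nat p + (\<Sum>j\<in>{..k} - {0}. ev (h j) \<theta> * (of_nat p * x ^ j))"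
    by (simp add: sum.remove[of "{..k}" 0] h'_def)
  also have "\<dots> = a + of_nat p * ev g \<theta>"
    unfolding h by (simp add: sum.remove[of "{..k}" 0] h'_def algebra_simps)
  also have "\<dots> = y" unfolding g[symmetric] by simp
  finally have "of_nat p * x ^ Suc k = of_nat p * (\<Sum>j\<le>k. ev (h' j) \<theta> * x ^ j)"
    unfolding y_def sum_distrib_left by (simp only: mult.left_commute)
  then have "x ^ Suc k = (\<Sum>j\<le>k. ev (h' j) \<theta> * x ^ j)" using p by simp
  then have "algebraic_int x" by (rule algebraic_int_trans[OF algebraic_int_theta])
  moreover have "x \<in> K"
  proof -
    have "of_nat p * x \<in> K" using x[of 1] by (simp add: OK_iff)
    moreover have "inverse (of_nat p) \<in> K" using subfield_of_rat[OF subfield_K, of "inverse (of_nat p)"] by (simp add: of_rat_inverse)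
    ultimately have "inverse (of_nat p) * (of_nat p * x) \<in> K" by (rule K_closed(4)[rotated])
    then show ?thesis using p by (simp add: mult.assoc[symmetric])
  qed
  ultimately show ?thesis by (simp add: OK_iff)
qed

lemma OK_rank:
  assumes p: "p > 1" and z: "\<And>i. i \<le> N \<Longrightarrow> z i \<in> OK"
  shows "\<exists>c :: nat \<Rightarrow> int. (\<Sum>i\<le>N. of_int (c i) * z i) = 0 \<and> (\<exists>i\<le>N. \<not> int p dvd c i)"
proof -
  let ?B = "(\<lambda>i. \<theta> ^ i) ` {..<N}"
  have "z i \<in> rat_vs.span ?B" if "i \<le> N" for i
  proof -
    have "z i \<in> K" using z[OF that] by (simp add: OK_iff)
    from K_reduced[OF this] obtain h where h: "degree h < N" "z i = evr h \<theta>" by (elim exE conjE)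
    show ?thesis unfolding h(2) evr_bounded_degree[OF h(1)]
      by (intro rat_vs.span_sum rat_vs.span_scale rat_vs.span_base imageI)
  qed
  moreover have "card ?B \<le> N" using card_image_le[of "{..<N}" "\<lambda>i. \<theta> ^ i"] by simp
  ultimately obtain c :: "nat \<Rightarrow> rat" and i where c: "(\<Sum>i\<le>N. of_rat (c i) * z i) = 0" "i \<le> N" "c i \<noteq> 0"
    using rational_relation[of ?B N z] by auto
  obtain d :: "nat \<Rightarrow> int" where d: "(\<Sum>i\<le>N. of_int (d i) * z i) = 0" "d i \<noteq> 0"
    using integer_relation[OF c] by (elim exE conjE)
  show ?thesis using primitive_relation[of "int p", OF _ d(1) c(2) d(2)] p by simp
qed

theorem p_maximal_order_OK:
  assumes p: "prime p"
  shows "p_maximal_order OK p N"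
proof
  have p1: "p > 1" using p prime_gt_1_nat by blast
  show "0 \<in> OK" "1 \<in> OK" by (simp_all add: OK_iff K_closed)
  show "x + y \<in> OK" if "x \<in> OK" "y \<in> OK" for x y using OK_closed(1)[OF that] .
  show "- x \<in> OK" if "x \<in> OK" for x using OK_closed(2)[OF that] .
  show "x * y \<in> OK" if "x \<in> OK" "y \<in> OK" for x y using OK_closed(3)[OF that] .
  show "prime p" by (rule p)
  show "\<exists>T. finite T \<and> T \<subseteq> OK \<and> (\<forall>x\<in>OK. \<exists>t\<in>T. \<exists>y\<in>OK. x = t + of_nat p * y)"
  proof -
    obtain \<phi> :: "'a \<Rightarrow> int list" where phi: "finite (\<phi> ` OK)"
      "\<forall>x\<in>OK. \<forall>y\<in>OK. \<phi> x = \<phi> y \<longrightarrow> (\<exists>g. x - y = of_nat p * ev g \<theta>)"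
      using OK_classes[of p] p1 by auto
    let ?T = "inv_into OK \<phi> ` (\<phi> ` OK)"
    have "\<exists>t\<in>?T. \<exists>y\<in>OK. x = t + of_nat p * y" if x: "x \<in> OK" for x
    proof -
      have im: "\<phi> x \<in> \<phi> ` OK" using x by simp
      let ?t = "inv_into OK \<phi> (\<phi> x)"
      have "?t \<in> OK" "\<phi> x = \<phi> ?t" using inv_into_into[OF im] f_inv_into_f[OF im] by simp_all
      then obtain g where "x - ?t = of_nat p * ev g \<theta>" using phi(2) x by blast
      then have "x = ?t + of_nat p * ev g \<theta>" by (simp add: algebra_simps)
      then show ?thesis using im ev_theta_in_OK by blast
    qed
    moreover have "?T \<subseteq> OK" by (rule image_subsetI) (rule inv_into_into)
    ultimately show ?thesis using phi(1) by (intro exI[of _ ?T]) simp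
  qed
  show "x \<in> OK" if "\<And>k. of_nat p * x ^ k \<in> OK" for x
    by (rule OK_bounded_powers[OF _ that]) (use p1 in simp)
  show "\<exists>c :: nat \<Rightarrow> int. (\<Sum>i\<le>N. of_int (c i) * z i) = 0 \<and> (\<exists>i\<le>N. \<not> int p dvd c i)"
    if "\<And>i. i \<le> N \<Longrightarrow> z i \<in> OK" for z
    by (rule OK_rank[OF p1 that])
qed

end

section \<open>The index of the trinomial field\<close>

lemma int_adjoin_eq: "int_adjoin x = range (\<lambda>h. ev h x)"
  by (simp add: int_adjoin_def ev_def)

lemma int_adjoin_closed:
  shows "0 \<in> int_adjoin x" "y \<in> int_adjoin x \<Longrightarrow> z \<in> int_adjoin x \<Longrightarrow> y + z \<in> int_adjoin x"
    "y \<in> int_adjoin x \<Longrightarrow> of_int k * y \<in> int_adjoin x" "y \<in> int_adjoin x \<Longrightarrow> - y \<in> int_adjoin x"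
proof -
  show "0 \<in> int_adjoin x" unfolding int_adjoin_eq by (rule range_eqI[of _ _ 0]) simp
  show "y + z \<in> int_adjoin x" if yz: "y \<in> int_adjoin x" "z \<in> int_adjoin x"
  proof -
    obtain g h where "y = ev g x" "z = ev h x" using yz by (auto simp: int_adjoin_eq)
    then show ?thesis unfolding int_adjoin_eq by (intro range_eqI[of _ _ "g + h"]) simp
  qed
  have scale: "of_int k * y \<in> int_adjoin x" if y: "y \<in> int_adjoin x" for k
  proof -
    obtain g where "y = ev g x" using y by (auto simp: int_adjoin_eq)
    then show ?thesis unfolding int_adjoin_eq by (intro range_eqI[of _ _ "Polynomial.smult k g"]) simp
  qed
  then show "y \<in> int_adjoin x \<Longrightarrow> of_int k * y \<in> int_adjoin x" .
  show "y \<in> int_adjoin x \<Longrightarrow> - y \<in> int_adjoin x" using scale[of "- 1"] by simp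
qed

lemma int_adjoin_sum: "(\<And>i. i \<in> A \<Longrightarrow> g i \<in> int_adjoin x) \<Longrightarrow> sum g A \<in> int_adjoin x"
  by (induction A rule: infinite_finite_induct) (auto simp: int_adjoin_closed)

lemma clear_denominators_evr:
  "\<exists>e :: int. e > 0 \<and> of_int e * evr h x \<in> int_adjoin x"
proof -
  obtain e where e: "e > 0" "\<forall>i\<in>{..degree h}. of_int e * coeff h i \<in> \<int>"
    using clear_denominators[of "{..degree h}" "coeff h"] by auto
  have "of_int e * (of_rat (coeff h i) * x ^ i) \<in> int_adjoin x" if "i < Suc (degree h)" for i
  proof -
    have "of_int e * coeff h i \<in> \<int>" using e(2) that by simp
    then obtain m where "of_int e * coeff h i = of_int m" by (elim Ints_cases)
    then have "of_rat (of_int e * coeff h i) = (of_rat (of_int m) :: 'a)" by simp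
    then have "of_int e * (of_rat (coeff h i) * x ^ i) = ev (monom m i) x"
      by (simp add: of_rat_mult flip: mult.assoc)
    then show ?thesis unfolding int_adjoin_eq by (rule range_eqI)
  qed
  then have "of_int e * evr h x \<in> int_adjoin x"
    unfolding evr_bounded_degree[OF lessI] sum_distrib_left by (intro int_adjoin_sum) simp
  then show ?thesis using e(1) by blast
qed

lemma rat_span_powers_subset:
  assumes "subfield S" "x \<in> S"
  shows "rat_vs.span (range (\<lambda>i. x ^ i)) \<subseteq> S"
proof (rule rat_vs.span_minimal)
  show "range (\<lambda>i. x ^ i) \<subseteq> S"
  proof (rule image_subsetI)
    fix i show "x ^ i \<in> S" using subfield_evr[OF assms, of "monom 1 i"] by simp
  qed
  show "rat_vs.subspace S"
    unfolding rat_vs.subspace_def using assms(1) subfield_of_rat[OF assms(1)] by (simp add: subfield_def)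
qed

lemma rat_span_powers_evr:
  assumes "y \<in> rat_vs.span (range (\<lambda>i. x ^ i))"
  shows "\<exists>h. y = evr h x"
proof -
  have "rat_vs.span (range (\<lambda>i. x ^ i)) \<subseteq> range (\<lambda>h. evr h x)"
  proof (rule rat_vs.span_minimal)
    show "range (\<lambda>i. x ^ i) \<subseteq> range (\<lambda>h. evr h x)"
    proof (rule image_subsetI)
      fix i show "x ^ i \<in> range (\<lambda>h. evr h x)" by (rule range_eqI[of _ _ "monom 1 i"]) simp
    qed
    show "rat_vs.subspace (range (\<lambda>h. evr h x))"
      unfolding rat_vs.subspace_def
    proof (intro conjI ballI allI)
      show "0 \<in> range (\<lambda>h. evr h x)" by (rule range_eqI[of _ _ 0]) simp
      fix y assume "y \<in> range (\<lambda>h. evr h x)"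
      then obtain g where g: "y = evr g x" by auto
      show "of_rat c * y \<in> range (\<lambda>h. evr h x)" for c
        by (rule range_eqI[of _ _ "Polynomial.smult c g"]) (simp add: g)
      fix z assume "z \<in> range (\<lambda>h. evr h x)"
      then obtain h where h: "z = evr h x" by auto
      show "y + z \<in> range (\<lambda>h. evr h x)" by (rule range_eqI[of _ _ "g + h"]) (simp add: g h)
    qed
  qed
  then show ?thesis using assms by blast
qed

text \<open>An element of order \<open>p\<close> of \<open>A/B\<close> comes from \<open>y \<in> A\<close> with \<open>p y \<in> B\<close> and \<open>y \<notin> B\<close>.\<close>

lemma prime_not_dvd_card_cosets:
  fixes A B :: "'a::field_char_0 set"
  assumes p: "prime p"
    and A: "0 \<in> A" "\<And>x y. x \<in> A \<Longrightarrow> y \<in> A \<Longrightarrow> x + y \<in> A" "\<And>x. x \<in> A \<Longrightarrow> - x \<in> A"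
    and B: "B \<subseteq> A" "0 \<in> B" "\<And>x y. x \<in> B \<Longrightarrow> y \<in> B \<Longrightarrow> x + y \<in> B" "\<And>x. x \<in> B \<Longrightarrow> - x \<in> B"
    and fin: "finite ((\<lambda>x. {x + z | z. z \<in> B}) ` A)"
    and torsion: "\<And>y. y \<in> A \<Longrightarrow> of_nat p * y \<in> B \<Longrightarrow> y \<in> B"
  shows "\<not> p dvd card ((\<lambda>x. {x + z | z. z \<in> B}) ` A)"
proof
  assume dvd: "p dvd card ((\<lambda>x. {x + z | z. z \<in> B}) ` A)"
  define G :: "'a monoid" where "G = \<lparr>carrier = A, monoid.mult = (+), one = 0\<rparr>"
  have "comm_group G"
  proof (rule comm_groupI)
    show "\<exists>y\<in>carrier G. y \<otimes>\<^bsub>G\<^esub> x = \<one>\<^bsub>G\<^esub>" if "x \<in> carrier G" for x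
      using that A(3) by (intro bexI[of _ "- x"]) (simp_all add: G_def)
  qed (use A in \<open>simp_all add: G_def algebra_simps\<close>)
  then interpret G: comm_group G .
  have inv: "inv\<^bsub>G\<^esub> x = - x" if "x \<in> A" for x
    using that A(3) by (intro G.inv_equality) (simp_all add: G_def)
  have "subgroup B G"
  proof (rule subgroup.intro)
    show "inv\<^bsub>G\<^esub> x \<in> B" if "x \<in> B" for x using inv[of x] B(1,4) that by auto
  qed (use B in \<open>simp_all add: G_def\<close>)
  then have "B \<lhd> G" by (rule G.subgroup_imp_normal)
  then interpret N: normal B G .
  interpret Q: group "G Mod B" by (rule N.factorgroup_is_group)
  have coset: "B #>\<^bsub>G\<^esub> x = {x + z | z. z \<in> B}" for x
    by (auto simp: r_coset_def G_def add.commute)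
  have carr: "carrier (G Mod B) = (\<lambda>x. {x + z | z. z \<in> B}) ` A"
    by (auto simp: FactGroup_def RCOSETS_def coset) (auto simp: G_def)
  obtain m where m: "card (carrier (G Mod B)) = p * m" using dvd unfolding carr by (elim dvdE)
  \<comment> \<open>Sylow with exponent 1, that is, Cauchy's theorem: a subgroup of order p, whose
    elements are killed by p.\<close>
  obtain S where S: "subgroup S (G Mod B)" "card S = p"
    using sylow_thm[OF p Q.group_axioms, of 1 m] m fin carr by (auto simp: order_def)
  have "card S > 1" using S(2) p prime_gt_1_nat by simp
  have "\<exists>X\<in>S. X \<noteq> \<one>\<^bsub>G Mod B\<^esub>"
  proof (rule ccontr)
    assume "\<not> ?thesis"
    then have "S \<subseteq> {\<one>\<^bsub>G Mod B\<^esub>}" by blast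
    then have "card S \<le> 1" using card_mono[of "{\<one>\<^bsub>G Mod B\<^esub>}" S] by simp
    then show False using \<open>card S > 1\<close> by simp
  qed
  then obtain X where X: "X \<in> S" "X \<noteq> \<one>\<^bsub>G Mod B\<^esub>" by (elim bexE)
  interpret S: group "(G Mod B)\<lparr>carrier := S\<rparr>" by (rule Q.subgroup_imp_group[OF S(1)])
  have "X [^]\<^bsub>(G Mod B)\<lparr>carrier := S\<rparr>\<^esub> order ((G Mod B)\<lparr>carrier := S\<rparr>) = \<one>\<^bsub>(G Mod B)\<lparr>carrier := S\<rparr>\<^esub>"
    by (rule S.pow_order_eq_1) (use X in simp)
  then have Xp: "X [^]\<^bsub>G Mod B\<^esub> p = \<one>\<^bsub>G Mod B\<^esub>" using S(2) by (simp add: order_def nat_pow_def)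
  have "X \<in> carrier (G Mod B)" using subgroup.subset[OF S(1)] X(1) by blast
  then obtain y where y: "y \<in> A" "X = B #>\<^bsub>G\<^esub> y" unfolding carr coset by (elim imageE)
  have mult: "of_nat k * y \<in> A" for k by (induction k) (use A y in \<open>simp_all add: algebra_simps\<close>)
  have pow: "X [^]\<^bsub>G Mod B\<^esub> k = B #>\<^bsub>G\<^esub> (of_nat k * y)" for k :: nat
  proof (induction k)
    case 0
    have "B #>\<^bsub>G\<^esub> 0 = B" unfolding coset by simp
    then show ?case by (simp add: FactGroup_def)
  next
    case (Suc k)
    have "X [^]\<^bsub>G Mod B\<^esub> Suc k = (B #>\<^bsub>G\<^esub> (of_nat k * y)) <#>\<^bsub>G\<^esub> (B #>\<^bsub>G\<^esub> y)"
      by (simp only: Q.nat_pow_Suc Suc.IH) (simp add: y(2) FactGroup_def)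
    also have "\<dots> = B #>\<^bsub>G\<^esub> (of_nat k * y \<otimes>\<^bsub>G\<^esub> y)"
      by (rule N.rcos_sum) (use mult y in \<open>simp_all add: G_def\<close>)
    finally show ?case by (simp add: G_def algebra_simps)
  qed
  have "{of_nat p * y + z | z. z \<in> B} = B" using Xp unfolding pow coset by (simp add: FactGroup_def)
  moreover have "of_nat p * y + 0 \<in> {of_nat p * y + z | z. z \<in> B}" using B(2) by blast
  ultimately have "of_nat p * y \<in> B" by simp
  then have yB: "y \<in> B" by (rule torsion[OF y(1)])
  then have "B #>\<^bsub>G\<^esub> y = B" using N.rcos_const[of y] by simp
  then show False using X(2) y(2) by (simp add: FactGroup_def)
qed

context simple_extension
begin

lemma monogenic_mod_prime_power:
  assumes "\<And>y. y \<in> OK \<Longrightarrow> \<exists>h. \<exists>z\<in>OK. y = ev h \<alpha> + of_nat p * z" "y \<in> OK"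
  shows "\<exists>h. \<exists>z\<in>OK. y = ev h \<alpha> + of_nat p ^ k * z"
proof (induction k)
  case 0
  then show ?case using assms(2) by (intro exI[of _ 0] bexI[of _ y]) simp_all
next
  case (Suc k)
  then obtain h z where h: "z \<in> OK" "y = ev h \<alpha> + of_nat p ^ k * z" by (elim exE bexE)
  obtain g w where g: "w \<in> OK" "z = ev g \<alpha> + of_nat p * w" using assms(1)[OF h(1)] by (elim exE bexE)
  have "y = ev (h + Polynomial.smult (int p ^ k) g) \<alpha> + of_nat p ^ Suc k * w"
    unfolding h(2) g(2) by (simp add: algebra_simps)
  then show ?case using g(1) by (intro exI bexI)
qed

text \<open>Otherwise a linear functional vanishing on \<open>\<rat>(\<alpha>)\<close> but not on \<open>OK\<close> would take values
  divisible by every power of \<open>p\<close>, up to a bounded denominator.\<close>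

lemma OK_subset_span_if_monogenic_mod_p:
  assumes p: "p > 1"
    and mono: "\<And>y. y \<in> OK \<Longrightarrow> \<exists>h. \<exists>z\<in>OK. y = ev h \<alpha> + of_nat p * z"
  shows "OK \<subseteq> rat_vs.span (range (\<lambda>i. \<alpha> ^ i))"
proof
  let ?W = "rat_vs.span (range (\<lambda>i. \<alpha> ^ i))"
  fix y assume y: "y \<in> OK"
  show "y \<in> ?W"
  proof (rule ccontr)
    assume yW: "y \<notin> ?W"
    interpret rat: vector_space "(*) :: rat \<Rightarrow> rat \<Rightarrow> rat"
      by unfold_locales (simp_all add: algebra_simps)
    interpret pair: vector_space_pair "\<lambda>(q :: rat) (x :: 'a). of_rat q * x" "(*) :: rat \<Rightarrow> rat \<Rightarrow> rat" ..
    obtain B where B: "B \<subseteq> ?W" "\<not> rat_vs.dependent B" "?W \<subseteq> rat_vs.span B"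
      using rat_vs.maximal_independent_subset[of ?W] by blast
    have "rat_vs.span B \<subseteq> ?W" using B(1) by (intro rat_vs.span_minimal rat_vs.subspace_span)
    then have "y \<notin> rat_vs.span B" using yW by blast
    then have indep: "\<not> rat_vs.dependent (insert y B)" and yB: "y \<notin> B"
      using rat_vs.independent_insertI[OF _ B(2)] rat_vs.span_base by auto
    obtain g where g: "Vector_Spaces.linear (\<lambda>(q :: rat) (x :: 'a). of_rat q * x) (*) g"
      "\<forall>x\<in>insert y B. g x = (if x = y then 1 else 0)"
      using pair.linear_independent_extend[OF indep, of "\<lambda>x. if x = y then 1 else 0"] by (elim exE conjE)
    interpret g: Vector_Spaces.linear "\<lambda>(q :: rat) (x :: 'a). of_rat q * x" "(*)" g by (rule g(1))
    have gW: "g x = 0" if "x \<in> ?W" for x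
    proof (rule pair.linear_eq_0_on_span[OF g(1)])
      show "x \<in> rat_vs.span B" using B(3) that by blast
      show "g b = 0" if "b \<in> B" for b using g(2) that yB by auto
    qed
    have g_ev: "g (ev h \<alpha>) = 0" for h
      using gW[OF evr_in_rat_span[of "map_poly of_int h"]] by (simp add: evr_of_int_poly)
    obtain D where D: "D > 0" "\<forall>x\<in>OK. \<exists>g. degree g < N \<and> of_int D * x = ev g \<theta>"
      using common_denominator by (elim exE conjE)
    obtain e where e: "e > 0" "\<forall>i\<in>{..<N}. of_int e * g (\<theta> ^ i) \<in> \<int>"
      using clear_denominators[of "{..<N}" "\<lambda>i. g (\<theta> ^ i)", OF finite_lessThan] by (elim exE conjE)
    \<comment> \<open>Elements of \<open>OK\<close> have denominator D in the powers of
      \<open>\<theta>\<close>, on which the functional has denominator e; so \<open>e * D\<close>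
      works uniformly on \<open>OK\<close>.\<close>
    have int: "of_int (e * D) * g z \<in> \<int>" if z: "z \<in> OK" for z
    proof -
      obtain h where h: "degree h < N" "of_int D * z = ev h \<theta>" using bspec[OF D(2) z] by (elim exE conjE)
      have "degree (map_poly of_int h :: rat poly) < N" using h(1) by (simp add: degree_map_poly)
      from evr_bounded_degree[OF this, of \<theta>]
      have eq: "of_rat (of_int D) * z = (\<Sum>i<N. of_rat (of_int (coeff h i)) * \<theta> ^ i)"
        using h(2) by (simp add: evr_of_int_poly coeff_map_poly)
      have "g (of_rat (of_int D) * z) = (\<Sum>i<N. of_int (coeff h i) * g (\<theta> ^ i))"
        unfolding eq by (simp only: g.sum g.scale)
      then have gD: "of_int D * g z = (\<Sum>i<N. of_int (coeff h i) * g (\<theta> ^ i))"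
        by (simp only: g.scale)
      have "of_int (e * D) * g z = of_int e * (of_int D * g z)" by simp
      also have "\<dots> = (\<Sum>i<N. of_int (coeff h i) * (of_int e * g (\<theta> ^ i)))"
        unfolding gD by (simp only: sum_distrib_left mult.left_commute)
      also have "\<dots> \<in> \<int>" by (rule Ints_sum, rule Ints_mult[OF Ints_of_int], rule bspec[OF e(2)])
      finally show ?thesis .
    qed
    have power: "\<exists>h. \<exists>z\<in>OK. y = ev h \<alpha> + of_nat p ^ k * z" for k
      by (rule monogenic_mod_prime_power[OF mono y])
    \<comment> \<open>The functional kills Z[\<alpha>] and is 1 at y, so the decomposition of y
      modulo p^k gives 1 = p^k g(z) with z in \<open>OK\<close>.\<close>
    have "int p ^ k dvd e * D" for k
    proof -
      obtain h z where z: "z \<in> OK" "y = ev h \<alpha> + of_nat p ^ k * z"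
        using power[of k] by (elim exE bexE)
      have "1 = g y" using g(2) by simp
      also have "\<dots> = g (of_rat (of_nat p ^ k) * z)" unfolding z(2) g.add g_ev by (simp add: of_rat_power)
      also have "\<dots> = of_nat p ^ k * g z" by (simp only: g.scale)
      finally have one: "1 = of_nat p ^ k * g z" .
      obtain m where m: "of_int (e * D) * g z = of_int m" using int[OF z(1)] by (elim Ints_cases)
      have "of_int (e * D) = of_int (e * D) * (of_nat p ^ k * g z)" unfolding one[symmetric] by simp
      also have "\<dots> = of_nat p ^ k * (of_int (e * D) * g z)" by (simp only: mult.left_commute)
      also have "\<dots> = of_int (int p ^ k * m)" unfolding m by simp
      finally have "of_int (e * D) = (of_int (int p ^ k * m) :: rat)" .
      then have "e * D = int p ^ k * m" by (simp only: of_int_eq_iff)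
      then show ?thesis by simp
    qed
    then have "int p ^ nat (e * D) \<le> e * D" using e(1) D(1) by (intro zdvd_imp_le) simp_all
    moreover have "e * D < int p ^ nat (e * D)"
    proof -
      have "nat (e * D) < p ^ nat (e * D)" using p by (intro power_gt_expt) simp
      then have "int (nat (e * D)) < int (p ^ nat (e * D))" by (simp only: of_nat_less_iff)
      then show ?thesis using e(1) D(1) by simp
    qed
    ultimately show False by simp
  qed
qed

text \<open>The index is prime to p because the quotient of \<open>OK\<close> by Z[\<alpha>] has no
  p-torsion: it is annihilated by an integer \<open>M'\<close> prime to p, and a Bezout combination
  of p and \<open>M'\<close> is 1.\<close>

theorem index_coprime_if_monogenic_mod_p:
  assumes p: "prime p" and \<alpha>: "\<alpha> \<in> OK"
    and mono: "\<And>y. y \<in> OK \<Longrightarrow> \<exists>h. \<exists>z\<in>OK. y = ev h \<alpha> + of_nat p * z"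
  shows "K = rat_adjoin \<alpha>" "\<not> p dvd index_of_element K \<alpha>"
proof -
  let ?W = "rat_vs.span (range (\<lambda>i. \<alpha> ^ i))" and ?Z = "int_adjoin \<alpha>"
  have p1: "p > 1" using p prime_gt_1_nat by blast
  have W: "OK \<subseteq> ?W" by (rule OK_subset_span_if_monogenic_mod_p[OF p1 mono])
  have "\<theta> \<in> rat_adjoin \<alpha>"
    by (rule subsetD[OF rat_span_powers_subset[OF subfield_rat_adjoin mem_rat_adjoin] subsetD[OF W theta_in_OK]])
  then have "rat_adjoin \<theta> \<subseteq> rat_adjoin \<alpha>" by (rule rat_adjoin_subset[OF subfield_rat_adjoin])
  moreover have aK: "\<alpha> \<in> K" using \<alpha> by (simp add: OK_iff)
  then have "rat_adjoin \<alpha> \<subseteq> K" by (rule rat_adjoin_subset[OF subfield_K])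
  ultimately show "K = rat_adjoin \<alpha>" unfolding K_eq by (rule equalityI)
  obtain D where D: "D > 0" "\<forall>x\<in>OK. \<exists>g. degree g < N \<and> of_int D * x = ev g \<theta>"
    using common_denominator by (elim exE conjE)
  have "\<exists>e :: int. e > 0 \<and> of_int e * \<theta> ^ i \<in> ?Z" for i
  proof -
    have "\<theta> ^ i \<in> OK" using ev_theta_in_OK[of "monom 1 i"] by simp
    then obtain h where h: "\<theta> ^ i = evr h \<alpha>" using rat_span_powers_evr W by blast
    show ?thesis unfolding h by (rule clear_denominators_evr)
  qed
  then have "\<exists>e. \<forall>i. (e i :: int) > 0 \<and> of_int (e i) * \<theta> ^ i \<in> ?Z" by (intro choice allI)
  then obtain e :: "nat \<Rightarrow> int" where e: "\<forall>i. e i > 0 \<and> of_int (e i) * \<theta> ^ i \<in> ?Z" by (elim exE)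
  define M where "M = prod e {..<N} * D"
  have M_pos: "M > 0" unfolding M_def using e D(1) by (intro mult_pos_pos prod_pos) simp_all
  have M: "of_int M * x \<in> ?Z" if x: "x \<in> OK" for x
  proof -
    obtain h where h: "degree h < N" "of_int D * x = ev h \<theta>" using bspec[OF D(2) x] by (elim exE conjE)
    have "degree (map_poly of_int h :: rat poly) < N" using h(1) by (simp add: degree_map_poly)
    from evr_bounded_degree[OF this, of \<theta>]
    have "ev h \<theta> = (\<Sum>i<N. of_int (coeff h i) * \<theta> ^ i)"
      by (simp add: evr_of_int_poly coeff_map_poly)
    then have "of_int M * x = (\<Sum>i<N. of_int (prod e {..<N}) * (of_int (coeff h i) * \<theta> ^ i))"
      using h(2) by (simp add: M_def mult.assoc sum_distrib_left)
    also have "\<dots> \<in> ?Z"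
    proof (rule int_adjoin_sum)
      fix i assume i: "i \<in> {..<N}"
      have eq: "of_int (prod e {..<N}) * (of_int (coeff h i) * \<theta> ^ i) =
        of_int (prod e ({..<N} - {i}) * coeff h i) * (of_int (e i) * \<theta> ^ i)"
        using i by (simp add: prod.remove[of "{..<N}" i] mult_ac)
      show "of_int (prod e {..<N}) * (of_int (coeff h i) * \<theta> ^ i) \<in> ?Z"
        unfolding eq by (rule int_adjoin_closed(3)[OF conjunct2[OF spec[OF e]]])
    qed
    finally show ?thesis .
  qed
  obtain n where n: "n > 0" "\<forall>h. ev h \<alpha> \<in> int_span (\<lambda>i. \<alpha> ^ i) {..<n}"
    using algebraic_int_power_span[of \<alpha>] \<alpha> by (auto simp: OK_iff)
  have rep: "\<exists>g. degree g < n \<and> of_int M * x = ev g \<alpha>" if x: "x \<in> OK" for x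
  proof -
    obtain h where "of_int M * x = ev h \<alpha>" using M[OF x] by (auto simp: int_adjoin_eq)
    with spec[OF n(2), of h] obtain c where c: "of_int M * x = (\<Sum>i<n. of_int (c i) * \<alpha> ^ i)"
      by (auto simp: int_span_def)
    have "degree (\<Sum>i<n. monom (c i) i) < n"
      using n(1) by (intro degree_sum_less) (auto intro: le_less_trans[OF degree_monom_le])
    then show ?thesis using c by (intro exI[of _ "\<Sum>i<n. monom (c i) i"]) simp
  qed
  \<comment> \<open>Taking M also as modulus, equal classes mean equal cosets of Z[\<alpha>].
    Finiteness is essential: \<open>card\<close> of an infinite set would be 0, which p
    divides.\<close>
  have "\<exists>\<phi> :: 'a \<Rightarrow> int list. finite (\<phi> ` OK) \<and>
    (\<forall>x\<in>OK. \<forall>y\<in>OK. \<phi> x = \<phi> y \<longrightarrow> (\<exists>g. of_int M * (x - y) = of_int M * ev g \<alpha>))"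
    by (rule finite_coefficient_classes[OF rep M_pos])
  then obtain \<phi> :: "'a \<Rightarrow> int list" where phi: "finite (\<phi> ` OK)"
    "\<forall>x\<in>OK. \<forall>y\<in>OK. \<phi> x = \<phi> y \<longrightarrow> (\<exists>g. of_int M * (x - y) = of_int M * ev g \<alpha>)"
    by (elim exE conjE)
  define coset where "coset x = {x + z | z. z \<in> ?Z}" for x
  have coset_eq: "coset x = coset y" if xy: "x \<in> OK" "y \<in> OK" "\<phi> x = \<phi> y" for x y
  proof -
    obtain g where "of_int M * (x - y) = of_int M * ev g \<alpha>" using phi(2) xy by blast
    then have "x - y = ev g \<alpha>" using M_pos by simp
    then have 1: "x - y \<in> ?Z" by (simp add: int_adjoin_eq)
    have 2: "y - x \<in> ?Z" using int_adjoin_closed(4)[OF 1] by simp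
    have "x + z = y + ((x - y) + z)" "y + z = x + ((y - x) + z)" for z by simp_all
    then show ?thesis unfolding coset_def using int_adjoin_closed(2)[OF 1] int_adjoin_closed(2)[OF 2] by blast
  qed
  have "coset ` OK \<subseteq> (\<lambda>v. coset (inv_into OK \<phi> v)) ` (\<phi> ` OK)"
  proof (rule image_subsetI)
    fix x assume x: "x \<in> OK"
    then have im: "\<phi> x \<in> \<phi> ` OK" by simp
    have "coset x = coset (inv_into OK \<phi> (\<phi> x))"
      by (rule coset_eq[OF x inv_into_into[OF im]]) (simp add: f_inv_into_f[OF im])
    then show "coset x \<in> (\<lambda>v. coset (inv_into OK \<phi> v)) ` (\<phi> ` OK)" using im by (rule image_eqI)
  qed
  then have fin: "finite (coset ` OK)" by (rule finite_subset) (simp add: phi(1))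
  define v where "v = multiplicity (int p) M"
  have M0: "M \<noteq> 0" "\<not> is_unit (int p)" using M_pos p1 by auto
  then obtain M' where M': "M = int p ^ v * M'" "\<not> int p dvd M'"
    unfolding v_def using multiplicity_decompose'[OF M0] by metis
  have M'Z: "of_int M' * x \<in> ?Z" if x: "x \<in> OK" for x
  proof -
    have "\<exists>h. \<exists>z\<in>OK. x = ev h \<alpha> + of_nat p ^ v * z"
      by (rule monogenic_mod_prime_power[OF mono x])
    then obtain h z where z: "z \<in> OK" "x = ev h \<alpha> + of_nat p ^ v * z" by (elim exE bexE)
    have "of_int M' * x = of_int M' * ev h \<alpha> + of_int M * z"
      unfolding z(2) M'(1) by (simp add: algebra_simps)
    moreover have "of_int M' * ev h \<alpha> \<in> ?Z" by (intro int_adjoin_closed(3)) (simp add: int_adjoin_eq)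
    ultimately show ?thesis using int_adjoin_closed(2) M[OF z(1)] by simp
  qed
  have "\<not> p dvd card ((\<lambda>x. {x + z | z. z \<in> ?Z}) ` OK)"
  proof (rule prime_not_dvd_card_cosets[OF p])
    show "0 \<in> OK" by (simp add: OK_iff K_closed)
    show "?Z \<subseteq> OK"
    proof
      fix x assume "x \<in> ?Z"
      then obtain h where h: "x = ev h \<alpha>" by (auto simp: int_adjoin_eq)
      have "evr (map_poly of_int h) \<alpha> \<in> K" by (rule subfield_evr[OF subfield_K aK])
      moreover have "algebraic_int (ev h \<alpha>)" by (rule algebraic_int_ev) (use \<alpha> in \<open>simp add: OK_iff\<close>)
      ultimately show "x \<in> OK" by (simp add: OK_iff h evr_of_int_poly)
    qed
    show "finite ((\<lambda>x. {x + z | z. z \<in> ?Z}) ` OK)" using fin unfolding coset_def .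
    fix y assume y: "y \<in> OK" "of_nat p * y \<in> ?Z"
    have "coprime (int p) M'" using p M'(2) by (intro prime_imp_coprime) auto
    then have "gcd (int p) M' = 1" by (simp only: coprime_iff_gcd_eq_1)
    with bezout_int[of "int p" M'] obtain s t where st: "s * int p + t * M' = 1" by auto
    have "of_int s * (of_nat p * y) + of_int t * (of_int M' * y) = of_int (s * int p + t * M') * y"
      by (simp add: algebra_simps)
    then have "of_int s * (of_nat p * y) + of_int t * (of_int M' * y) = y" unfolding st by simp
    moreover have "of_int s * (of_nat p * y) + of_int t * (of_int M' * y) \<in> ?Z"
      by (rule int_adjoin_closed(2)[OF int_adjoin_closed(3)[OF y(2)] int_adjoin_closed(3)[OF M'Z[OF y(1)]]])
    ultimately show "y \<in> ?Z" by simp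
  qed (simp_all add: OK_closed int_adjoin_closed)
  then show "\<not> p dvd index_of_element K \<alpha>" by (simp add: index_of_element_def OK_def)
qed

end

theorem theorem1p7:
  fixes a b :: int and f :: "rat poly" and \<theta> :: "'a::field_char_0"
    and K :: "'a set" and p :: nat
  assumes "f = monom 1 7 + monom (of_int a) 1 + [:of_int b:]"
    and "irreducible f"
    and "poly (map_poly of_rat f) \<theta> = 0"
    and "K = rat_adjoin \<theta>"
    and "prime p" and "p \<ge> 5"
  shows "\<not> p dvd field_index K"
proof
  assume dvd: "p dvd field_index K"
  define F where "F = monom 1 7 + monom a 1 + [:b:]"
  have fF: "f = map_poly of_int F"
    unfolding assms(1) F_def by (rule poly_eqI) (simp add: coeff_map_poly coeff_pCons split: nat.split)
  have coeff_F: "coeff F 7 = 1" by (simp add: F_def numeral_eq_Suc)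
  have "degree F \<le> 7" unfolding F_def
    by (intro degree_add_le order_trans[OF degree_monom_le]) (simp_all add: degree_pCons_le)
  then have deg: "degree F = 7" using coeff_F le_degree[of F 7] by simp
  have ev_F: "ev F \<theta> = 0" using assms(3) by (simp add: fF evr_def[symmetric] evr_of_int_poly)
  interpret E: simple_extension f F \<theta> 7
    by unfold_locales (use fF coeff_F deg assms(2) ev_F in simp_all)
  interpret P: p_maximal_order E.OK p 7 by (rule E.p_maximal_order_OK[OF assms(5)])
  have K: "K = E.K" using E.K_eq assms(4) by simp
  obtain D where D: "D > 0" "\<forall>x\<in>E.OK. \<exists>g. degree g < 7 \<and> of_int D * x = ev g \<theta>"
    using E.common_denominator by (elim exE conjE)
  have root: "\<theta> ^ 7 + of_int a * \<theta> + of_int b = 0" using ev_F by (simp add: F_def)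
  have "\<exists>x\<in>E.OK. \<forall>y\<in>E.OK. \<exists>h. y - ev h x \<in> P.pR"
    by (rule P.monogenic_mod_p_trinomial[OF assms(6) refl E.theta_in_OK root, of D]) (use D in auto)
  then obtain x where x: "x \<in> E.OK" "\<forall>y\<in>E.OK. \<exists>h. y - ev h x \<in> P.pR" by (elim bexE)
  have mono: "\<exists>h. \<exists>z\<in>E.OK. y = ev h x + of_nat p * z" if y: "y \<in> E.OK" for y
  proof -
    obtain h z where "z \<in> E.OK" "y - ev h x = of_nat p * z" using x(2) y unfolding P.pR_def by blast
    then show ?thesis by (intro exI[of _ h] bexI[of _ z]) (simp_all add: algebra_simps)
  qed
  have "K = rat_adjoin x" "\<not> p dvd index_of_element K x"
    using E.index_coprime_if_monogenic_mod_p[OF assms(5) x(1) mono] K by simp_all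
  moreover have "x \<in> ring_of_integers K" using x(1) K by (simp add: E.OK_def)
  ultimately have "field_index K dvd index_of_element K x"
    unfolding field_index_def by (intro Gcd_dvd) blast
  then show False using dvd dvd_trans \<open>\<not> p dvd index_of_element K x\<close> by blast
qed

end
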